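(* Let $n\ge2$, $Z=\{1,2,\dots,n\}$, $1\le r\le n-1$, and let $X$ be the family of all $r$-subsets of $Z$. A decomposition of the permutation representation of $C_2\wr S_n$ on $C_2^Z\times X$ is given by \[ L(C_2^Z\times X)=\bigoplus_{k=0}^{n}\ \bigoplus_{i=\max\{0,r+k-n\}}^{\min\{k,r\}}\ \bigoplus_{l=0}^{\min\{i,k-i\}}\ \bigoplus_{m=0}^{\min\{n-k-r+i,\,r-i\}}W^i_{k;l,m}, \] where $W^i_{k;l,m}$ is the linear span of the functions $\chi_\theta\otimes(f_1\otimes f_2)\in L(C_2^Z)\otimes L(X)$ with $\theta\in C_2^Z$, $|Z_\theta|=k$, $f_1\in S_i^{k-l,l}(Z_\theta)$ and $f_2\in S_{r-i}^{n-k-m,m}(Z\setminus Z_\theta)$. Moreover, the representation of $C_2\wr S_n$ on $W^i_{k;l,m}$ is isomorphic to the irreducible representation $\rho_{[(k-l,l);(n-k-m,m)]}$.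
   Context: $C_2=\{0,1\}$ with addition mod $2$; $S_n$ acts on $C_2^Z$ (functions $Z\to C_2$) by $(g\omega)(z)=\omega(g^{-1}z)$. $C_2\wr S_n$ is the set $C_2^Z\times S_n$ with product $(\theta,g)(\omega,h)=(\theta+g\omega,gh)$, acting on $C_2^Z\times X$ by $(\omega,g)(\theta,x)=(\omega+g\theta,gx)$ and on $L(C_2^Z\times X)$ (complex functions) by $(af)(b)=f(a^{-1}b)$. For $\theta\in C_2^Z$: $Z_\theta=\{z:\theta(z)=0\}$, $\chi_\theta(\omega)=(-1)^{\sum_z\theta(z)\omega(z)}$. $(F\otimes f)(\omega,x)=F(\omega)f(x)$. For $\lambda$ a partition of $t$, $\rho_\lambda$ (space $S^\lambda$) is the irreducible representation of $S_t$ canonically associated to $\lambda$ (Specht module). For a finite set $A$ with $|A|=k$ and $0\le l\le k$, $M^{k-l,l}(A)$ is the space of complex functions on the $l$-subsets of $A$, a representation of the symmetric group on $A$; it decomposes without multiplicity as $M^{k-l,l}(A)=\bigoplus_{j=0}^{\min\{l,k-l\}}S_l^{k-j,j}(A)$, where $S_l^{k-j,j}(A)$ is the unique subspace isomorphic to $S^{k-j,j}$. For $f_1$ a function on the $i$-subsets of $Z_\theta$ and $f_2$ a function on the $(r-i)$-subsets of $Z\setminus Z_\theta$, $f_1\otimes f_2\in L(X)$ is the function with $(f_1\otimes f_2)(A)=f_1(A\cap Z_\theta)f_2(A\setminus Z_\theta)$ if $|A\cap Z_\theta|=i$ and $0$ otherwise. For $0\le k\le n$ fix $\theta^{(k)}\in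 C_2^Z$ with $|Z_{\theta^{(k)}}|=k$; its stabilizer in $S_n$ is $S_k\times S_{n-k}$, where $S_k$ permutes $Z_{\theta^{(k)}}$ and $S_{n-k}$ permutes its complement. For $\lambda\vdash k$, $\mu\vdash n-k$, $\rho_{[\lambda;\mu]}=\mathrm{Ind}_{C_2\wr(S_k\times S_{n-k})}^{C_2\wr S_n}[\tilde\chi_{\theta^{(k)}}\otimes(\rho_\lambda\otimes\rho_\mu)^\#]$, where $\tilde\chi_{\theta^{(k)}}\otimes(\rho_\lambda\otimes\rho_\mu)^\#$ is the representation $(\omega,g)\mapsto\chi_{\theta^{(k)}}(\omega)(\rho_\lambda\otimes\rho_\mu)(g)$ of $C_2\wr(S_k\times S_{n-k})=\{(\omega,g):\omega\in C_2^Z,\ g\in S_k\times S_{n-k}\}$. *)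

theory Defs
  imports Complex_Main "HOL-Library.Function_Algebras" "HOL-Library.Z2" "HOL-Algebra.Sym_Groups"
begin

class complex_vector = ab_group_add +
  fixes scaleC :: "complex \<Rightarrow> 'a \<Rightarrow> 'a" (infixr \<open>*\<^sub>C\<close> 75)
  assumes scaleC_add_right: "a *\<^sub>C (x + y) = a *\<^sub>C x + a *\<^sub>C y"
    and scaleC_add_left: "(a + b) *\<^sub>C x = a *\<^sub>C x + b *\<^sub>C x"
    and scaleC_scaleC: "a *\<^sub>C b *\<^sub>C x = (a * b) *\<^sub>C x"
    and scaleC_one: "1 *\<^sub>C x = x"

global_interpretation cvec: vector_space "scaleC :: complex \<Rightarrow> 'a \<Rightarrow> 'a :: complex_vector"
  by unfold_locales (rule scaleC_add_right scaleC_add_left scaleC_scaleC scaleC_one)+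

instantiation complex :: complex_vector
begin
definition scaleC_complex :: "complex \<Rightarrow> complex \<Rightarrow> complex"
  where "scaleC_complex c x = c * x"
instance
  by standard (simp_all add: scaleC_complex_def algebra_simps)
end

instantiation "fun" :: (type, complex_vector) complex_vector
begin
definition scaleC_fun :: "complex \<Rightarrow> ('a \<Rightarrow> 'b) \<Rightarrow> 'a \<Rightarrow> 'b"
  where "scaleC_fun c f = (\<lambda>x. c *\<^sub>C f x)"
instance
  by standard (simp_all add: scaleC_fun_def fun_eq_iff
      scaleC_add_right scaleC_add_left scaleC_scaleC scaleC_one)
end

text \<open>\<open>L(Y)\<close>: a complex function on the set \<open>Y\<close> is represented by its extension by zero.\<close>

definition functions_on :: "'a set \<Rightarrow> ('a \<Rightarrow> complex) set"
  where "functions_on Y = {f. \<forall>y. y \<notin> Y \<longrightarrow> f y = 0}"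

definition tensor_fun :: "('a \<Rightarrow> complex) \<Rightarrow> ('b \<Rightarrow> complex) \<Rightarrow> 'a \<times> 'b \<Rightarrow> complex"
  where "tensor_fun F f = (\<lambda>(x, y). F x * f y)"

definition tensor_space ::
    "('a \<Rightarrow> complex) set \<Rightarrow> ('b \<Rightarrow> complex) set \<Rightarrow> ('a \<times> 'b \<Rightarrow> complex) set"
  where "tensor_space V W = cvec.span {tensor_fun v w | v w. v \<in> V \<and> w \<in> W}"

text \<open>The operator \<open>T \<otimes> S\<close>: apply \<open>S\<close> in the second variable, then \<open>T\<close> in the first. If
  \<open>T\<close> is linear on \<open>V\<close> and \<open>S\<close> on \<open>W\<close>, it is linear on \<open>tensor_space V W\<close>, where it
  sends \<open>v \<otimes> w\<close> to \<open>T v \<otimes> S w\<close>.\<close>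

definition tensor_op ::
    "(('a \<Rightarrow> complex) \<Rightarrow> 'a \<Rightarrow> complex) \<Rightarrow> (('b \<Rightarrow> complex) \<Rightarrow> 'b \<Rightarrow> complex)
      \<Rightarrow> ('a \<times> 'b \<Rightarrow> complex) \<Rightarrow> 'a \<times> 'b \<Rightarrow> complex"
  where "tensor_op T S f = (\<lambda>(x, y). T (\<lambda>x'. S (\<lambda>y'. f (x', y')) y) x)"

definition is_direct_sum :: "'v::complex_vector set \<Rightarrow> 'i set \<Rightarrow> ('i \<Rightarrow> 'v set) \<Rightarrow> bool"
  where "is_direct_sum V I W \<longleftrightarrow> finite I
    \<and> (\<forall>i\<in>I. cvec.subspace (W i) \<and> W i \<subseteq> V)
    \<and> (\<forall>v\<in>V. \<exists>!w. w \<in> Pi\<^sub>E I W \<and> v = (\<Sum>i\<in>I. w i))"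

definition linear_on :: "'v::complex_vector set \<Rightarrow> ('v \<Rightarrow> 'w::complex_vector) \<Rightarrow> bool"
  where "linear_on V T \<longleftrightarrow> (\<forall>u\<in>V. \<forall>v\<in>V. T (u + v) = T u + T v)
    \<and> (\<forall>c. \<forall>v\<in>V. T (c *\<^sub>C v) = c *\<^sub>C T v)"

text \<open>Only the values \<open>\<rho> g v\<close> with \<open>g \<in> carrier G\<close> and \<open>v \<in> V\<close> matter.\<close>

locale group_rep = group G for G (structure) +
  fixes V :: "'v::complex_vector set" and \<rho> :: "'a \<Rightarrow> 'v \<Rightarrow> 'v"
  assumes subspace: "cvec.subspace V"
    and linear: "g \<in> carrier G \<Longrightarrow> linear_on V (\<rho> g)"
    and closed: "g \<in> carrier G \<Longrightarrow> v \<in> V \<Longrightarrow> \<rho> g v \<in> V"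
    and rep_one: "v \<in> V \<Longrightarrow> \<rho> \<one> v = v"
    and rep_mult: "g \<in> carrier G \<Longrightarrow> h \<in> carrier G \<Longrightarrow> v \<in> V \<Longrightarrow> \<rho> (g \<otimes> h) v = \<rho> g (\<rho> h v)"

definition irreducible_rep ::
    "('g, 'x) monoid_scheme \<Rightarrow> 'v::complex_vector set \<Rightarrow> ('g \<Rightarrow> 'v \<Rightarrow> 'v) \<Rightarrow> bool"
  where "irreducible_rep G V \<rho> \<longleftrightarrow> group_rep G V \<rho> \<and> V \<noteq> {0}
    \<and> (\<forall>U. U \<subseteq> V \<and> group_rep G U \<rho> \<longrightarrow> U = {0} \<or> U = V)"

definition rep_iso ::
    "('g, 'x) monoid_scheme \<Rightarrow> 'v::complex_vector set \<Rightarrow> ('g \<Rightarrow> 'v \<Rightarrow> 'v)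
      \<Rightarrow> 'w::complex_vector set \<Rightarrow> ('g \<Rightarrow> 'w \<Rightarrow> 'w) \<Rightarrow> bool"
  where "rep_iso G V \<rho> W \<sigma> \<longleftrightarrow> group_rep G V \<rho> \<and> group_rep G W \<sigma>
    \<and> (\<exists>T. linear_on V T \<and> bij_betw T V W
        \<and> (\<forall>g\<in>carrier G. \<forall>v\<in>V. T (\<rho> g v) = \<sigma> g (T v)))"

text \<open>The permutation representation \<open>(a f)(b) = f(a\<inverse> b)\<close> attached to an action \<open>act\<close>.\<close>

definition perm_rep ::
    "('g, 'x) monoid_scheme \<Rightarrow> ('g \<Rightarrow> 'b \<Rightarrow> 'b) \<Rightarrow> 'g \<Rightarrow> ('b \<Rightarrow> complex) \<Rightarrow> 'b \<Rightarrow> complex"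
  where "perm_rep G act a f = (\<lambda>b. f (act (inv\<^bsub>G\<^esub> a) b))"

text \<open>The representation of \<open>G\<close> induced from the representation \<open>\<sigma>\<close> of the subgroup \<open>H\<close> on \<open>V\<close>:
  the functions \<open>F : G \<rightarrow> V\<close> (extended by zero) with \<open>F(g h) = \<sigma>(h\<inverse>) F(g)\<close>, under left translation.\<close>

definition ind_space ::
    "('g, 'x) monoid_scheme \<Rightarrow> 'g set \<Rightarrow> 'v::complex_vector set \<Rightarrow> ('g \<Rightarrow> 'v \<Rightarrow> 'v) \<Rightarrow> ('g \<Rightarrow> 'v) set"
  where "ind_space G H V \<sigma> = {F. (\<forall>g. g \<notin> carrier G \<longrightarrow> F g = 0) \<and> (\<forall>g\<in>carrier G. F g \<in> V)
    \<and> (\<forall>g\<in>carrier G. \<forall>h\<in>H. F (g \<otimes>\<^bsub>G\<^esub> h) = \<sigma> (inv\<^bsub>G\<^esub> h) (F g))}"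

definition ind_rep ::
    "('g, 'x) monoid_scheme \<Rightarrow> 'g \<Rightarrow> ('g \<Rightarrow> 'v::complex_vector) \<Rightarrow> 'g \<Rightarrow> 'v"
  where "ind_rep G a F = (\<lambda>g. if g \<in> carrier G then F (inv\<^bsub>G\<^esub> a \<otimes>\<^bsub>G\<^esub> g) else 0)"

definition sym_on :: "'a set \<Rightarrow> ('a \<Rightarrow> 'a) monoid"
  where "sym_on A = \<lparr> carrier = {p. p permutes A}, mult = (\<circ>), one = id \<rparr>"

text \<open>A partition is a weakly decreasing list of natural numbers; trailing zeros are harmless, so
  that \<open>(k - l, l)\<close> is \<open>[k - l, l]\<close> also for \<open>l = 0\<close>. Tableaux have their entries in an arbitrary
  set \<open>A\<close> with as many elements as the diagram, so that the Specht module \<open>S\<^sup>\<lambda>\<close> is a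
  representation of the symmetric group on \<open>A\<close>.\<close>

definition diagram :: "nat list \<Rightarrow> (nat \<times> nat) set"
  where "diagram lam = {(i, j). i < length lam \<and> j < lam ! i}"

definition tableaux :: "nat list \<Rightarrow> 'a set \<Rightarrow> (nat \<times> nat \<Rightarrow> 'a) set"
  where "tableaux lam A = {t. bij_betw t (diagram lam) A}"

text \<open>A tabloid is the list of the rows (as sets) of a tableau.\<close>

definition tabloid :: "nat list \<Rightarrow> (nat \<times> nat \<Rightarrow> 'a) \<Rightarrow> 'a set list"
  where "tabloid lam t = map (\<lambda>i. (\<lambda>j. t (i, j)) ` {..<lam ! i}) [0..<length lam]"

definition tabloid_act :: "('a \<Rightarrow> 'a) \<Rightarrow> 'a set list \<Rightarrow> 'a set list"
  where "tabloid_act g T = map (\<lambda>R. g ` R) T"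

definition column_stabilizer :: "nat list \<Rightarrow> 'a set \<Rightarrow> (nat \<times> nat \<Rightarrow> 'a) \<Rightarrow> ('a \<Rightarrow> 'a) set"
  where "column_stabilizer lam A t = {s. s permutes A
    \<and> (\<forall>(i, j) \<in> diagram lam. \<exists>i'. (i', j) \<in> diagram lam \<and> s (t (i, j)) = t (i', j))}"

definition polytabloid :: "nat list \<Rightarrow> 'a set \<Rightarrow> (nat \<times> nat \<Rightarrow> 'a) \<Rightarrow> 'a set list \<Rightarrow> complex"
  where "polytabloid lam A t = (\<lambda>T. \<Sum>s\<in>column_stabilizer lam A t.
    if T = tabloid_act s (tabloid lam t) then of_int (sign s) else 0)"

definition specht :: "nat list \<Rightarrow> 'a set \<Rightarrow> ('a set list \<Rightarrow> complex) set"
  where "specht lam A = cvec.span (polytabloid lam A ` tableaux lam A)"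

definition specht_rep ::
    "'a set \<Rightarrow> ('a \<Rightarrow> 'a) \<Rightarrow> ('a set list \<Rightarrow> complex) \<Rightarrow> 'a set list \<Rightarrow> complex"
  where "specht_rep A = perm_rep (sym_on A) tabloid_act"

definition subsets_of_card :: "'a set \<Rightarrow> nat \<Rightarrow> 'a set set"
  where "subsets_of_card A l = {B. B \<subseteq> A \<and> card B = l}"

text \<open>\<open>M\<^bsup>k-l,l\<^esup>(A)\<close> with \<open>k = card A\<close>, and its group action.\<close>

definition M_space :: "'a set \<Rightarrow> nat \<Rightarrow> ('a set \<Rightarrow> complex) set"
  where "M_space A l = functions_on (subsets_of_card A l)"

definition M_rep :: "'a set \<Rightarrow> ('a \<Rightarrow> 'a) \<Rightarrow> ('a set \<Rightarrow> complex) \<Rightarrow> 'a set \<Rightarrow> complex"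
  where "M_rep A = perm_rep (sym_on A) (\<lambda>g B. g ` B)"

text \<open>\<open>S\<^sub>l\<^bsup>k-j,j\<^esup>(A)\<close> with \<open>k = card A\<close>, meaningful for \<open>j \<le> min l (k - l)\<close>.\<close>

definition S_component :: "'a set \<Rightarrow> nat \<Rightarrow> nat \<Rightarrow> ('a set \<Rightarrow> complex) set"
  where "S_component A l j = (THE V. V \<subseteq> M_space A l
    \<and> rep_iso (sym_on A) V (M_rep A) (specht [card A - j, j] A) (specht_rep A))"

text \<open>\<open>C\<^sub>2\<close> is the additive group of \<^typ>\<open>bit\<close>, and \<open>C\<^sub>2\<^sup>Z\<close>, for \<open>Z = {1..n}\<close>, consists of the
  functions vanishing outside \<open>Z\<close>, with pointwise addition.\<close>

definition C2_pow :: "nat \<Rightarrow> (nat \<Rightarrow> bit) set"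
  where "C2_pow n = {\<omega>. \<forall>z. z \<notin> {1..n} \<longrightarrow> \<omega> z = 0}"

definition C2_act :: "(nat \<Rightarrow> nat) \<Rightarrow> (nat \<Rightarrow> bit) \<Rightarrow> nat \<Rightarrow> bit"
  where "C2_act g \<omega> = (\<lambda>z. \<omega> (inv' g z))"

definition wreath :: "nat \<Rightarrow> ((nat \<Rightarrow> bit) \<times> (nat \<Rightarrow> nat)) monoid"
  where "wreath n = \<lparr> carrier = C2_pow n \<times> carrier (sym_group n),
    mult = (\<lambda>(\<theta>, g) (\<omega>, h). (\<theta> + C2_act g \<omega>, g \<circ> h)), one = (0, id) \<rparr>"

definition wreath_act ::
    "(nat \<Rightarrow> bit) \<times> (nat \<Rightarrow> nat) \<Rightarrow> (nat \<Rightarrow> bit) \<times> nat set \<Rightarrow> (nat \<Rightarrow> bit) \<times> nat set"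
  where "wreath_act = (\<lambda>(\<omega>, g) (\<theta>, x). (\<omega> + C2_act g \<theta>, g ` x))"

definition wreath_perm_rep :: "nat \<Rightarrow> (nat \<Rightarrow> bit) \<times> (nat \<Rightarrow> nat)
    \<Rightarrow> ((nat \<Rightarrow> bit) \<times> nat set \<Rightarrow> complex) \<Rightarrow> (nat \<Rightarrow> bit) \<times> nat set \<Rightarrow> complex"
  where "wreath_perm_rep n = perm_rep (wreath n) wreath_act"

definition zeros :: "nat \<Rightarrow> (nat \<Rightarrow> bit) \<Rightarrow> nat set"
  where "zeros n \<theta> = {z \<in> {1..n}. \<theta> z = 0}"

text \<open>The sum \<open>\<Sum>\<^sub>z \<theta>(z)\<omega>(z)\<close> is taken in \<open>C\<^sub>2\<close>, so the case distinction is \<open>(-1)\<close> to that power.\<close>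

definition chi :: "nat \<Rightarrow> (nat \<Rightarrow> bit) \<Rightarrow> (nat \<Rightarrow> bit) \<Rightarrow> complex"
  where "chi n \<theta> \<omega> = (if \<omega> \<notin> C2_pow n then 0
    else if (\<Sum>z\<in>{1..n}. \<theta> z * \<omega> z) = 0 then 1 else - 1)"

definition stab :: "nat \<Rightarrow> (nat \<Rightarrow> bit) \<Rightarrow> (nat \<Rightarrow> nat) set"
  where "stab n \<theta> = {g \<in> carrier (sym_group n). C2_act g \<theta> = \<theta>}"

text \<open>\<open>(\<rho>\<^sub>\<lambda> \<otimes> \<rho>\<^sub>\<mu>)(g)\<close> for \<open>g\<close> in the stabilizer of \<open>\<theta>\<close>, which is the product of the symmetric
  groups on \<open>zeros n \<theta>\<close> and on its complement; the two components of \<open>g\<close> are its restrictions.\<close>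

definition specht_tensor_rep :: "nat \<Rightarrow> (nat \<Rightarrow> bit) \<Rightarrow> (nat \<Rightarrow> nat)
    \<Rightarrow> (nat set list \<times> nat set list \<Rightarrow> complex) \<Rightarrow> nat set list \<times> nat set list \<Rightarrow> complex"
  where "specht_tensor_rep n \<theta> g = (let A = zeros n \<theta>; B = {1..n} - zeros n \<theta> in
    tensor_op (specht_rep A (restrict_id g A)) (specht_rep B (restrict_id g B)))"

definition twisted_rep :: "nat \<Rightarrow> (nat \<Rightarrow> bit) \<Rightarrow> (nat \<Rightarrow> bit) \<times> (nat \<Rightarrow> nat)
    \<Rightarrow> (nat set list \<times> nat set list \<Rightarrow> complex) \<Rightarrow> nat set list \<times> nat set list \<Rightarrow> complex"
  where "twisted_rep n \<theta> = (\<lambda>(\<omega>, g) f. chi n \<theta> \<omega> *\<^sub>C specht_tensor_rep n \<theta> g f)"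

text \<open>The space of \<open>\<rho>\<^bsub>[\<lambda>;\<mu>]\<^esub>\<close>, constructed from the chosen \<open>\<theta> = \<theta>\<^sup>(\<^sup>k\<^sup>)\<close>; the group acts on it by
  \<open>ind_rep (wreath n)\<close>.\<close>

definition rho_space :: "nat \<Rightarrow> (nat \<Rightarrow> bit) \<Rightarrow> nat list \<Rightarrow> nat list
    \<Rightarrow> ((nat \<Rightarrow> bit) \<times> (nat \<Rightarrow> nat) \<Rightarrow> nat set list \<times> nat set list \<Rightarrow> complex) set"
  where "rho_space n \<theta> lam mu = ind_space (wreath n) (C2_pow n \<times> stab n \<theta>)
    (tensor_space (specht lam (zeros n \<theta>)) (specht mu ({1..n} - zeros n \<theta>)))
    (twisted_rep n \<theta>)"

definition L_space :: "nat \<Rightarrow> nat \<Rightarrow> ((nat \<Rightarrow> bit) \<times> nat set \<Rightarrow> complex) set"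
  where "L_space n r = functions_on (C2_pow n \<times> subsets_of_card {1..n} r)"

definition split_tensor :: "nat \<Rightarrow> nat \<Rightarrow> (nat \<Rightarrow> bit) \<Rightarrow> nat
    \<Rightarrow> (nat set \<Rightarrow> complex) \<Rightarrow> (nat set \<Rightarrow> complex) \<Rightarrow> nat set \<Rightarrow> complex"
  where "split_tensor n r \<theta> i f1 f2 = (\<lambda>A.
    if A \<in> subsets_of_card {1..n} r \<and> card (A \<inter> zeros n \<theta>) = i
    then f1 (A \<inter> zeros n \<theta>) * f2 (A - zeros n \<theta>) else 0)"

definition W_space ::
    "nat \<Rightarrow> nat \<Rightarrow> nat \<times> nat \<times> nat \<times> nat \<Rightarrow> ((nat \<Rightarrow> bit) \<times> nat set \<Rightarrow> complex) set"
  where "W_space n r = (\<lambda>(k, i, l, m). cvec.span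
    {tensor_fun (chi n \<theta>) (split_tensor n r \<theta> i f1 f2) | \<theta> f1 f2.
      \<theta> \<in> C2_pow n \<and> card (zeros n \<theta>) = k
      \<and> f1 \<in> S_component (zeros n \<theta>) i l
      \<and> f2 \<in> S_component ({1..n} - zeros n \<theta>) (r - i) m})"

text \<open>Natural-number subtraction truncates: \<open>r + k - n\<close> below is \<open>max {0, r + k - n}\<close>, and
  \<open>n - k - r + i\<close> is written \<open>n + i - (k + r)\<close>, which does not truncate on the given range of \<open>i\<close>.\<close>

definition W_index :: "nat \<Rightarrow> nat \<Rightarrow> (nat \<times> nat \<times> nat \<times> nat) set"
  where "W_index n r = {(k, i, l, m). k \<in> {0..n}
    \<and> i \<in> {max 0 (r + k - n)..min k r}
    \<and> l \<in> {0..min i (k - i)}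
    \<and> m \<in> {0..min (n + i - (k + r)) (r - i)}}"

end

theory Submission
  imports Defs
begin

text \<open>For a set \<open>p\<close> of \<open>j\<close> disjoint pairs in \<open>A\<close>, let \<open>alt_prod p B\<close> be the product over
  \<open>(a, b) \<in> p\<close> of \<open>[a \<in> B] - [b \<in> B]\<close>. Up to scalars it is the only function on the \<open>l\<close>-subsets of \<open>A\<close>
  that changes sign under the transpositions of the pairs and is fixed by those of the remaining
  points. On \<open>j\<close>-subsets these functions are the polytabloids of shape \<open>(|A| - j, j)\<close>, and on
  \<open>l\<close>-subsets an equivariant image of a polytabloid must be a multiple of one of them; so they span
  the component \<open>S\<^sub>l\<close> of type \<open>(|A| - j, j)\<close>. They are orthogonal for different \<open>j\<close>, and no nonzero
  function is orthogonal to all of them.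

  The spaces \<open>W\<close> are thus spanned by the products of a character \<open>chi n \<theta>\<close> with two alternating
  products, one on each side of \<open>\<theta>\<close>; orthogonality and completeness of these products give the
  direct sum. The induced representation is irreducible because, by projecting with \<open>chi n \<theta>\<close> and
  antisymmetrizing, one finds in every nonzero invariant subspace a function that is supported on
  the inducing subgroup and has a tensor product of polytabloids as its value at the identity.
  Frobenius reciprocity turns the pairings of \<open>w \<in> W\<close> with cones \<open>{S. C \<union> D \<subseteq> S}\<close> into an
  intertwiner; it is injective since the generators of \<open>W\<close> are combinations of cones.\<close>

section \<open>Linear algebra of complex functions\<close>

text \<open>\<open>S_component\<close> is a definite description, so it has no usable content until
  existence and uniqueness are settled. For this reason the components are pinned down by symmetry,
  through functions determined up to a scalar by their behaviour under transpositions. The bridge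
  between subsets of different sizes is incidence. An alternating product at \<open>B\<close> is the
  sum of its values over the \<open>card p\<close>-subsets of \<open>B\<close>; conversely, its sum
  over the \<open>l\<close>-supersets of a \<open>card p\<close>-subset \<open>C\<close> is a
  multiple of its value at \<open>C\<close>, with a nonzero factor because it relates two positive
  counts. This one relation gives orthogonality (a set with fewer points than there are pairs misses
  a pair), the isomorphism from a component to the Specht module (the superset sum), the values of
  the final intertwiner on generators, and the vanishing of its kernel. The wreath product preserves
  the inner product on functions, so the group can be moved from one argument to the other.
  Surjectivity of the intertwiner is read off from the irreducibility of its target.\<close>

lemma scaleC_fun_apply [simp]: "(c *\<^sub>C f) x = c *\<^sub>C f x"
  by (simp add: scaleC_fun_def)

lemma scaleC_complex [simp]: "c *\<^sub>C x = c * (x :: complex)"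
  by (simp add: scaleC_complex_def)

lemma sum_fun_apply: "(\<Sum>i\<in>I. f i) x = (\<Sum>i\<in>I. f i x)"
  for f :: "'i \<Rightarrow> 'x \<Rightarrow> 'v::comm_monoid_add"
  by (induction I rule: infinite_finite_induct) simp_all

lemma sum_constant_scaleC: "(\<Sum>i\<in>I. v) = of_nat (card I) *\<^sub>C (v :: 'v::complex_vector)"
  by (induction I rule: infinite_finite_induct) (simp_all add: scaleC_add_left scaleC_one)

lemma cnj_of_bool [simp]: "cnj (of_bool P) = of_bool P"
  by (cases P) simp_all

lemma linear_on_zero:
  assumes "linear_on V T" "cvec.subspace V"
  shows "T 0 = 0"
proof -
  have "T (0 *\<^sub>C 0) = 0 *\<^sub>C T 0"
    using assms cvec.subspace_0 unfolding linear_on_def by blast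
  then show ?thesis by simp
qed

lemma linear_on_diff:
  assumes "linear_on V T" "cvec.subspace V" "u \<in> V" "v \<in> V"
  shows "T (u - v) = T u - T v"
proof -
  have "T (u + (-1) *\<^sub>C v) = T u + (-1) *\<^sub>C T v"
    using assms cvec.subspace_scale[of V v "-1"] unfolding linear_on_def by metis
  then show ?thesis by simp
qed

lemma linear_on_subset: "linear_on V T \<Longrightarrow> U \<subseteq> V \<Longrightarrow> linear_on U T"
  unfolding linear_on_def by blast

lemma linear_on_inj:
  assumes "linear_on V T" "cvec.subspace V" "\<And>v. v \<in> V \<Longrightarrow> T v = 0 \<Longrightarrow> v = 0"
  shows "inj_on T V"
proof (rule inj_onI)
  fix u v assume uv: "u \<in> V" "v \<in> V" "T u = T v"
  have "u - v = 0"
    using uv assms(3)[OF cvec.subspace_diff[OF assms(2) uv(1,2)]]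
    by (simp add: linear_on_diff[OF assms(1,2)])
  then show "u = v" by simp
qed

lemma linear_on_subspace_image:
  assumes "linear_on V T" "cvec.subspace V"
  shows "cvec.subspace (T ` V)"
proof -
  have "T u + T v \<in> T ` V" if "u \<in> V" "v \<in> V" for u v
    using that assms cvec.subspace_add unfolding linear_on_def by (metis image_eqI)
  moreover have "c *\<^sub>C T u \<in> T ` V" if "u \<in> V" for u c
    using that assms cvec.subspace_scale unfolding linear_on_def by (metis image_eqI)
  moreover have "0 \<in> T ` V"
    using linear_on_zero[OF assms] cvec.subspace_0[OF assms(2)] by (metis image_eqI)
  ultimately show ?thesis
    by (auto simp: cvec.subspace_def)
qed

lemma linear_on_image_span:
  assumes "linear_on (cvec.span S) T"
  shows "T ` cvec.span S = cvec.span (T ` S)"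
proof
  let ?U = "{x \<in> cvec.span S. T x \<in> cvec.span (T ` S)}"
  have "cvec.subspace ?U"
    using assms linear_on_zero[OF assms cvec.subspace_span]
    by (auto simp: cvec.subspace_def cvec.span_zero linear_on_def
        intro!: cvec.span_add cvec.span_scale)
  then have "cvec.span S \<subseteq> ?U"
    by (rule cvec.span_minimal[rotated]) (auto intro: cvec.span_base)
  then show "T ` cvec.span S \<subseteq> cvec.span (T ` S)" by blast
  show "cvec.span (T ` S) \<subseteq> T ` cvec.span S"
    by (rule cvec.span_minimal)
      (auto intro: linear_on_subspace_image[OF assms cvec.subspace_span] cvec.span_base)
qed

lemma linear_on_span_closed:
  assumes "linear_on (cvec.span S) T" "\<And>s. s \<in> S \<Longrightarrow> T s \<in> cvec.span S'" "v \<in> cvec.span S"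
  shows "T v \<in> cvec.span S'"
proof -
  have "T v \<in> cvec.span (T ` S)"
    using assms(3) linear_on_image_span[OF assms(1)] by blast
  also have "\<dots> \<subseteq> cvec.span S'"
    by (rule cvec.span_minimal) (use assms(2) in auto)
  finally show ?thesis .
qed

text \<open>The scalars may differ from point to point. This suffices for an intertwiner that is
  known on each generator only up to a nonzero factor: its image still has the expected
  span.\<close>

lemma span_image_scaled:
  assumes "\<And>x. x \<in> S \<Longrightarrow> \<exists>c. c \<noteq> 0 \<and> f x = c *\<^sub>C g x"
  shows "cvec.span (f ` S) = cvec.span (g ` S)"
proof
  have "f x \<in> cvec.span (g ` S)" if x: "x \<in> S" for x
    using assms[OF x] x by (metis cvec.span_scale cvec.span_base imageI)
  then show "cvec.span (f ` S) \<subseteq> cvec.span (g ` S)"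
    by (intro cvec.span_minimal) auto
  have "g x \<in> cvec.span (f ` S)" if x: "x \<in> S" for x
  proof -
    obtain c where c: "c \<noteq> 0" "f x = c *\<^sub>C g x" using assms[OF x] by blast
    then have "g x = inverse c *\<^sub>C f x" by (simp add: scaleC_scaleC scaleC_one)
    then show ?thesis using x by (metis cvec.span_scale cvec.span_base imageI)
  qed
  then show "cvec.span (g ` S) \<subseteq> cvec.span (f ` S)"
    by (intro cvec.span_minimal) auto
qed

text \<open>Linearity is used first in the second argument, with a generator \<open>u\<close> fixed,
  and then in the first. The result lets tensor products and the spaces \<open>W_space\<close> be
  spanned by products of generators.\<close>

lemma span_bilinear:
  fixes \<beta> :: "'u::complex_vector \<Rightarrow> 'v::complex_vector \<Rightarrow> 'w::complex_vector"
  assumes lin: "\<And>v. linear_on UNIV (\<lambda>u. \<beta> u v)" "\<And>u. linear_on UNIV (\<beta> u)"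
  shows "cvec.span {\<beta> u v | u v. u \<in> cvec.span S \<and> v \<in> cvec.span S'}
    = cvec.span {\<beta> u v | u v. u \<in> S \<and> v \<in> S'}" (is "?L = cvec.span ?G")
proof
  have *: "\<beta> u v \<in> cvec.span ?G" if u: "u \<in> S" and v: "v \<in> cvec.span S'" for u v
  proof -
    have "\<beta> u ` cvec.span S' = cvec.span (\<beta> u ` S')"
      by (rule linear_on_image_span[OF linear_on_subset[OF lin(2)]]) simp
    moreover have "cvec.span (\<beta> u ` S') \<subseteq> cvec.span ?G"
      by (rule cvec.span_mono) (use u in auto)
    ultimately show ?thesis using v by blast
  qed
  have "\<beta> u v \<in> cvec.span ?G" if u: "u \<in> cvec.span S" and v: "v \<in> cvec.span S'" for u v
  proof -
    have "(\<lambda>u. \<beta> u v) ` cvec.span S = cvec.span ((\<lambda>u. \<beta> u v) ` S)"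
      by (rule linear_on_image_span[OF linear_on_subset[OF lin(1)]]) simp
    moreover have "cvec.span ((\<lambda>u. \<beta> u v) ` S) \<subseteq> cvec.span ?G"
      by (rule cvec.span_minimal) (use * v in auto)
    ultimately show ?thesis using u by blast
  qed
  then show "?L \<subseteq> cvec.span ?G"
    by (intro cvec.span_minimal) auto
  show "cvec.span ?G \<subseteq> ?L"
    by (rule cvec.span_mono) (auto, metis cvec.span_base)
qed

section \<open>Hermitian products on finite sets, orthogonal projection and orthogonal sums\<close>

definition inner_on :: "'a set \<Rightarrow> ('a \<Rightarrow> complex) \<Rightarrow> ('a \<Rightarrow> complex) \<Rightarrow> complex"
  where "inner_on Y f g = (\<Sum>y\<in>Y. f y * cnj (g y))"

lemma inner_on_add_left: "inner_on Y (f + g) h = inner_on Y f h + inner_on Y g h"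
  by (simp add: inner_on_def distrib_right sum.distrib)

lemma inner_on_diff_left: "inner_on Y (f - g) h = inner_on Y f h - inner_on Y g h"
  by (simp add: inner_on_def left_diff_distrib sum_subtractf)

lemma inner_on_scale_left: "inner_on Y (c *\<^sub>C f) h = c * inner_on Y f h"
  by (simp add: inner_on_def sum_distrib_left mult.assoc)

lemma inner_on_add_right: "inner_on Y h (f + g) = inner_on Y h f + inner_on Y h g"
  by (simp add: inner_on_def distrib_left sum.distrib)

lemma inner_on_scale_right: "inner_on Y h (c *\<^sub>C f) = cnj c * inner_on Y h f"
  by (simp add: inner_on_def sum_distrib_left mult.left_commute)

lemma inner_on_zero [simp]: "inner_on Y 0 h = 0" "inner_on Y h 0 = 0"
  by (simp_all add: inner_on_def)

lemma inner_on_sum_left: "inner_on Y (\<Sum>i\<in>I. f i) h = (\<Sum>i\<in>I. inner_on Y (f i) h)"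
  unfolding inner_on_def sum_fun_apply sum_distrib_right by (rule sum.swap)

lemma inner_on_commute: "inner_on Y g f = cnj (inner_on Y f g)"
  by (simp add: inner_on_def mult.commute)

lemma inner_on_self:
  assumes "finite Y" "inner_on Y f f = 0" "y \<in> Y"
  shows "f y = 0"
proof -
  have "inner_on Y f f = of_real (\<Sum>y\<in>Y. (cmod (f y))\<^sup>2)"
    by (simp add: inner_on_def complex_norm_square del: of_real_power)
  with assms have "(\<Sum>y\<in>Y. (cmod (f y))\<^sup>2) = 0"
    by (metis of_real_eq_0_iff)
  with assms show ?thesis
    by (simp add: sum_nonneg_eq_0_iff)
qed

lemma inner_on_self_functions:
  assumes "finite Y" "inner_on Y f f = 0" "f \<in> functions_on Y"
  shows "f = 0"
  using inner_on_self[OF assms(1,2)] assms(3) by (auto simp: functions_on_def fun_eq_iff)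

lemma functions_onD: "f \<in> functions_on Y \<Longrightarrow> y \<notin> Y \<Longrightarrow> f y = 0"
  by (simp add: functions_on_def)

lemma subspace_functions_on: "cvec.subspace (functions_on Y)"
  by (auto simp: cvec.subspace_def functions_on_def)

lemma inner_on_span:
  assumes "\<And>s. s \<in> S \<Longrightarrow> inner_on Y f s = 0" "u \<in> cvec.span S"
  shows "inner_on Y f u = 0"
proof -
  have "cvec.subspace {u. inner_on Y f u = 0}"
    by (simp add: cvec.subspace_def inner_on_add_right inner_on_scale_right)
  then have "cvec.span S \<subseteq> {u. inner_on Y f u = 0}"
    by (rule cvec.span_minimal[rotated]) (use assms(1) in blast)
  then show ?thesis using assms(2) by blast
qed

lemma finite_spanning_set:
  assumes "finite Y" "cvec.subspace U" "U \<subseteq> functions_on Y"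
  obtains S where "finite S" "cvec.span S = U"
proof -
  define D where "D = (\<lambda>y x. of_bool (x = y) :: complex) ` Y"
  have "functions_on Y \<subseteq> cvec.span D"
  proof
    fix f assume f: "f \<in> functions_on Y"
    have "f = (\<Sum>y\<in>Y. f y *\<^sub>C (\<lambda>x. of_bool (x = y)))"
    proof
      fix x
      have "(\<Sum>y\<in>Y. f y *\<^sub>C (\<lambda>x. of_bool (x = y))) x = (\<Sum>y\<in>Y. f y * of_bool (x = y))"
        using assms(1) by (induction rule: finite_induct) auto
      also have "\<dots> = f x"
        using f assms(1) by (auto simp: functions_on_def if_distrib of_bool_def cong: if_cong)
      finally show "f x = (\<Sum>y\<in>Y. f y *\<^sub>C (\<lambda>x. of_bool (x = y))) x" ..
    qed
    also have "\<dots> \<in> cvec.span D"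
      by (intro cvec.span_sum cvec.span_scale cvec.span_base) (auto simp: D_def)
    finally show "f \<in> cvec.span D" .
  qed
  moreover obtain B where B: "B \<subseteq> U" "cvec.independent B" "U \<subseteq> cvec.span B"
    using cvec.basis_exists[of U] by metis
  ultimately have "finite B"
    using cvec.independent_span_bound[of D B] assms by (auto simp: D_def)
  moreover have "cvec.span B = U"
    using B assms(2) by (simp add: cvec.span_minimal subset_antisym)
  ultimately show ?thesis using that by blast
qed

text \<open>Gram-Schmidt, one generator at a time: \<open>s\<close> is replaced by \<open>w\<close>,
  its residue modulo the span already treated, and only the component along \<open>w\<close> is
  added.\<close>

lemma orthogonal_projection_span:
  assumes "finite Y" "finite S"
  shows "\<exists>u\<in>cvec.span S. \<forall>w\<in>cvec.span S. inner_on Y (f - u) w = 0"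
  using assms(2)
proof (induction S arbitrary: f rule: finite_induct)
  case empty
  have "\<exists>u\<in>cvec.span {}. \<forall>w\<in>cvec.span {}. inner_on Y (f - u) w = 0"
    by simp
  then show ?case .
next
  case (insert s S)
  obtain u where u: "u \<in> cvec.span S" "\<forall>w\<in>cvec.span S. inner_on Y (f - u) w = 0"
    using insert.IH by blast
  obtain u' where u': "u' \<in> cvec.span S" "\<forall>w\<in>cvec.span S. inner_on Y (s - u') w = 0"
    using insert.IH by blast
  define w where "w = s - u'"
  \<comment> \<open>The product ignores values outside \<open>Y\<close>, so it is only semidefinite
    and the denominator may vanish. Then \<open>w\<close> is zero on \<open>Y\<close>, and the value
    \<open>c = 0\<close> given by division by zero is still correct.\<close>
  define c where "c = inner_on Y (f - u) w / inner_on Y w w"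
  define v where "v = u + c *\<^sub>C w"
  have w: "inner_on Y w t = 0" if "t \<in> cvec.span S" for t
    using u'(2) that by (simp add: w_def)
  have sub: "cvec.span S \<subseteq> cvec.span (insert s S)"
    by (rule cvec.span_mono) auto
  have "v \<in> cvec.span (insert s S)"
    using u(1) u'(1) sub cvec.span_base[of s "insert s S"]
    unfolding v_def w_def by (auto intro!: cvec.span_add cvec.span_scale cvec.span_diff)
  moreover have "inner_on Y (f - v) x = 0" if "x \<in> cvec.span (insert s S)" for x
  proof (rule inner_on_span[OF _ that])
    have eq: "inner_on Y (f - v) t = inner_on Y (f - u) t - c * inner_on Y w t" for t
      by (simp add: v_def diff_diff_add[symmetric] inner_on_diff_left inner_on_scale_left
          del: diff_diff_add diff_diff_eq)
    have "inner_on Y (f - u) w = c * inner_on Y w w"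
    proof (cases "inner_on Y w w = 0")
      case True
      then have "\<forall>y\<in>Y. w y = 0" using inner_on_self[OF assms(1)] by blast
      then have "inner_on Y (f - u) w = 0" by (simp add: inner_on_def)
      with True show ?thesis by simp
    qed (simp add: c_def)
    then have "inner_on Y (f - v) (w + u') = 0"
      using u(2) u'(1) w by (simp add: eq inner_on_add_right)
    then have s: "inner_on Y (f - v) s = 0" by (simp add: w_def)
    fix t assume "t \<in> insert s S"
    then show "inner_on Y (f - v) t = 0"
      using s u(2) w by (auto simp: eq cvec.span_base)
  qed
  ultimately show ?case by blast
qed

text \<open>The residue of the orthogonal projection of \<open>f\<close> onto \<open>U\<close> is
  orthogonal to \<open>U\<close>, hence zero by hypothesis, which puts \<open>f\<close> itself in
  \<open>U\<close>.\<close>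

lemma subspace_full:
  assumes "finite Y" "cvec.subspace U" "U \<subseteq> functions_on Y"
    and "\<And>g. g \<in> functions_on Y \<Longrightarrow> (\<And>u. u \<in> U \<Longrightarrow> inner_on Y g u = 0) \<Longrightarrow> g = 0"
  shows "U = functions_on Y"
proof
  show "functions_on Y \<subseteq> U"
  proof
    fix f assume f: "f \<in> functions_on Y"
    obtain S where S: "finite S" "cvec.span S = U"
      using finite_spanning_set assms(1-3) by blast
    obtain u where u: "u \<in> U" "\<forall>w\<in>U. inner_on Y (f - u) w = 0"
      using orthogonal_projection_span[OF assms(1) S(1)] S(2) by blast
    have "f - u \<in> functions_on Y"
      using f u(1) assms(3) subspace_functions_on cvec.subspace_diff by blast
    then have "f - u = 0" using u(2) assms(4) by blast
    then show "f \<in> U" using u(1) by simp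
  qed
qed fact

lemma is_direct_sum_cong:
  assumes "\<And>i. i \<in> I \<Longrightarrow> W i = W' i"
  shows "is_direct_sum V I W \<longleftrightarrow> is_direct_sum V I W'"
proof -
  have "Pi\<^sub>E I W = Pi\<^sub>E I W'" using assms by (rule PiE_cong)
  then show ?thesis using assms by (simp add: is_direct_sum_def)
qed

text \<open>Both halves reduce to generators. The sum of the spans is everything because its
  orthogonal complement is zero; two decompositions agree because pairing their difference with its
  \<open>j\<close>-th component leaves only the norm of that component.\<close>

lemma is_direct_sum_orthogonal:
  assumes "finite Y" "finite I"
    and sub: "\<And>i. i \<in> I \<Longrightarrow> S i \<subseteq> functions_on Y"
    and orth: "\<And>i j s t. i \<in> I \<Longrightarrow> j \<in> I \<Longrightarrow> i \<noteq> j \<Longrightarrow> s \<in> S i \<Longrightarrow> t \<in> S j \<Longrightarrow> inner_on Y s t = 0"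
    and complete: "\<And>f. f \<in> functions_on Y \<Longrightarrow> (\<And>i s. i \<in> I \<Longrightarrow> s \<in> S i \<Longrightarrow> inner_on Y f s = 0) \<Longrightarrow> f = 0"
  shows "is_direct_sum (functions_on Y) I (\<lambda>i. cvec.span (S i))"
proof -
  let ?W = "\<lambda>i. cvec.span (S i)"
  have W: "?W i \<subseteq> functions_on Y" if "i \<in> I" for i
    using sub[OF that] by (simp add: cvec.span_minimal subspace_functions_on)
  have orthW: "inner_on Y u v = 0" if "i \<in> I" "j \<in> I" "i \<noteq> j" "u \<in> ?W i" "v \<in> ?W j" for i j u v
  proof (rule inner_on_span[OF _ that(5)])
    fix t assume t: "t \<in> S j"
    have "inner_on Y t u = 0"
      by (rule inner_on_span[OF _ that(4)]) (use orth that t in blast)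
    then show "inner_on Y u t = 0" by (metis inner_on_commute complex_cnj_zero)
  qed
  define U where "U = {\<Sum>i\<in>I. w i | w. \<forall>i\<in>I. w i \<in> ?W i}"
  have "U = functions_on Y"
  proof (rule subspace_full[OF assms(1)])
    show "cvec.subspace U"
      unfolding cvec.subspace_def
    proof (intro conjI ballI allI)
      show "0 \<in> U"
        by (auto simp: U_def cvec.span_zero intro!: exI[of _ "\<lambda>_. 0"])
      show "u + v \<in> U" if "u \<in> U" "v \<in> U" for u v
      proof -
        from that obtain w w' where "\<forall>i\<in>I. w i \<in> ?W i" "u = (\<Sum>i\<in>I. w i)"
          "\<forall>i\<in>I. w' i \<in> ?W i" "v = (\<Sum>i\<in>I. w' i)"
          unfolding U_def by blast
        then show ?thesis
          unfolding U_def
          by (intro CollectI exI[of _ "\<lambda>i. w i + w' i"]) (simp add: sum.distrib cvec.span_add)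
      qed
      show "c *\<^sub>C u \<in> U" if "u \<in> U" for c u
      proof -
        from that obtain w where "\<forall>i\<in>I. w i \<in> ?W i" "u = (\<Sum>i\<in>I. w i)"
          unfolding U_def by blast
        then show ?thesis
          unfolding U_def
          by (intro CollectI exI[of _ "\<lambda>i. c *\<^sub>C w i"])
            (simp add: cvec.scale_sum_right cvec.span_scale)
      qed
    qed
    show "U \<subseteq> functions_on Y"
      using W by (auto simp: U_def intro!: cvec.subspace_sum[OF subspace_functions_on])
    fix g assume g: "g \<in> functions_on Y" "\<And>u. u \<in> U \<Longrightarrow> inner_on Y g u = 0"
    show "g = 0"
    proof (rule complete[OF g(1)], rule g(2))
      fix i s assume i: "i \<in> I" "s \<in> S i"
      have "s = (\<Sum>j\<in>I. if j = i then s else 0)"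
        using i \<open>finite I\<close> by simp
      then show "s \<in> U"
        using i unfolding U_def
        by (intro CollectI exI[of _ "\<lambda>j. if j = i then s else 0"])
          (auto intro: cvec.span_base cvec.span_zero)
    qed
  qed
  have "\<exists>!w. w \<in> Pi\<^sub>E I ?W \<and> v = (\<Sum>i\<in>I. w i)" if v: "v \<in> functions_on Y" for v
  proof (rule ex_ex1I)
    obtain w where w: "\<forall>i\<in>I. w i \<in> ?W i" "v = (\<Sum>i\<in>I. w i)"
      using v \<open>U = functions_on Y\<close> by (auto simp: U_def)
    then show "\<exists>w. w \<in> Pi\<^sub>E I ?W \<and> v = (\<Sum>i\<in>I. w i)"
      by (intro exI[of _ "restrict w I"]) auto
  next
    fix w w' assume w: "w \<in> Pi\<^sub>E I ?W \<and> v = (\<Sum>i\<in>I. w i)" "w' \<in> Pi\<^sub>E I ?W \<and> v = (\<Sum>i\<in>I. w' i)"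
    have "w j = w' j" if j: "j \<in> I" for j
    proof -
      define d where "d i = w i - w' i" for i
      have d: "d i \<in> ?W i" if "i \<in> I" for i
        using w that by (auto simp: d_def intro!: cvec.span_diff)
      have "(\<Sum>i\<in>I. d i) = 0"
        using w by (simp add: d_def sum_subtractf)
      then have "0 = inner_on Y (\<Sum>i\<in>I. d i) (d j)" by simp
      also have "\<dots> = (\<Sum>i\<in>I. if i = j then inner_on Y (d j) (d j) else 0)"
        unfolding inner_on_sum_left
        by (intro sum.cong) (use orthW j d in auto)
      also have "\<dots> = inner_on Y (d j) (d j)"
        using j assms(2) by simp
      finally have "d j = 0"
        using inner_on_self_functions[OF assms(1)] W[OF j] d[OF j] by (metis in_mono)
      then show ?thesis by (simp add: d_def)
    qed
    then show "w = w'"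
      using w by (intro PiE_ext[of w I ?W w']) auto
  qed
  then show ?thesis
    using assms(2) W by (auto simp: is_direct_sum_def cvec.subspace_span)
qed

section \<open>Representations\<close>

lemma group_rep_perm_rep:
  assumes "group G" "cvec.subspace U"
    and "\<And>b. act \<one>\<^bsub>G\<^esub> b = b"
    and "\<And>g h b. g \<in> carrier G \<Longrightarrow> h \<in> carrier G \<Longrightarrow> act (g \<otimes>\<^bsub>G\<^esub> h) b = act g (act h b)"
    and "\<And>g u. g \<in> carrier G \<Longrightarrow> u \<in> U \<Longrightarrow> perm_rep G act g u \<in> U"
  shows "group_rep G U (perm_rep G act)"
proof -
  interpret group G by fact
  show ?thesis
    using assms(2-5)
    by unfold_locales
      (auto simp: perm_rep_def linear_on_def inv_mult_group scaleC_fun_def fun_eq_iff)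
qed

lemma linear_on_perm_rep: "linear_on V (perm_rep G act g)"
  by (auto simp: linear_on_def perm_rep_def)

lemma perm_rep_span_closed:
  assumes "\<And>s. s \<in> S \<Longrightarrow> perm_rep G act g s \<in> cvec.span S" "u \<in> cvec.span S"
  shows "perm_rep G act g u \<in> cvec.span S"
  by (rule linear_on_span_closed[OF linear_on_perm_rep assms])

text \<open>\<open>rep_iso\<close> provides a map out of \<open>V\<close>, whereas the symmetry
  argument for \<open>S_component\<close> starts from polytabloids in \<open>W\<close> and follows
  their images in \<open>V\<close>.\<close>

lemma rep_iso_inverse:
  assumes "rep_iso G V \<rho> W \<sigma>"
  obtains T where "linear_on W T" "T ` W = V" "\<And>w. w \<in> W \<Longrightarrow> T w = 0 \<Longrightarrow> w = 0"
    "\<And>g w. g \<in> carrier G \<Longrightarrow> w \<in> W \<Longrightarrow> T (\<sigma> g w) = \<rho> g (T w)"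
proof -
  from assms obtain R where R: "linear_on V R" "bij_betw R V W"
    "\<And>g v. g \<in> carrier G \<Longrightarrow> v \<in> V \<Longrightarrow> R (\<rho> g v) = \<sigma> g (R v)"
    and rep: "group_rep G V \<rho>"
    unfolding rep_iso_def by blast
  interpret group_rep G V \<rho> by fact
  let ?T = "inv_into V R"
  have RT: "R (?T w) = w" "?T w \<in> V" if "w \<in> W" for w
    using R(2) that by (auto simp: bij_betw_def f_inv_into_f inv_into_into)
  have TR: "?T (R v) = v" if "v \<in> V" for v
    using R(2) that by (auto simp: bij_betw_def)
  show ?thesis
  proof
    show "linear_on W ?T"
      unfolding linear_on_def
    proof (intro conjI ballI allI)
      fix u v assume uv: "u \<in> W" "v \<in> W"
      have "R (?T u + ?T v) = u + v"
        using R(1) RT uv unfolding linear_on_def by simp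
      then show "?T (u + v) = ?T u + ?T v"
        using TR cvec.subspace_add[OF subspace RT(2)[OF uv(1)] RT(2)[OF uv(2)]] by metis
    next
      fix c v assume v: "v \<in> W"
      have "R (c *\<^sub>C ?T v) = c *\<^sub>C v"
        using R(1) RT v unfolding linear_on_def by simp
      then show "?T (c *\<^sub>C v) = c *\<^sub>C ?T v"
        using TR cvec.subspace_scale[OF subspace RT(2)[OF v]] by metis
    qed
    show "?T ` W = V"
      using R(2) bij_betw_inv_into bij_betw_imp_surj_on by blast
    show "w = 0" if "w \<in> W" "?T w = 0" for w
      using that RT(1) linear_on_zero[OF R(1) subspace] by metis
    show "?T (\<sigma> g w) = \<rho> g (?T w)" if "g \<in> carrier G" "w \<in> W" for g w
      using that RT TR R(3) closed by metis
  qed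
qed


section \<open>Alternating products over matchings\<close>

abbreviation "swap \<equiv> Transposition.transpose"

text \<open>The conditions say that the \<open>2 * card p\<close> end points are pairwise distinct.
  Pairs are ordered because the order fixes the sign of the alternating product.\<close>

definition matching :: "'a set \<Rightarrow> ('a \<times> 'a) set \<Rightarrow> bool"
  where "matching A p \<longleftrightarrow> finite p \<and> inj_on fst p \<and> inj_on snd p
    \<and> fst ` p \<inter> snd ` p = {} \<and> fst ` p \<union> snd ` p \<subseteq> A"

text \<open>For finite \<open>p\<close> the values are 0, 1 and -1, and the product is nonzero
  exactly on the transversals of \<open>p\<close>, the sets containing exactly one point of every
  pair.\<close>

definition alt_prod :: "('a \<times> 'a) set \<Rightarrow> 'a set \<Rightarrow> complex"
  where "alt_prod p B = (\<Prod>(a, b)\<in>p. of_bool (a \<in> B) - of_bool (b \<in> B))"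

definition alt_fun :: "'a set \<Rightarrow> nat \<Rightarrow> ('a \<times> 'a) set \<Rightarrow> 'a set \<Rightarrow> complex"
  where "alt_fun A l p = (\<lambda>B. if B \<in> subsets_of_card A l then alt_prod p B else 0)"

lemma matching_finite: "matching A p \<Longrightarrow> finite p"
  by (simp add: matching_def)

lemma matching_empty [simp]: "matching A {}"
  by (simp add: matching_def)

lemma matching_pair:
  assumes "matching A p" "(a, b) \<in> p"
  shows "a \<in> A" "b \<in> A" "a \<noteq> b"
  using assms by (force simp: matching_def)+

lemma matching_disjoint_pairs:
  assumes "matching A p" "(a, b) \<in> p" "(c, d) \<in> p" "(c, d) \<noteq> (a, b)"
  shows "c \<noteq> a" "c \<noteq> b" "d \<noteq> a" "d \<noteq> b"
proof -
  have m: "inj_on fst p" "inj_on snd p" "fst ` p \<inter> snd ` p = {}"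
    using assms(1) by (auto simp: matching_def)
  show "c \<noteq> a" "d \<noteq> b"
    using inj_onD[OF m(1), of "(a, b)" "(c, d)"] inj_onD[OF m(2), of "(a, b)" "(c, d)"] assms(2-4)
    by auto
  have "a \<in> fst ` p" "c \<in> fst ` p" "b \<in> snd ` p" "d \<in> snd ` p"
    using imageI[OF assms(2), of fst] imageI[OF assms(3), of fst]
      imageI[OF assms(2), of snd] imageI[OF assms(3), of snd] by auto
  then show "c \<noteq> b" "d \<noteq> a" using m(3) by auto
qed

lemma matching_insert:
  assumes "matching A p" "x \<in> A - Field p" "y \<in> A - Field p" "x \<noteq> y"
  shows "matching A (insert (x, y) p)"
proof -
  have "fst ` p \<subseteq> Field p" "snd ` p \<subseteq> Field p"
    by (auto simp: Field_def)
  moreover have "inj_on fst (insert (x, y) p)" "inj_on snd (insert (x, y) p)"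
    using assms by (force simp: matching_def inj_on_def Field_def)+
  ultimately show ?thesis
    using assms by (auto simp: matching_def)
qed

lemma matching_image:
  assumes "matching A p" "inj g"
  shows "matching (g ` A) (map_prod g g ` p)"
proof -
  have 1: "fst ` map_prod g g ` p = g ` fst ` p" "snd ` map_prod g g ` p = g ` snd ` p"
    by (simp_all add: image_image)
  have "inj_on fst (map_prod g g ` p)" "inj_on snd (map_prod g g ` p)"
    using assms by (auto simp: matching_def comp_inj_on inj_on_subset[OF assms(2)]
        intro!: inj_on_imageI)
  then show ?thesis
    using assms unfolding matching_def 1
    by (simp add: image_Int[OF assms(2), symmetric] image_Un[symmetric] image_mono)
qed

lemma Field_matching: "matching A p \<Longrightarrow> Field p \<subseteq> A"
  by (auto simp: Field_def dest: matching_pair)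

lemma Field_eq_fst_snd: "Field p = fst ` p \<union> snd ` p"
  by (auto simp: Field_def image_iff) force+

lemma card_Field_matching: "matching A p \<Longrightarrow> card (Field p) = 2 * card p"
  unfolding Field_eq_fst_snd by (simp add: matching_def card_Un_disjoint card_image)

lemma card_minus_Field_matching:
  "finite A \<Longrightarrow> matching A p \<Longrightarrow> card (A - Field p) = card A - 2 * card p"
  using Field_matching[of A p]
  by (simp add: card_Diff_subset card_Field_matching finite_subset)

lemma card_map_prod_image: "inj g \<Longrightarrow> card (map_prod g g ` p) = card p"
  by (intro card_image) (auto simp: inj_on_def inj_def)

lemma finite_subsets_of_card [simp]: "finite A \<Longrightarrow> finite (subsets_of_card A l)"
  by (auto simp: subsets_of_card_def)

lemma subsets_of_card_image:
  assumes "bij_betw g A A'"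
  shows "bij_betw ((`) g) (subsets_of_card A l) (subsets_of_card A' l)"
proof (rule bij_betw_byWitness[where f' = "(`) (inv_into A g)"])
  show "(`) g ` subsets_of_card A l \<subseteq> subsets_of_card A' l"
    using assms by (auto simp: subsets_of_card_def bij_betw_def inj_on_subset card_image)
  show "(`) (inv_into A g) ` subsets_of_card A' l \<subseteq> subsets_of_card A l"
    using bij_betw_inv_into[OF assms]
    by (auto simp: subsets_of_card_def bij_betw_def inj_on_subset card_image)
  show "\<forall>a\<in>subsets_of_card A l. inv_into A g ` g ` a = a"
    using assms by (simp add: subsets_of_card_def bij_betw_def inv_into_image_cancel)
  show "\<forall>a\<in>subsets_of_card A' l. g ` inv_into A g ` a = a"
    using assms by (auto simp: subsets_of_card_def bij_betw_def image_inv_into_cancel)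
qed

section \<open>Transpositions acting on subsets, and the signs they produce\<close>

lemma image_transpose_swap:
  assumes "x \<in> B" "y \<notin> B"
  shows "swap x y ` B = insert y (B - {x})"
  using assms by (auto simp: in_transpose_image_iff Transposition.transpose_def split: if_splits)

lemma image_transpose_same:
  assumes "x \<in> B \<longleftrightarrow> y \<in> B"
  shows "swap x y ` B = B"
  using assms by (auto simp: in_transpose_image_iff Transposition.transpose_def)

lemma transpose_subsets_of_card:
  assumes "x \<in> A" "y \<in> A"
  shows "bij_betw ((`) (swap x y)) (subsets_of_card A l) (subsets_of_card A l)"
  by (rule subsets_of_card_image) (use assms in simp)

lemma alt_prod_empty [simp]: "alt_prod {} B = 1"
  by (simp add: alt_prod_def)

lemma alt_prod_eq_0_iff:
  "finite p \<Longrightarrow> alt_prod p B = 0 \<longleftrightarrow> (\<exists>(a, b)\<in>p. a \<in> B \<longleftrightarrow> b \<in> B)"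
  by (auto simp: alt_prod_def prod_zero_iff split_beta of_bool_def)

lemma alt_prod_insert:
  "finite p \<Longrightarrow> (a, b) \<notin> p \<Longrightarrow>
    alt_prod (insert (a, b) p) B = (of_bool (a \<in> B) - of_bool (b \<in> B)) * alt_prod p B"
  by (simp add: alt_prod_def)

lemma alt_prod_square:
  "finite p \<Longrightarrow> alt_prod p B \<noteq> 0 \<Longrightarrow> alt_prod p B * alt_prod p B = 1"
  by (induction p rule: finite_induct) (auto simp: alt_prod_insert of_bool_def split: if_splits)

lemma cnj_alt_prod [simp]: "cnj (alt_prod p B) = alt_prod p B"
  by (auto simp: alt_prod_def split_beta intro!: prod.cong)

lemma alt_prod_cong:
  assumes "\<And>a. a \<in> Field p \<Longrightarrow> a \<in> B \<longleftrightarrow> a \<in> B'"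
  shows "alt_prod p B = alt_prod p B'"
  unfolding alt_prod_def split_beta
proof (rule prod.cong[OF refl])
  fix x assume "x \<in> p"
  then have "fst x \<in> Field p" "snd x \<in> Field p"
    by (auto simp: Field_def Domain.simps Range.simps) (metis prod.collapse)+
  then show "of_bool (fst x \<in> B) - of_bool (snd x \<in> B)
    = (of_bool (fst x \<in> B') - of_bool (snd x \<in> B') :: complex)"
    using assms by simp
qed

lemma alt_prod_image:
  assumes "inj g"
  shows "alt_prod (map_prod g g ` p) (g ` B) = alt_prod p B"
proof -
  have "inj_on (map_prod g g) p"
    using assms by (auto simp: inj_on_def inj_def)
  then show ?thesis
    using assms by (simp add: alt_prod_def prod.reindex split_beta inj_image_mem_iff)
qed

lemma alt_prod_fixed:
  assumes "x \<notin> Field p" "y \<notin> Field p"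
  shows "alt_prod p (swap x y ` B) = alt_prod p B"
  by (rule alt_prod_cong)
    (use assms in \<open>auto simp: in_transpose_image_iff Transposition.transpose_def\<close>)

lemma alt_prod_swap:
  assumes "matching A p" "(a, b) \<in> p"
  shows "alt_prod p (swap a b ` B) = - alt_prod p B"
proof -
  let ?q = "p - {(a, b)}" and ?t = "swap a b"
  have p: "p = insert (a, b) ?q" using assms(2) by blast
  have "z \<noteq> a \<and> z \<noteq> b" if "z \<in> Field ?q" for z
  proof -
    from that obtain w where "(z, w) \<in> ?q \<or> (w, z) \<in> ?q"
      by (auto simp: Field_def)
    then show ?thesis
      using matching_disjoint_pairs[OF assms, of z w] matching_disjoint_pairs[OF assms, of w z]
      by blast
  qed
  then have "a \<notin> Field ?q" "b \<notin> Field ?q" by blast+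
  then have "alt_prod ?q (?t ` B) = alt_prod ?q B"
    by (rule alt_prod_fixed)
  then have "alt_prod (insert (a, b) ?q) (?t ` B) = - alt_prod (insert (a, b) ?q) B"
    using assms by (subst (1 2) alt_prod_insert)
      (auto simp: matching_finite in_transpose_image_iff algebra_simps)
  then show ?thesis using p by simp
qed

lemma sum_antisymmetric:
  fixes f :: "'b \<Rightarrow> complex"
  assumes "bij_betw s Y Y" "\<And>y. y \<in> Y \<Longrightarrow> f (s y) = - f y"
  shows "sum f Y = 0"
proof -
  have "sum f Y = (\<Sum>y\<in>Y. f (s y))"
    by (rule sum.reindex_bij_betw[OF assms(1), symmetric])
  also have "\<dots> = - sum f Y"
    using assms(2) by (simp add: sum_negf)
  finally show ?thesis by simp
qed

lemma alt_fun_unique: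
  assumes "finite A" "matching A p" "f \<in> M_space A l"
    and anti: "\<And>a b B. (a, b) \<in> p \<Longrightarrow> B \<in> subsets_of_card A l \<Longrightarrow>
      f (swap a b ` B) = - f B"
    and sym: "\<And>x y B. x \<in> A - Field p \<Longrightarrow> y \<in> A - Field p \<Longrightarrow> B \<in> subsets_of_card A l \<Longrightarrow>
      x \<in> B \<Longrightarrow> y \<notin> B \<Longrightarrow> f (swap x y ` B) = f B"
  obtains c where "f = c *\<^sub>C alt_fun A l p"
proof -
  have fin: "finite p" using assms(2) by (rule matching_finite)
  define h where "h B = f B * alt_prod p B" for B
  \<comment> \<open>\<open>f\<close> times the sign is invariant under all exchanges, and any two sets meeting every pair
    in one point are connected by exchanges.\<close>
  have h: "h B = h B'" if "B \<in> subsets_of_card A l" "B' \<in> subsets_of_card A l"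
    "alt_prod p B \<noteq> 0" "alt_prod p B' \<noteq> 0" for B B'
    using that
  proof (induction "card (B - B')" arbitrary: B rule: less_induct)
    case less
    have finB: "finite B" "finite B'" "card B = card B'"
      using less.prems assms(1) by (auto simp: subsets_of_card_def finite_subset)
    show ?case
    proof (cases "B = B'")
      case False
      have "\<not> B \<subseteq> B'" "\<not> B' \<subseteq> B"
        using finB False by (metis card_subset_eq)+
      then obtain x0 y0 where xy0: "x0 \<in> B - B'" "y0 \<in> B' - B" by blast
      have trans: "a \<in> C \<longleftrightarrow> b \<notin> C" if "(a, b) \<in> p" "alt_prod p C \<noteq> 0" for a b C
        using that fin by (auto simp: alt_prod_eq_0_iff)
      \<comment> \<open>If \<open>B\<close> and \<open>B'\<close> differ at a point of a pair, then,
        both being transversals, they contain opposite points of that pair, and the pair itself is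
        the exchange. Otherwise all differences lie outside \<open>Field p\<close>, where any two
        points may be exchanged.\<close>
      have "\<exists>x y. x \<in> B - B' \<and> y \<in> B' - B \<and> ((x, y) \<in> p \<or> (y, x) \<in> p \<or> x \<in> A - Field p \<and> y \<in> A - Field p)"
      proof (cases "\<exists>z\<in>Field p. z \<in> B - B' \<or> z \<in> B' - B")
        case True
        then obtain a b where "(a, b) \<in> p" "a \<in> B - B' \<or> a \<in> B' - B \<or> b \<in> B - B' \<or> b \<in> B' - B"
          by (auto simp: Field_def)
        then show ?thesis
          using trans[of a b B] trans[of a b B'] less.prems by blast
      next
        case False
        then have "x0 \<in> A - Field p" "y0 \<in> A - Field p"
          using xy0 less.prems by (auto simp: subsets_of_card_def)
        then show ?thesis using xy0 by blast
      qed
      then obtain x y where xy: "x \<in> B - B'" "y \<in> B' - B"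
        "(x, y) \<in> p \<or> (y, x) \<in> p \<or> x \<in> A - Field p \<and> y \<in> A - Field p"
        by blast
      let ?B = "swap x y ` B"
      have A: "x \<in> A" "y \<in> A" using xy less.prems by (auto simp: subsets_of_card_def)
      have B: "?B = insert y (B - {x})"
        using xy by (intro image_transpose_swap) auto
      have hB: "h ?B = h B" and nz: "alt_prod p ?B \<noteq> 0"
        using xy less.prems anti[of x y B] anti[of y x B] sym[of x y B]
          alt_prod_swap[OF assms(2), of x y B] alt_prod_swap[OF assms(2), of y x B]
          alt_prod_fixed[of x p y B]
        by (auto simp: h_def transpose_commute)
      have "?B - B' = (B - B') - {x}" using B xy by auto
      then have "card (?B - B') < card (B - B')"
        using xy finB card_Diff1_less[of "B - B'" x] by simp
      moreover have "?B \<in> subsets_of_card A l"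
        using transpose_subsets_of_card[OF A] less.prems(1) by (auto simp: bij_betw_def)
      ultimately show ?thesis
        using less.hyps[of ?B] less.prems nz hB by simp
    qed simp
  qed
  then obtain c where c: "\<And>B. B \<in> subsets_of_card A l \<Longrightarrow> alt_prod p B \<noteq> 0 \<Longrightarrow> h B = c"
    by metis
  have "f B = c * alt_fun A l p B" for B
  proof (cases "B \<in> subsets_of_card A l")
    case B: True
    show ?thesis
    proof (cases "alt_prod p B = 0")
      case True
      then obtain a b where ab: "(a, b) \<in> p" "a \<in> B \<longleftrightarrow> b \<in> B"
        using fin by (auto simp: alt_prod_eq_0_iff)
      \<comment> \<open>A set containing both or neither of the points of a pair is fixed by its
        transposition.\<close>
      then have "f B = - f B"
        using anti[OF ab(1) B] image_transpose_same[OF ab(2)] by simp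
      then show ?thesis using True B by (simp add: alt_fun_def)
    next
      case False
      then show ?thesis
        using c[OF B False] alt_prod_square[OF fin False] B
        by (simp add: h_def alt_fun_def mult.assoc flip: c[OF B False])
    qed
  next
    case False
    then show ?thesis using assms(3) by (simp add: alt_fun_def M_space_def functions_on_def)
  qed
  then have "f = c *\<^sub>C alt_fun A l p" by (simp add: fun_eq_iff)
  then show ?thesis by (rule that)
qed

section \<open>Incidence sums and orthogonality of alternating products\<close>

lemma exists_missed_pair:
  assumes "matching A q" "finite C" "card C < card q"
  obtains a b where "(a, b) \<in> q" "a \<notin> C" "b \<notin> C"
proof (rule ccontr)
  assume "\<not> thesis"
  with that have *: "a \<in> C \<or> b \<in> C" if "(a, b) \<in> q" for a b using \<open>(a, b) \<in> q\<close> by blast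
  \<comment> \<open>Pigeonhole: if every pair met \<open>C\<close>, choosing for each pair a point
    in \<open>C\<close> would be injective, as distinct pairs are disjoint.\<close>
  let ?f = "\<lambda>(a, b). if a \<in> C then a else b"
  have "inj_on ?f q"
  proof (rule inj_onI, rule ccontr)
    fix x y assume xy: "x \<in> q" "y \<in> q" "?f x = ?f y" "x \<noteq> y"
    then show False
      using matching_disjoint_pairs[OF assms(1), of "fst x" "snd x" "fst y" "snd y"]
      by (auto simp: split_beta split: if_splits)
  qed
  moreover have "?f x \<in> C" if "x \<in> q" for x
    using *[of "fst x" "snd x"] that by (auto simp: split_beta)
  then have "?f ` q \<subseteq> C" by blast
  ultimately have "card q \<le> card C" using assms(2) card_inj_on_le by blast
  then show False using assms(3) by simp
qed

text \<open>Transposing the missed pair maps the supersets of \<open>C\<close> among the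
  \<open>l\<close>-subsets to themselves and reverses every sign.\<close>

lemma sum_supersets_alt_prod_zero:
  assumes "matching A q" "(a, b) \<in> q" "a \<notin> C" "b \<notin> C"
  shows "(\<Sum>B\<in>subsets_of_card A l. of_bool (C \<subseteq> B) * alt_prod q B) = 0"
proof (rule sum_antisymmetric[OF transpose_subsets_of_card])
  show "a \<in> A" "b \<in> A" using matching_pair[OF assms(1,2)] by auto
  fix B
  have "C \<subseteq> swap a b ` B \<longleftrightarrow> C \<subseteq> B"
    using assms(3,4) by (auto simp: in_transpose_image_iff Transposition.transpose_def subset_iff split: if_splits)
  then show "of_bool (C \<subseteq> swap a b ` B) * alt_prod q (swap a b ` B)
    = - (of_bool (C \<subseteq> B) * alt_prod q B)"
    using alt_prod_swap[OF assms(1,2)] by simp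
qed

lemma card_Field_inter:
  assumes "matching A p" "alt_prod p B \<noteq> 0"
  shows "card (Field p \<inter> B) = card p"
proof -
  let ?f = "\<lambda>(a, b). if a \<in> B then a else b"
  have trans: "a \<in> B \<longleftrightarrow> b \<notin> B" if "(a, b) \<in> p" for a b
    using that assms matching_finite[OF assms(1)] by (auto simp: alt_prod_eq_0_iff)
  have "inj_on ?f p"
  proof (rule inj_onI, rule ccontr)
    fix x y assume xy: "x \<in> p" "y \<in> p" "?f x = ?f y" "x \<noteq> y"
    then show False
      using matching_disjoint_pairs[OF assms(1), of "fst x" "snd x" "fst y" "snd y"]
      by (auto simp: split_beta split: if_splits)
  qed
  moreover have "?f ` p = Field p \<inter> B"
  proof
    show "?f ` p \<subseteq> Field p \<inter> B"
      using trans by (auto simp: Field_def Domain.simps Range.simps)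
    show "Field p \<inter> B \<subseteq> ?f ` p"
    proof
      fix z assume "z \<in> Field p \<inter> B"
      then obtain a b where ab: "(a, b) \<in> p" "z = a \<or> z = b" "z \<in> B"
        by (auto simp: Field_def)
      then have "z = ?f (a, b)" using trans[OF ab(1)] by auto
      then show "z \<in> ?f ` p" using ab(1) by blast
    qed
  qed
  ultimately show ?thesis using card_image by metis
qed

text \<open>A transversal with only \<open>card p\<close> points consists of pair points. If
  \<open>B\<close> is a transversal, the only one inside it is therefore
  \<open>Field p \<inter> B\<close>, and the sum has one term. If some pair lies entirely inside or
  entirely outside \<open>B\<close>, its transposition makes the terms cancel.\<close>

lemma sum_subsets_alt_prod:
  assumes "finite A" "matching A p" "B \<subseteq> A"
  shows "(\<Sum>C\<in>subsets_of_card A (card p). of_bool (C \<subseteq> B) * alt_prod p C) = alt_prod p B"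
proof (cases "alt_prod p B = 0")
  case False
  have fin: "finite p" using assms(2) by (rule matching_finite)
  let ?C = "Field p \<inter> B"
  have C: "?C \<in> subsets_of_card A (card p)"
    using card_Field_inter[OF assms(2) False] assms(3) by (auto simp: subsets_of_card_def)
  have only: "C = ?C" if C': "C \<in> subsets_of_card A (card p)" "C \<subseteq> B" "alt_prod p C \<noteq> 0" for C
  proof -
    have "finite C" using C' assms(1) by (auto simp: subsets_of_card_def finite_subset)
    moreover have "card (Field p \<inter> C) = card C"
      using card_Field_inter[OF assms(2) C'(3)] C'(1) by (simp add: subsets_of_card_def)
    ultimately have "C \<subseteq> Field p"
      by (metis Int_lower2 card_subset_eq Int_lower1)
    moreover have "finite ?C" "card ?C = card C"
      using C C'(1) assms(1) by (auto simp: subsets_of_card_def finite_subset)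
    ultimately show ?thesis using C'(2) by (metis card_subset_eq le_inf_iff)
  qed
  have "(\<Sum>C\<in>subsets_of_card A (card p). of_bool (C \<subseteq> B) * alt_prod p C)
    = (\<Sum>C\<in>subsets_of_card A (card p). if C = ?C then alt_prod p ?C else 0)"
  proof (intro sum.cong refl)
    fix C assume C: "C \<in> subsets_of_card A (card p)"
    show "of_bool (C \<subseteq> B) * alt_prod p C = (if C = ?C then alt_prod p ?C else 0)"
    proof (cases "C = ?C")
      case True
      show ?thesis unfolding True by simp
    next
      case False
      then have "\<not> C \<subseteq> B \<or> alt_prod p C = 0" using only C by blast
      then show ?thesis using False by auto
    qed
  qed
  also have "\<dots> = alt_prod p ?C"
    using C assms(1) by (subst sum.delta) simp_all
  also have "\<dots> = alt_prod p B" by (rule alt_prod_cong) auto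
  finally show ?thesis .
next
  case True
  have fin: "finite p" using assms(2) by (rule matching_finite)
  from True obtain a b where ab: "(a, b) \<in> p" "a \<in> B \<longleftrightarrow> b \<in> B"
    using fin by (auto simp: alt_prod_eq_0_iff)
  have "(\<Sum>C\<in>subsets_of_card A (card p). of_bool (C \<subseteq> B) * alt_prod p C) = 0"
  proof (rule sum_antisymmetric[OF transpose_subsets_of_card])
    show "a \<in> A" "b \<in> A" using matching_pair[OF assms(2) ab(1)] by auto
    fix C
    have "swap a b ` C \<subseteq> B \<longleftrightarrow> C \<subseteq> B"
      using inj_image_subset_iff[OF inj_transpose[of a b], of C B] image_transpose_same[OF ab(2)]
      by simp
    then show "of_bool (swap a b ` C \<subseteq> B) * alt_prod p (swap a b ` C)
      = - (of_bool (C \<subseteq> B) * alt_prod p C)"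
      using alt_prod_swap[OF assms(2) ab(1)] by simp
  qed
  then show ?thesis using True by simp
qed

text \<open>An adjointness formula: pairing \<open>w\<close> with the alternating product on
  \<open>l\<close>-subsets is pairing the superset sums of \<open>w\<close> with it on
  \<open>card p\<close>-subsets. Orthogonality, the nonvanishing of the superset constant and the
  injectivity of the map to the Specht module all rest on it.\<close>

lemma sum_alt_prod_expand:
  assumes "finite A" "matching A p"
  shows "(\<Sum>B\<in>subsets_of_card A l. w B * alt_prod p B)
    = (\<Sum>C\<in>subsets_of_card A (card p). alt_prod p C * (\<Sum>B\<in>subsets_of_card A l. of_bool (C \<subseteq> B) * w B))"
proof -
  let ?X = "subsets_of_card A l" and ?Y = "subsets_of_card A (card p)"
  have "(\<Sum>B\<in>?X. w B * alt_prod p B)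
    = (\<Sum>B\<in>?X. \<Sum>C\<in>?Y. alt_prod p C * (of_bool (C \<subseteq> B) * w B))"
  proof (rule sum.cong[OF refl])
    fix B assume "B \<in> ?X"
    then have "(\<Sum>C\<in>?Y. of_bool (C \<subseteq> B) * alt_prod p C) = alt_prod p B"
      by (intro sum_subsets_alt_prod[OF assms]) (simp add: subsets_of_card_def)
    then have "w B * alt_prod p B = w B * (\<Sum>C\<in>?Y. of_bool (C \<subseteq> B) * alt_prod p C)"
      by simp
    then show "w B * alt_prod p B = (\<Sum>C\<in>?Y. alt_prod p C * (of_bool (C \<subseteq> B) * w B))"
      by (simp only: sum_distrib_left mult_ac)
  qed
  also have "\<dots> = (\<Sum>C\<in>?Y. alt_prod p C * (\<Sum>B\<in>?X. of_bool (C \<subseteq> B) * w B))"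
    by (subst sum.swap) (simp add: sum_distrib_left)
  finally show ?thesis .
qed

text \<open>After expansion along \<open>p\<close>, each inner sum runs over the supersets of a set
  with fewer points than \<open>q\<close> has pairs. Such a set misses a pair of \<open>q\<close>,
  so the inner sum vanishes.\<close>

lemma alt_prod_orthogonal_less:
  assumes "finite A" "matching A p" "matching A q" "card p < card q"
  shows "(\<Sum>B\<in>subsets_of_card A l. alt_prod p B * alt_prod q B) = 0"
proof -
  let ?X = "subsets_of_card A l" and ?Y = "subsets_of_card A (card p)"
  have "(\<Sum>B\<in>?X. alt_prod p B * alt_prod q B)
    = (\<Sum>C\<in>?Y. alt_prod p C * (\<Sum>B\<in>?X. of_bool (C \<subseteq> B) * alt_prod q B))"
    using sum_alt_prod_expand[OF assms(1,2), of "alt_prod q"] by (simp only: mult.commute)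
  also have "\<dots> = 0"
  proof (intro sum.neutral ballI)
    fix C assume C: "C \<in> ?Y"
    then have "finite C" "card C < card q"
      using assms by (auto simp: subsets_of_card_def finite_subset)
    then obtain a b where "(a, b) \<in> q" "a \<notin> C" "b \<notin> C"
      using exists_missed_pair[OF assms(3)] by blast
    then show "alt_prod p C * (\<Sum>B\<in>?X. of_bool (C \<subseteq> B) * alt_prod q B) = 0"
      using sum_supersets_alt_prod_zero[OF assms(3)] by simp
  qed
  finally show ?thesis .
qed

lemma alt_prod_orthogonal:
  assumes "finite A" "matching A p" "matching A q" "card p \<noteq> card q"
  shows "(\<Sum>B\<in>subsets_of_card A l. alt_prod p B * alt_prod q B) = 0"
  using alt_prod_orthogonal_less[OF assms(1-3)] alt_prod_orthogonal_less[OF assms(1,3,2)] assms(4)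
  by (cases "card p" "card q" rule: linorder_cases) (auto simp: mult.commute)

lemma alt_prod_nonzero_exists:
  assumes "finite A" "matching A p" "card p \<le> l" "card p + l \<le> card A"
  obtains B where "B \<in> subsets_of_card A l" "alt_prod p B \<noteq> 0"
proof -
  have fin: "finite p" using assms(2) by (rule matching_finite)
  note sub = Field_eq_fst_snd[of p]
  have dis: "fst ` p \<inter> snd ` p = {}" and inj: "inj_on fst p" "inj_on snd p"
    using assms(2) by (auto simp: matching_def)
  \<comment> \<open>The transversal takes the first point of every pair and is filled up with points
    outside \<open>Field p\<close>; the bound \<open>card p + l \<le> card A\<close> leaves enough
    of them.\<close>
  have "l - card p \<le> card (A - Field p)"
    using assms by (simp add: card_minus_Field_matching)
  then obtain R where R: "R \<subseteq> A - Field p" "card R = l - card p" "finite R"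
    using obtain_subset_with_card_n by metis
  let ?B = "fst ` p \<union> R"
  have "card ?B = l"
    using R assms(3) fin inj(1) sub
    by (subst card_Un_disjoint) (auto simp: card_image)
  moreover have "?B \<subseteq> A" using R Field_matching[OF assms(2)] sub by auto
  ultimately have "?B \<in> subsets_of_card A l" by (simp add: subsets_of_card_def)
  moreover have "alt_prod p ?B \<noteq> 0"
  proof
    assume "alt_prod p ?B = 0"
    then obtain a b where ab: "(a, b) \<in> p" "a \<in> ?B \<longleftrightarrow> b \<in> ?B"
      using fin by (auto simp: alt_prod_eq_0_iff)
    have "a \<in> fst ` p" "b \<in> snd ` p"
      using imageI[OF ab(1), of fst] imageI[OF ab(1), of snd] by auto
    then show False using ab(2) dis R(1) sub by auto
  qed
  ultimately show ?thesis using that by blast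
qed

text \<open>The summands are 0 or 1, so the sum counts the transversals among the
  \<open>l\<close>-subsets, and there is at least one.\<close>

lemma sum_alt_prod_square_nonzero:
  assumes "finite A" "matching A p" "card p \<le> l" "card p + l \<le> card A"
  shows "(\<Sum>B\<in>subsets_of_card A l. alt_prod p B * alt_prod p B) \<noteq> 0"
proof
  have fin: "finite p" using assms(2) by (rule matching_finite)
  obtain B0 where B0: "B0 \<in> subsets_of_card A l" "alt_prod p B0 \<noteq> 0"
    using alt_prod_nonzero_exists[OF assms] .
  assume "(\<Sum>B\<in>subsets_of_card A l. alt_prod p B * alt_prod p B) = 0"
  moreover have "(\<Sum>B\<in>subsets_of_card A l. alt_prod p B * alt_prod p B)
    = (\<Sum>B\<in>subsets_of_card A l. of_nat (of_bool (alt_prod p B \<noteq> 0)))"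
    using alt_prod_square[OF fin] by (intro sum.cong) auto
  ultimately have "(\<Sum>B\<in>subsets_of_card A l. of_bool (alt_prod p B \<noteq> 0) :: nat) = 0"
    by (simp only: of_nat_sum[symmetric] of_nat_eq_0_iff)
  then have "of_bool (alt_prod p B0 \<noteq> 0) = (0 :: nat)"
    using B0(1) assms(1) by (metis finite_subsets_of_card sum_eq_0_iff)
  then show False using B0(2) by simp
qed

text \<open>Downward induction on \<open>card q\<close>. The sum \<open>D q B'\<close> collects the sets \<open>B\<close> with \<open>B - Field q = B'\<close>;
  exchanging \<open>x\<close> for \<open>y\<close> in \<open>B'\<close> changes it by \<open>D (insert (x, y) q) (B' - {x}) = 0\<close>, so it does not
  depend on \<open>B'\<close>, and its total over \<open>B'\<close> vanishes by hypothesis.\<close>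

lemma alt_fun_complete:
  assumes "finite A" "l \<le> card A" "f \<in> M_space A l"
    and orth: "\<And>p. matching A p \<Longrightarrow> card p \<le> min l (card A - l) \<Longrightarrow>
      (\<Sum>B\<in>subsets_of_card A l. f B * alt_prod p B) = 0"
  shows "f = 0"
proof -
  let ?X = "subsets_of_card A l"
  define D where "D q B' = (\<Sum>B\<in>?X. of_bool (B - Field q = B') * (f B * alt_prod q B))" for q B'
  have D0: "D q B' = 0" if q: "matching A q" "card q \<le> min l (card A - l)" for q B'
    using q
  proof (induction "min l (card A - l) - card q" arbitrary: q B' rule: less_induct)
    case less
    have finq: "finite q" using less.prems(1) by (rule matching_finite)
    have Fq: "Field q \<subseteq> A" using less.prems(1) by (rule Field_matching)
    let ?R = "A - Field q" and ?j = "card q"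
    let ?Y = "subsets_of_card ?R (l - ?j)"
    define g where "g C = (if C \<in> ?Y then D q C else 0)" for C
    \<comment> \<open>A transversal of \<open>q\<close> uses exactly \<open>card q\<close> points of
      \<open>Field q\<close>, so \<open>l - card q\<close> of its points lie outside.\<close>
    have supp: "D q C = 0" if "C \<notin> ?Y" for C
    proof -
      have "of_bool (B - Field q = C) * (f B * alt_prod q B) = 0" if B: "B \<in> ?X" for B
      proof (cases "alt_prod q B = 0")
        case False
        have "finite B" using B assms(1) by (auto simp: subsets_of_card_def finite_subset)
        then have "card (B - Field q) = l - ?j"
          using B card_Field_inter[OF less.prems(1) False]
          by (simp add: card_Diff_subset_Int subsets_of_card_def Int_commute)
        then show ?thesis using B \<open>C \<notin> ?Y\<close> by (auto simp: subsets_of_card_def)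
      qed simp
      then show ?thesis unfolding D_def by (intro sum.neutral) blast
    qed
    \<comment> \<open>For the empty matching the uniqueness lemma says that a function invariant
      under all exchanges is constant.\<close>
    obtain c where c: "g = c *\<^sub>C alt_fun ?R (l - ?j) {}"
    proof (rule alt_fun_unique[of ?R "{}" g "l - ?j"])
      show "finite ?R" "matching ?R {}" using assms(1) by auto
      show "g \<in> M_space ?R (l - ?j)" by (simp add: g_def M_space_def functions_on_def)
    next
      fix x y C assume xy: "x \<in> ?R - Field {}" "y \<in> ?R - Field {}" "C \<in> ?Y" "x \<in> C" "y \<notin> C"
      let ?C = "swap x y ` C" and ?q = "insert (x, y) q"
      have C: "?C = insert y (C - {x})" using xy by (intro image_transpose_swap)
      have CY: "?C \<in> ?Y"
        using transpose_subsets_of_card[of x ?R y] xy by (auto simp: bij_betw_def)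
      have "x \<noteq> y" using xy by auto
      have xyq: "(x, y) \<notin> q" using xy by (auto simp: Field_def)
      have mq: "matching A ?q"
        by (rule matching_insert[OF less.prems(1)]) (use xy \<open>x \<noteq> y\<close> in auto)
      have finR: "finite ?R" using assms(1) by simp
      have "card C < card ?R"
        using xy finR by (intro psubset_card_mono) (auto simp: subsets_of_card_def)
      moreover have "finite C"
        using xy(3) finR by (auto simp: subsets_of_card_def intro: finite_subset)
      then have "0 < card C" using xy(4) card_gt_0_iff by blast
      moreover have "card C = l - ?j" using xy by (simp add: subsets_of_card_def)
      moreover have "card ?R = card A - 2 * ?j"
        using assms(1) less.prems(1) by (rule card_minus_Field_matching)
      \<comment> \<open>The exchange needs a point inside \<open>C\<close> and one outside, so
        \<open>l - ?j\<close> and \<open>card A - l - ?j\<close> are both positive and the enlarged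
        matching still satisfies the size bound of the induction.\<close>
      ultimately have jm: "?j < min l (card A - l)"
        using less.prems(2) by linarith
      have "0 = D ?q (C - {x})"
        using less.hyps[OF diff_less_mono2 mq] jm xyq finq by simp
      also have "\<dots> = (\<Sum>B\<in>?X. of_bool (B - Field q = C) * (f B * alt_prod q B)
          - of_bool (B - Field q = ?C) * (f B * alt_prod q B))"
        unfolding D_def
      proof (rule sum.cong[OF refl])
        fix B assume B: "B \<in> ?X"
        have F: "Field ?q = insert x (insert y (Field q))" by (auto simp: Field_def)
        have a: "alt_prod ?q B = (of_bool (x \<in> B) - of_bool (y \<in> B)) * alt_prod q B"
          using finq xyq by (rule alt_prod_insert)
        have xq: "x \<notin> Field q" "y \<notin> Field q" using xy by auto
        \<comment> \<open>The new factor is 1 on the sets that contain \<open>x\<close> only, which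
          may restrict to \<open>C\<close>, and -1 on those that contain \<open>y\<close> only,
          which may restrict to the exchanged set; it vanishes on all others.\<close>
        consider "x \<in> B" "y \<notin> B" | "x \<notin> B" "y \<in> B" | "x \<in> B \<longleftrightarrow> y \<in> B" by blast
        then show "of_bool (B - Field ?q = C - {x}) * (f B * alt_prod ?q B)
          = of_bool (B - Field q = C) * (f B * alt_prod q B)
          - of_bool (B - Field q = ?C) * (f B * alt_prod q B)"
        proof cases
          case 1
          then have "B - Field ?q = C - {x} \<longleftrightarrow> B - Field q = C" "B - Field q \<noteq> ?C"
            unfolding F C using xq xy by auto
          then show ?thesis using 1 a by simp
        next
          case 2
          then have "B - Field ?q = C - {x} \<longleftrightarrow> B - Field q = ?C" "B - Field q \<noteq> C"
            unfolding F C using xq xy by auto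
          then show ?thesis using 2 a by simp
        next
          case 3
          then have "B - Field q \<noteq> ?C" "B - Field q \<noteq> C"
            unfolding F C using xq xy by auto
          then show ?thesis using 3 a by simp
        qed
      qed
      also have "\<dots> = D q C - D q ?C"
        by (simp add: D_def sum_subtractf)
      finally show "g ?C = g C" using CY xy by (simp add: g_def)
    qed auto
    have "0 = (\<Sum>B\<in>?X. f B * alt_prod q B)" using orth[OF less.prems] by simp
    also have "\<dots> = (\<Sum>B\<in>?X. \<Sum>C\<in>Pow ?R. of_bool (B - Field q = C) * (f B * alt_prod q B))"
    proof (rule sum.cong[OF refl])
      fix B assume "B \<in> ?X"
      then have "B - Field q \<in> Pow ?R" by (auto simp: subsets_of_card_def)
      then show "f B * alt_prod q B
        = (\<Sum>C\<in>Pow ?R. of_bool (B - Field q = C) * (f B * alt_prod q B))"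
        using assms(1) by (simp add: of_bool_def if_distrib[of "\<lambda>x. x * _"] cong: if_cong)
    qed
    also have "\<dots> = (\<Sum>C\<in>Pow ?R. D q C)"
      unfolding D_def by (rule sum.swap)
    also have "\<dots> = (\<Sum>C\<in>?Y. D q C)"
      using assms(1) supp by (intro sum.mono_neutral_right) (auto simp: subsets_of_card_def)
    also have "\<dots> = (\<Sum>C\<in>?Y. g C)" by (simp add: g_def)
    also have "\<dots> = of_nat (card ?Y) * c" by (simp add: c alt_fun_def)
    finally have "c = 0 \<or> ?Y = {}" using assms(1) by auto
    then show ?case
    proof
      assume "c = 0"
      then have "g B' = 0" using c by simp
      then show ?thesis using supp[of B'] by (auto simp: g_def split: if_splits)
    qed (use supp in auto)
  qed
  have "f B = 0" for B
  proof (cases "B \<in> ?X")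
    case True
    have "0 = D {} B" using D0[of "{}" B] by simp
    also have "\<dots> = f B"
      using True assms(1) by (simp add: D_def of_bool_def if_distrib[of "\<lambda>x. x * _"] cong: if_cong)
    finally show ?thesis by simp
  qed (use assms(3) in \<open>simp add: M_space_def functions_on_def\<close>)
  then show ?thesis by (simp add: fun_eq_iff)
qed


section \<open>Two-row Specht modules\<close>

definition matchings :: "'a set \<Rightarrow> nat \<Rightarrow> ('a \<times> 'a) set set"
  where "matchings A j = {p. matching A p \<and> card p = j}"

text \<open>A tabloid with two rows is determined by its second row \<open>C\<close>, so this is the
  alternating product on \<open>card p\<close>-subsets carried over to tabloids and extended by
  zero.\<close>

definition alt_tab :: "'a set \<Rightarrow> ('a \<times> 'a) set \<Rightarrow> 'a set list \<Rightarrow> complex"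
  where "alt_tab A p = (\<lambda>T. if \<exists>C\<in>subsets_of_card A (card p). T = [A - C, C]
    then alt_prod p (T ! 1) else 0)"

lemma alt_tab_apply: "C \<in> subsets_of_card A (card p) \<Longrightarrow> alt_tab A p [A - C, C] = alt_prod p C"
  by (auto simp: alt_tab_def)

text \<open>For \<open>l = card p\<close> the symmetry in the remaining points is automatic: a
  transversal of that size has no point outside \<open>Field p\<close>, so \<open>f\<close> vanishes
  on both sets of any exchange there.\<close>

lemma alt_fun_unique_top:
  assumes "finite A" "matching A p" "f \<in> M_space A (card p)"
    and anti: "\<And>a b B. (a, b) \<in> p \<Longrightarrow> B \<in> subsets_of_card A (card p) \<Longrightarrow>
      f (swap a b ` B) = - f B"
  obtains c where "f = c *\<^sub>C alt_fun A (card p) p"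
proof -
  have zero: "f B = 0" if B: "B \<in> subsets_of_card A (card p)" "x \<in> B" "x \<notin> Field p" for B x
  proof (rule ccontr)
    assume nz: "f B \<noteq> 0"
    have "alt_prod p B \<noteq> 0"
    proof
      assume "alt_prod p B = 0"
      then obtain a b where ab: "(a, b) \<in> p" "a \<in> B \<longleftrightarrow> b \<in> B"
        using matching_finite[OF assms(2)] by (auto simp: alt_prod_eq_0_iff)
      then have "f B = - f B"
        using anti[OF ab(1) B(1)] image_transpose_same[OF ab(2)] by simp
      then show False using nz by simp
    qed
    then have "card (Field p \<inter> B) = card B"
      using card_Field_inter[OF assms(2)] B(1) by (simp add: subsets_of_card_def)
    moreover have "finite B"
      using B(1) assms(1) by (auto simp: subsets_of_card_def intro: finite_subset)
    ultimately have "Field p \<inter> B = B" by (metis Int_lower2 card_subset_eq)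
    then show False using B by blast
  qed
  have sym: "f (swap x y ` B) = f B"
    if xy: "x \<in> A - Field p" "y \<in> A - Field p" "B \<in> subsets_of_card A (card p)" "x \<in> B" "y \<notin> B"
    for x y B
  proof -
    have "swap x y ` B \<in> subsets_of_card A (card p)"
      using transpose_subsets_of_card[of x A y] xy by (auto simp: bij_betw_def)
    moreover have "y \<in> swap x y ` B"
      using image_transpose_swap[OF xy(4,5)] by simp
    ultimately show ?thesis
      using zero xy by (metis DiffD2)
  qed
  show ?thesis
  proof (rule alt_fun_unique[OF assms(1-3)])
    fix a b B assume "(a, b) \<in> p" "B \<in> subsets_of_card A (card p)"
    then show "f (swap a b ` B) = - f B" by (rule anti)
  qed (use sym that in blast)+
qed

lemma diagram_two_rows:
  "diagram [a, b] = Pair 0 ` {..<a} \<union> Pair 1 ` {..<b}"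
  by (auto simp: diagram_def less_Suc_eq nth_Cons split: nat.splits)

lemma tabloid_act_permutes:
  assumes "s permutes A"
  shows "tabloid_act s [A - C, C] = [A - s ` C, s ` C]"
proof -
  have "s ` (A - C) = s ` A - s ` C"
    by (rule image_set_diff) (use assms permutes_inj in blast)
  then show ?thesis using assms by (simp add: tabloid_act_def permutes_image)
qed

text \<open>The signed sum \<open>f\<close> over the column group changes sign under every column
  transposition, hence is a multiple of the alternating product; comparing values at the second row
  shows that the factor is 1. The pairs lead from the second row to the first so that the
  alternating product is 1, without a sign, at the second row.\<close>

lemma polytabloid_eq_alt_tab:
  assumes "finite A" "2 * j \<le> card A" and t: "t \<in> tableaux [card A - j, j] A"
  defines "p \<equiv> (\<lambda>x. (t (1, x), t (0, x))) ` {..<j}"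
  shows "p \<in> matchings A j" and "polytabloid [card A - j, j] A t = alt_tab A p"
proof -
  let ?lam = "[card A - j, j]" and ?k = "card A - j"
  have jk: "j \<le> ?k" using assms(2) by simp
  have bij: "bij_betw t (diagram ?lam) A" using t by (simp add: tableaux_def)
  have D: "(0, x) \<in> diagram ?lam \<longleftrightarrow> x < ?k" "(Suc 0, x) \<in> diagram ?lam \<longleftrightarrow> x < j" for x
    by (auto simp: diagram_two_rows)
  have inj: "t u = t v \<longleftrightarrow> u = v" if "u \<in> diagram ?lam" "v \<in> diagram ?lam" for u v
    using bij that by (auto simp: bij_betw_def inj_on_def)
  have tA: "t u \<in> A" if "u \<in> diagram ?lam" for u
    using bij that by (auto simp: bij_betw_def)
  have tne: "t (0, x) \<noteq> t (Suc 0, y)" if "x < ?k" "y < j" for x y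
    using inj[of "(0, x)" "(Suc 0, y)"] that D by simp
  have t0: "t (0, x) = t (0, y) \<longleftrightarrow> x = y" if "x < ?k" "y < ?k" for x y
    using inj[of "(0, x)" "(0, y)"] that D by simp
  have t1: "t (Suc 0, x) = t (Suc 0, y) \<longleftrightarrow> x = y" if "x < j" "y < j" for x y
    using inj[of "(Suc 0, x)" "(Suc 0, y)"] that D by simp
  have "inj_on (\<lambda>x. (t (1, x), t (0, x))) {..<j}"
    using t1 by (auto simp: inj_on_def)
  then have cardp: "card p = j" by (simp add: p_def card_image)
  have mp: "matching A p"
    unfolding matching_def
  proof (intro conjI)
    show "finite p" by (simp add: p_def)
    show "inj_on fst p" "inj_on snd p"
      using t0 t1 jk by (auto simp: p_def inj_on_def)
    show "fst ` p \<inter> snd ` p = {}"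
      using tne jk by (auto simp: p_def) (metis order_less_le_trans)
    show "fst ` p \<union> snd ` p \<subseteq> A"
      using tA D jk by (auto simp: p_def)
  qed
  then show pm: "p \<in> matchings A j" using cardp by (simp add: matchings_def)
  define R where "R = (\<lambda>x. t (Suc 0, x)) ` {..<j}"
  have Rsub: "R \<in> subsets_of_card A (card p)"
  proof -
    have "inj_on (\<lambda>x. t (Suc 0, x)) {..<j}" using t1 by (auto simp: inj_on_def)
    then show ?thesis
      using tA D cardp by (auto simp: subsets_of_card_def R_def card_image)
  qed
  have "A = (\<lambda>x. t (0, x)) ` {..<?k} \<union> R"
    using bij by (auto simp: bij_betw_def diagram_two_rows R_def image_Un image_image)
  moreover have "(\<lambda>x. t (0, x)) ` {..<?k} \<inter> R = {}"
    using tne by (auto simp: R_def)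
  ultimately have row0: "(\<lambda>x. t (0, x)) ` {..<?k} = A - R" by blast
  have tabloid: "tabloid ?lam t = [A - R, R]"
    using row0 by (simp add: tabloid_def R_def)
  let ?CS = "column_stabilizer ?lam A t"
  have CSperm: "s permutes A" if "s \<in> ?CS" for s
    using that by (simp add: column_stabilizer_def)
  have CScol: "\<exists>i'. (i', x) \<in> diagram ?lam \<and> s (t (i, x)) = t (i', x)"
    if "s \<in> ?CS" "(i, x) \<in> diagram ?lam" for s i x
    using that by (auto simp: column_stabilizer_def)
  define f where "f C = (\<Sum>s\<in>?CS. if C = s ` R then of_int (sign s) else (0 :: complex))" for C
  have finCS: "finite ?CS"
    by (rule finite_subset[OF _ finite_permutations[OF assms(1)]]) (use CSperm in auto)
  have poly: "polytabloid ?lam A t T = (if \<exists>C\<in>subsets_of_card A (card p). T = [A - C, C]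
    then f (T ! 1) else 0)" for T
  proof -
    have *: "T = tabloid_act s (tabloid ?lam t) \<longleftrightarrow>
      (\<exists>C\<in>subsets_of_card A (card p). T = [A - C, C]) \<and> T ! 1 = s ` R" if "s \<in> ?CS" for s
    proof -
      have "s ` R \<in> subsets_of_card A (card p)"
        using subsets_of_card_image[OF permutes_imp_bij[OF CSperm[OF that]]] Rsub
        by (auto simp: bij_betw_def)
      then show ?thesis
        unfolding tabloid tabloid_act_permutes[OF CSperm[OF that]] by auto
    qed
    show ?thesis
      unfolding polytabloid_def f_def by (auto simp: * intro!: sum.cong sum.neutral)
  qed
  \<comment> \<open>The pairs are the columns of height two, so composing with a pair transposition
    stays in the column group. This left multiplication reindexes the signed sum below.\<close>
  have swapCS: "swap a b \<circ> s \<in> ?CS" if "(a, b) \<in> p" "s \<in> ?CS" for a b s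
  proof -
    from that(1) obtain x where x: "x < j" "a = t (Suc 0, x)" "b = t (0, x)"
      by (auto simp: p_def)
    have ab: "a \<in> A" "b \<in> A" using matching_pair[OF mp that(1)] by auto
    have "\<exists>i'. (i', y) \<in> diagram ?lam \<and> (swap a b \<circ> s) (t (i, y)) = t (i', y)"
      if iy: "(i, y) \<in> diagram ?lam" for i y
    proof -
      obtain i' where i': "(i', y) \<in> diagram ?lam" "s (t (i, y)) = t (i', y)"
        using CScol[OF \<open>s \<in> ?CS\<close> iy] by blast
      have dx: "(0, x) \<in> diagram ?lam" "(Suc 0, x) \<in> diagram ?lam"
        using x(1) jk D by auto
      show ?thesis
      proof (cases "y = x")
        case True
        have "i' = 0 \<or> i' = 1" using i'(1) by (auto simp: diagram_two_rows)
        then show ?thesis using i' dx True x by auto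
      next
        case False
        then have "t (i', y) \<noteq> a" "t (i', y) \<noteq> b"
          using inj[OF i'(1)] dx x by auto
        then show ?thesis using i' by auto
      qed
    qed
    moreover have "swap a b \<circ> s permutes A"
      by (rule permutes_compose[OF CSperm[OF that(2)] permutes_swap_id[OF ab]])
    ultimately show ?thesis by (auto simp: column_stabilizer_def)
  qed
  have "f (swap a b ` C) = - f C" if ab: "(a, b) \<in> p" for a b C
  proof -
    let ?t = "swap a b"
    have "bij_betw ((\<circ>) ?t) ?CS ?CS"
      by (rule bij_betw_byWitness[where f' = "(\<circ>) ?t"])
        (use swapCS[OF ab] in \<open>auto simp: o_assoc[symmetric] simp flip: comp_assoc\<close>)
    then have "f (?t ` C)
      = (\<Sum>s\<in>?CS. if ?t ` C = (?t \<circ> s) ` R then of_int (sign (?t \<circ> s)) else 0)"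
      unfolding f_def by (rule sum.reindex_bij_betw[symmetric])
    also have "\<dots> = (\<Sum>s\<in>?CS. - (if C = s ` R then of_int (sign s) else 0))"
    proof (rule sum.cong[OF refl])
      fix s assume s: "s \<in> ?CS"
      have "permutation s"
        using CSperm[OF s] assms(1) permutation_permutes by blast
      then have "sign (?t \<circ> s) = - sign s"
        using matching_pair(3)[OF mp ab]
        by (simp add: sign_compose sign_swap_id permutation_swap_id)
      moreover have "?t ` C = (?t \<circ> s) ` R \<longleftrightarrow> C = s ` R"
        by (simp only: image_comp[symmetric] inj_image_eq_iff[OF inj_transpose])
      ultimately show "(if ?t ` C = (?t \<circ> s) ` R then of_int (sign (?t \<circ> s)) else 0)
        = - (if C = s ` R then of_int (sign s) else (0 :: complex))"
        by simp
    qed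
    also have "\<dots> = - f C" by (simp add: f_def sum_negf)
    finally show ?thesis .
  qed
  note anti = this
  define f' where "f' C = (if C \<in> subsets_of_card A (card p) then f C else 0)" for C
  obtain c where c: "f' = c *\<^sub>C alt_fun A (card p) p"
  proof (rule alt_fun_unique_top[OF assms(1) mp])
    show "f' \<in> M_space A (card p)" by (simp add: f'_def M_space_def functions_on_def)
    fix a b B assume ab: "(a, b) \<in> p" and B: "B \<in> subsets_of_card A (card p)"
    have "swap a b ` B \<in> subsets_of_card A (card p)"
      using transpose_subsets_of_card[OF matching_pair(1,2)[OF mp ab]] B by (auto simp: bij_betw_def)
    then show "f' (swap a b ` B) = - f' B"
      using B anti[OF ab] by (simp add: f'_def)
  qed
  have "f R = 1" \<comment> \<open>only the identity among the column permutations fixes the second row\<close>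
  proof -
    have "s = id" if s: "s \<in> ?CS" "R = s ` R" for s
    proof
      fix z
      have sinj: "s u = s v \<longleftrightarrow> u = v" for u v
        using permutes_inj[OF CSperm[OF s(1)]] by (auto dest: injD)
      have fix1: "s (t (Suc 0, x)) = t (Suc 0, x)" if x: "x < j" for x
      proof -
        obtain i' where i': "(i', x) \<in> diagram ?lam" "s (t (Suc 0, x)) = t (i', x)"
          using CScol[OF s(1)] D x by blast
        have "t (i', x) \<in> R" using x s(2) i'(2) unfolding R_def by (metis image_eqI lessThan_iff)
        moreover have "t (0, x) \<notin> R" using tne[of x] x jk by (auto simp: R_def)
        ultimately have "i' \<noteq> 0" by (intro notI) simp
        then show ?thesis using i' by (auto simp: diagram_two_rows)
      qed
      \<comment> \<open>An entry of the first row cannot move down its column, since that place is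
        already the image of the fixed entry there.\<close>
      have fix0: "s (t (0, x)) = t (0, x)" if x: "x < ?k" for x
      proof -
        obtain i' where i': "(i', x) \<in> diagram ?lam" "s (t (0, x)) = t (i', x)"
          using CScol[OF s(1)] D x by blast
        have "i' = 0"
        proof (rule ccontr)
          assume "i' \<noteq> 0"
          then have "i' = Suc 0" "x < j" using i'(1) by (auto simp: diagram_two_rows)
          then have "s (t (0, x)) = s (t (Suc 0, x))" using fix1 i' by simp
          then show False using tne[OF x \<open>x < j\<close>] sinj by blast
        qed
        then show ?thesis using i' by simp
      qed
      show "s z = id z"
      proof (cases "z \<in> A")
        case True
        then obtain u where "u \<in> diagram ?lam" "z = t u"
          using bij unfolding bij_betw_def by blast
        then show ?thesis using fix0 fix1 by (auto simp: diagram_two_rows)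
      next
        case False
        then show ?thesis using CSperm[OF s(1)] by (simp add: permutes_not_in)
      qed
    qed
    moreover have "id \<in> ?CS"
      by (auto simp: column_stabilizer_def permutes_id)
    ultimately have "f R = (\<Sum>s\<in>?CS. if s = id then 1 else 0)"
      unfolding f_def by (intro sum.cong refl) (auto simp: sign_id)
    then show ?thesis using finCS \<open>id \<in> ?CS\<close> by simp
  qed
  moreover have "alt_prod p R = 1"
  proof -
    have "of_bool (fst x \<in> R) - of_bool (snd x \<in> R) = (1 :: complex)" if "x \<in> p" for x
      using that tne jk by (auto simp: p_def R_def)
    then show ?thesis by (auto simp: alt_prod_def split_beta intro!: prod.neutral)
  qed
  ultimately have "c = 1"
    using Rsub fun_cong[OF c, of R] by (simp add: f'_def alt_fun_def)
  then have "f C = alt_prod p C" if "C \<in> subsets_of_card A (card p)" for C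
    using that fun_cong[OF c, of C] by (simp add: f'_def alt_fun_def)
  then show "polytabloid ?lam A t = alt_tab A p"
    by (auto simp: fun_eq_iff poly alt_tab_def)
qed

lemma matching_tableau:
  assumes "finite A" "p \<in> matchings A j" "2 * j \<le> card A"
  obtains t where "t \<in> tableaux [card A - j, j] A" "p = (\<lambda>x. (t (1, x), t (0, x))) ` {..<j}"
proof -
  let ?k = "card A - j"
  have mp: "matching A p" "card p = j" using assms(2) by (auto simp: matchings_def)
  have fin: "finite p" using mp(1) by (rule matching_finite)
  note sub = Field_eq_fst_snd[of p]
  have cardR: "card (A - Field p) = ?k - j"
    using card_minus_Field_matching[OF assms(1) mp(1)] mp(2) by simp
  obtain h where h: "bij_betw h {..<j} p"
    using ex_bij_betw_nat_finite[OF fin] mp(2) by (auto simp: atLeast0LessThan)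
  have "card {j..<?k} = card (A - Field p)" using cardR by simp
  then obtain e where e: "bij_betw e {j..<?k} (A - Field p)"
    using assms(1) finite_same_card_bij by blast
  \<comment> \<open>The columns of height two are filled with the pairs, enumerated by
    \<open>h\<close>, and the rest of the first row with the points outside \<open>Field p\<close>,
    enumerated by \<open>e\<close>.\<close>
  define t where "t u = (if fst u = Suc 0 then fst (h (snd u))
    else if snd u < j then snd (h (snd u)) else e (snd u))" for u
  have jk: "j \<le> ?k" using assms(3) by simp
  have "t ` diagram [?k, j] = A"
  proof -
    have split: "{..<?k} = {..<j} \<union> {j..<?k}" using jk by auto
    have "t ` diagram [?k, j] = snd ` h ` {..<j} \<union> e ` {j..<?k} \<union> fst ` h ` {..<j}"
      unfolding diagram_two_rows split image_Un image_image
      by (intro arg_cong2[where f = "(\<union>)"] image_cong refl) (auto simp: t_def)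
    also have "\<dots> = A"
      using h e Field_matching[OF mp(1)] unfolding sub by (auto simp: bij_betw_def)
    finally show ?thesis .
  qed
  moreover have "finite (diagram [?k, j])" by (simp add: diagram_two_rows)
  moreover have "card (diagram [?k, j]) = card A"
    unfolding diagram_two_rows using assms(3)
    by (subst card_Un_disjoint) (auto simp: card_image inj_on_def)
  ultimately have "t \<in> tableaux [?k, j] A"
    by (simp add: tableaux_def bij_betw_def eq_card_imp_inj_on)
  moreover have "(\<lambda>x. (t (1, x), t (0, x))) ` {..<j} = h ` {..<j}"
    by (intro image_cong refl) (simp add: t_def)
  ultimately show ?thesis using that h by (simp add: bij_betw_def)
qed

lemma specht_two_rows:
  assumes "finite A" "2 * j \<le> card A"
  shows "specht [card A - j, j] A = cvec.span (alt_tab A ` matchings A j)"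
proof -
  have "polytabloid [card A - j, j] A ` tableaux [card A - j, j] A = alt_tab A ` matchings A j"
  proof (intro Set.set_eqI iffI)
    fix f assume "f \<in> polytabloid [card A - j, j] A ` tableaux [card A - j, j] A"
    then obtain t where t: "t \<in> tableaux [card A - j, j] A" "f = polytabloid [card A - j, j] A t"
      by blast
    show "f \<in> alt_tab A ` matchings A j"
      unfolding t(2) polytabloid_eq_alt_tab(2)[OF assms t(1)]
      by (rule imageI) (rule polytabloid_eq_alt_tab(1)[OF assms t(1)])
  next
    fix f assume "f \<in> alt_tab A ` matchings A j"
    then obtain p where p: "p \<in> matchings A j" "f = alt_tab A p" by blast
    obtain t where t: "t \<in> tableaux [card A - j, j] A" "p = (\<lambda>x. (t (1, x), t (0, x))) ` {..<j}"
      using matching_tableau[OF assms(1) p(1) assms(2)] .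
    show "f \<in> polytabloid [card A - j, j] A ` tableaux [card A - j, j] A"
      unfolding p(2) t(2) polytabloid_eq_alt_tab(2)[OF assms t(1), symmetric]
      by (rule imageI) (rule t(1))
  qed
  then show ?thesis by (simp add: specht_def)
qed

section \<open>The isotypic components of the subset representations\<close>

lemma sym_on_simps [simp]:
  "g \<in> carrier (sym_on A) \<longleftrightarrow> g permutes A" "\<one>\<^bsub>sym_on A\<^esub> = id" "g \<otimes>\<^bsub>sym_on A\<^esub> h = g \<circ> h"
  by (simp_all add: sym_on_def)

lemma group_sym_on: "group (sym_on A)"
proof (rule groupI)
  fix g assume "g \<in> carrier (sym_on A)"
  then show "\<exists>h\<in>carrier (sym_on A). h \<otimes>\<^bsub>sym_on A\<^esub> g = \<one>\<^bsub>sym_on A\<^esub>"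
    by (auto intro!: bexI[of _ "inv' g"] simp: permutes_inv permutes_inv_o)
qed (auto simp: permutes_compose permutes_id comp_assoc)

lemma inv_sym_on: "g permutes A \<Longrightarrow> inv\<^bsub>sym_on A\<^esub> g = inv' g"
  by (rule group.inv_equality[OF group_sym_on]) (auto simp: permutes_inv permutes_inv_o)

lemma M_rep_apply: "g permutes A \<Longrightarrow> M_rep A g f B = f (inv' g ` B)"
  by (simp add: M_rep_def perm_rep_def inv_sym_on)

lemma specht_rep_apply: "g permutes A \<Longrightarrow> specht_rep A g f T = f (tabloid_act (inv' g) T)"
  by (simp add: specht_rep_def perm_rep_def inv_sym_on)

lemma tabloid_act_compose: "tabloid_act (g \<circ> h) T = tabloid_act g (tabloid_act h T)"
  by (simp add: tabloid_act_def image_comp)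

lemma tabloid_act_id: "tabloid_act id T = T"
  by (simp add: tabloid_act_def)

lemma alt_prod_inv:
  assumes "g permutes A"
  shows "alt_prod p (inv' g ` B) = alt_prod (map_prod g g ` p) B"
proof -
  have "alt_prod (map_prod g g ` p) B = alt_prod (map_prod g g ` p) (g ` inv' g ` B)"
    using assms by (simp add: image_comp permutes_inv_o)
  then show ?thesis using alt_prod_image[OF permutes_inj[OF assms]] by metis
qed

lemma image_subsets_of_card_iff:
  assumes "g permutes A"
  shows "inv' g ` B \<in> subsets_of_card A l \<longleftrightarrow> B \<in> subsets_of_card A l"
proof -
  have *: "h ` C \<in> subsets_of_card A l" if "h permutes A" "C \<in> subsets_of_card A l" for h C
    using subsets_of_card_image[OF permutes_imp_bij[OF that(1)]] that(2) by (auto simp: bij_betw_def)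
  have "g ` inv' g ` B = B" using assms by (simp add: image_comp permutes_inv_o)
  then show ?thesis using *[OF assms] *[OF permutes_inv[OF assms]] by metis
qed

lemma matchings_image:
  assumes "g permutes A" "p \<in> matchings A j"
  shows "map_prod g g ` p \<in> matchings A j"
  using assms matching_image[of A p g] permutes_inj[OF assms(1)]
  by (simp add: matchings_def card_map_prod_image permutes_image)

lemma M_rep_alt_fun:
  assumes "g permutes A"
  shows "M_rep A g (alt_fun A l p) = alt_fun A l (map_prod g g ` p)"
  using assms
  by (simp add: fun_eq_iff M_rep_apply alt_fun_def image_subsets_of_card_iff alt_prod_inv)

lemma specht_rep_tab:
  assumes "g permutes A"
  shows "(\<exists>C\<in>subsets_of_card A l. tabloid_act (inv' g) T = [A - C, C])
    \<longleftrightarrow> (\<exists>C\<in>subsets_of_card A l. T = [A - C, C])"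
proof -
  have *: "\<exists>C\<in>subsets_of_card A l. tabloid_act h T = [A - C, C]"
    if "h permutes A" "\<exists>C\<in>subsets_of_card A l. T = [A - C, C]" for h T
    using that tabloid_act_permutes[OF that(1)] image_subsets_of_card_iff[OF permutes_inv[OF that(1)]]
    by (metis permutes_inv_inv)
  have "tabloid_act g (tabloid_act (inv' g) T) = T"
    using assms by (simp add: tabloid_act_compose[symmetric] permutes_inv_o tabloid_act_id)
  then show ?thesis using *[OF assms] *[OF permutes_inv[OF assms]] by metis
qed

lemma tabloid_act_pair [simp]: "tabloid_act g [B, C] = [g ` B, g ` C]"
  by (simp add: tabloid_act_def)

lemma specht_rep_alt_tab:
  assumes "g permutes A"
  shows "specht_rep A g (alt_tab A p) = alt_tab A (map_prod g g ` p)"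
proof
  fix T
  have [simp]: "card (map_prod g g ` p) = card p"
    by (rule card_map_prod_image[OF permutes_inj[OF assms]])
  show "specht_rep A g (alt_tab A p) T = alt_tab A (map_prod g g ` p) T"
    unfolding specht_rep_apply[OF assms] unfolding alt_tab_def specht_rep_tab[OF assms]
    using alt_prod_inv[OF assms, of p] by (auto )
qed

lemma group_rep_M_alt:
  "group_rep (sym_on A) (cvec.span (alt_fun A l ` matchings A j)) (M_rep A)"
  unfolding M_rep_def
proof (rule group_rep_perm_rep[OF group_sym_on])
  fix g u assume g: "g \<in> carrier (sym_on A)" and u: "u \<in> cvec.span (alt_fun A l ` matchings A j)"
  show "perm_rep (sym_on A) (`) g u \<in> cvec.span (alt_fun A l ` matchings A j)"
    by (rule perm_rep_span_closed[OF _ u])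
      (use g M_rep_alt_fun[of g A l] matchings_image[of g A]
        in \<open>auto simp: M_rep_def intro: cvec.span_base\<close>)
qed (auto simp: cvec.subspace_span image_comp)

lemma group_rep_specht:
  "group_rep (sym_on A) (cvec.span (alt_tab A ` matchings A j)) (specht_rep A)"
  unfolding specht_rep_def
proof (rule group_rep_perm_rep[OF group_sym_on])
  fix g u assume g: "g \<in> carrier (sym_on A)" and u: "u \<in> cvec.span (alt_tab A ` matchings A j)"
  show "perm_rep (sym_on A) tabloid_act g u \<in> cvec.span (alt_tab A ` matchings A j)"
    by (rule perm_rep_span_closed[OF _ u])
      (use g specht_rep_alt_tab[of g A] matchings_image[of g A]
        in \<open>auto simp: specht_rep_def intro: cvec.span_base\<close>)
qed (auto simp: cvec.subspace_span tabloid_act_compose tabloid_act_id)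

text \<open>The superset sum is antisymmetric under every pair, so it is a multiple of the
  alternating product on \<open>card p\<close>-subsets. By the expansion formula, \<open>c\<close>
  times the number of transversals of size \<open>card p\<close> is the number of those of size
  \<open>l\<close>, which is not zero.\<close>

lemma sum_supersets_alt_prod:
  assumes "finite A" "matching A p" "card p \<le> l" "card p + l \<le> card A"
  obtains c where "c \<noteq> 0" "\<And>C. C \<in> subsets_of_card A (card p) \<Longrightarrow>
    (\<Sum>B\<in>subsets_of_card A l. of_bool (C \<subseteq> B) * alt_prod p B) = c * alt_prod p C"
proof -
  let ?X = "subsets_of_card A l" and ?Y = "subsets_of_card A (card p)"
  define f where "f C = (if C \<in> ?Y then \<Sum>B\<in>?X. of_bool (C \<subseteq> B) * alt_prod p B else 0)" for C
  obtain c where c: "f = c *\<^sub>C alt_fun A (card p) p"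
  proof (rule alt_fun_unique_top[OF assms(1,2)])
    show "f \<in> M_space A (card p)" by (simp add: f_def M_space_def functions_on_def)
    fix a b C assume ab: "(a, b) \<in> p" and C: "C \<in> ?Y"
    let ?t = "swap a b"
    have A: "a \<in> A" "b \<in> A" using matching_pair[OF assms(2) ab] by auto
    have "?t ` C \<in> ?Y"
      using transpose_subsets_of_card[OF A] C by (auto simp: bij_betw_def)
    then have "f (?t ` C) = (\<Sum>B\<in>?X. of_bool (?t ` C \<subseteq> B) * alt_prod p B)"
      by (simp add: f_def)
    also have "\<dots> = (\<Sum>B\<in>?X. of_bool (?t ` C \<subseteq> ?t ` B) * alt_prod p (?t ` B))"
      by (rule sum.reindex_bij_betw[OF transpose_subsets_of_card[OF A], symmetric])
    also have "\<dots> = (\<Sum>B\<in>?X. - (of_bool (C \<subseteq> B) * alt_prod p B))"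
      by (simp add: alt_prod_swap[OF assms(2) ab] inj_image_subset_iff[OF inj_transpose])
    also have "\<dots> = - f C" using C by (simp add: f_def sum_negf)
    finally show "f (?t ` C) = - f C" .
  qed
  have val: "(\<Sum>B\<in>?X. of_bool (C \<subseteq> B) * alt_prod p B) = c * alt_prod p C" if "C \<in> ?Y" for C
    using that fun_cong[OF c, of C] by (simp add: f_def alt_fun_def)
  have "(\<Sum>B\<in>?X. alt_prod p B * alt_prod p B)
    = (\<Sum>C\<in>?Y. alt_prod p C * (\<Sum>B\<in>?X. of_bool (C \<subseteq> B) * alt_prod p B))"
    by (rule sum_alt_prod_expand[OF assms(1,2)])
  also have "\<dots> = (\<Sum>C\<in>?Y. alt_prod p C * (c * alt_prod p C))"
    by (intro sum.cong refl) (simp only: val)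
  also have "\<dots> = c * (\<Sum>C\<in>?Y. alt_prod p C * alt_prod p C)"
    by (simp only: sum_distrib_left mult_ac)
  finally have "c \<noteq> 0"
    using sum_alt_prod_square_nonzero[OF assms] by auto
  then show ?thesis using val that by blast
qed

text \<open>The isomorphism is the superset sum, read at the second row of a tabloid. It sends each
  generator to a nonzero multiple of a polytabloid, which gives the image; a function in its kernel
  is orthogonal to all generators by the expansion formula, hence to itself.\<close>

lemma rep_iso_M_specht:
  assumes "finite A" "j \<le> l" "j + l \<le> card A"
  shows "rep_iso (sym_on A) (cvec.span (alt_fun A l ` matchings A j)) (M_rep A)
    (specht [card A - j, j] A) (specht_rep A)"
proof -
  let ?V = "cvec.span (alt_fun A l ` matchings A j)"
  let ?X = "subsets_of_card A l" and ?Y = "subsets_of_card A j"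
  have S: "specht [card A - j, j] A = cvec.span (alt_tab A ` matchings A j)"
    using assms by (intro specht_two_rows) auto
  define T where "T w = (\<lambda>t. if \<exists>C\<in>?Y. t = [A - C, C]
    then \<Sum>B\<in>?X. of_bool (t ! 1 \<subseteq> B) * w B else (0 :: complex))" for w
  have lin: "linear_on ?V T"
    by (auto simp: linear_on_def T_def fun_eq_iff distrib_left sum.distrib sum_distrib_left mult_ac)
  have Tgen: "\<exists>c. c \<noteq> 0 \<and> T (alt_fun A l p) = c *\<^sub>C alt_tab A p" if p: "p \<in> matchings A j" for p
  proof -
    have mp: "matching A p" "card p = j" using p by (auto simp: matchings_def)
    obtain c where c: "c \<noteq> 0" "\<And>C. C \<in> ?Y \<Longrightarrow>
      (\<Sum>B\<in>?X. of_bool (C \<subseteq> B) * alt_prod p B) = c * alt_prod p C"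
      using sum_supersets_alt_prod[OF assms(1) mp(1)] assms(2,3) mp(2) by metis
    have "T (alt_fun A l p) t = (c *\<^sub>C alt_tab A p) t" for t
      using c(2) mp(2) by (auto simp: T_def alt_tab_def alt_fun_def)
    then show ?thesis using c(1) by blast
  qed
  have "inj_on T ?V"
  proof (rule linear_on_inj[OF lin cvec.subspace_span])
    fix w assume w: "w \<in> ?V" "T w = 0"
    have orth: "inner_on ?X w s = 0" if "s \<in> alt_fun A l ` matchings A j" for s
    proof -
      from that obtain p where p: "matching A p" "card p = j" "s = alt_fun A l p"
        by (auto simp: matchings_def)
      have "inner_on ?X w s = (\<Sum>B\<in>?X. w B * alt_prod p B)"
        by (simp add: inner_on_def p(3) alt_fun_def)
      also have "\<dots> = (\<Sum>C\<in>?Y. alt_prod p C * (\<Sum>B\<in>?X. of_bool (C \<subseteq> B) * w B))"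
        unfolding p(2)[symmetric] by (rule sum_alt_prod_expand[OF assms(1) p(1)])
      also have "\<dots> = (\<Sum>C\<in>?Y. alt_prod p C * T w [A - C, C])"
        by (intro sum.cong refl) (auto simp: T_def)
      finally show ?thesis using w(2) by simp
    qed
    have "?V \<subseteq> functions_on ?X"
      by (rule cvec.span_minimal[OF _ subspace_functions_on]) (auto simp: functions_on_def alt_fun_def)
    moreover have "inner_on ?X w w = 0"
      by (rule inner_on_span[OF orth w(1)])
    ultimately show "w = 0"
      using inner_on_self_functions[of ?X w] w(1) assms(1) by auto
  qed
  moreover have "T ` ?V = cvec.span (alt_tab A ` matchings A j)"
    unfolding linear_on_image_span[OF lin] image_image
    by (rule span_image_scaled) (rule Tgen)
  moreover have "T (M_rep A g w) = specht_rep A g (T w)" if g: "g permutes A" for g w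
  proof
    fix t
    have bij: "bij_betw ((`) (inv' g)) ?X ?X"
      by (rule subsets_of_card_image[OF permutes_imp_bij[OF permutes_inv[OF g]]])
    have "(\<Sum>B\<in>?X. of_bool (C \<subseteq> B) * w (inv' g ` B))
      = (\<Sum>B\<in>?X. of_bool (inv' g ` C \<subseteq> inv' g ` B) * w (inv' g ` B))" for C
      by (simp add: inj_image_subset_iff[OF permutes_inj[OF permutes_inv[OF g]]])
    also have "\<dots> C = (\<Sum>B\<in>?X. of_bool (inv' g ` C \<subseteq> B) * w B)" for C
      by (rule sum.reindex_bij_betw[OF bij])
    finally have *: "(\<Sum>B\<in>?X. of_bool (C \<subseteq> B) * w (inv' g ` B))
      = (\<Sum>B\<in>?X. of_bool (inv' g ` C \<subseteq> B) * w B)" for C .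
    show "T (M_rep A g w) t = specht_rep A g (T w) t"
      unfolding specht_rep_apply[OF g] unfolding T_def specht_rep_tab[OF g]
      by (auto simp: * M_rep_apply[OF g])
  qed
  ultimately show ?thesis
    unfolding rep_iso_def S using lin group_rep_M_alt group_rep_specht
    by (auto simp: bij_betw_def)
qed

lemma alt_tab_nonzero:
  assumes "finite A" "p \<in> matchings A j" "2 * j \<le> card A"
  shows "alt_tab A p \<noteq> 0"
proof -
  have mp: "matching A p" "card p = j" using assms(2) by (auto simp: matchings_def)
  obtain C where C: "C \<in> subsets_of_card A (card p)" "alt_prod p C \<noteq> 0"
    using alt_prod_nonzero_exists[OF assms(1) mp(1), of "card p"] mp(2) assms(3) by auto
  then have "alt_tab A p [A - C, C] \<noteq> 0" by (simp add: alt_tab_apply)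
  then show ?thesis by auto
qed

text \<open>The scalar \<open>c\<close> covers both cases that occur: -1 for the points of a pair
  and 1 for two points outside \<open>Field p\<close>.\<close>

lemma specht_rep_transpose:
  assumes "matching A p" "a \<in> A" "b \<in> A" 
    and "\<And>C. alt_prod p (swap a b ` C) = c * alt_prod p C"
  shows "specht_rep A (swap a b) (alt_tab A p) = c *\<^sub>C alt_tab A p"
proof
  fix T
  let ?t = "swap a b"
  have g: "?t permutes A" using assms(2,3) by (rule permutes_swap_id)
  show "specht_rep A ?t (alt_tab A p) T = (c *\<^sub>C alt_tab A p) T"
    unfolding specht_rep_apply[OF g] unfolding alt_tab_def specht_rep_tab[OF g]
    using assms(4) by (auto )
qed

text \<open>Existence is \<open>rep_iso_M_specht\<close>. For uniqueness, the inverse of any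
  isomorphism carries the behaviour of a polytabloid under transpositions over to its image, which
  is therefore a multiple of \<open>alt_fun A l p\<close>; injectivity makes the multiple nonzero,
  so the image is the whole span.\<close>

lemma S_component_eq:
  assumes "finite A" "j \<le> l" "j + l \<le> card A"
  shows "S_component A l j = cvec.span (alt_fun A l ` matchings A j)"
  unfolding S_component_def
proof (rule the_equality)
  show "cvec.span (alt_fun A l ` matchings A j) \<subseteq> M_space A l \<and>
    rep_iso (sym_on A) (cvec.span (alt_fun A l ` matchings A j)) (M_rep A)
      (specht [card A - j, j] A) (specht_rep A)"
    using rep_iso_M_specht[OF assms]
    by (intro conjI cvec.span_minimal)
      (auto simp: M_space_def subspace_functions_on, auto simp: functions_on_def alt_fun_def)
next
  fix V assume V: "V \<subseteq> M_space A l \<and>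
    rep_iso (sym_on A) V (M_rep A) (specht [card A - j, j] A) (specht_rep A)"
  have j: "2 * j \<le> card A" using assms by simp
  note S = specht_two_rows[OF assms(1) j]
  obtain T where T: "linear_on (specht [card A - j, j] A) T" "T ` specht [card A - j, j] A = V"
    "\<And>w. w \<in> specht [card A - j, j] A \<Longrightarrow> T w = 0 \<Longrightarrow> w = 0"
    "\<And>g w. g permutes A \<Longrightarrow> w \<in> specht [card A - j, j] A \<Longrightarrow>
      T (specht_rep A g w) = M_rep A g (T w)"
    by (rule rep_iso_inverse[OF conjunct2[OF V]]) simp
  have "\<exists>c. c \<noteq> 0 \<and> T (alt_tab A p) = c *\<^sub>C alt_fun A l p" if p: "p \<in> matchings A j" for p
  proof -
    have mp: "matching A p" "card p = j" using p by (auto simp: matchings_def)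
    have e: "alt_tab A p \<in> specht [card A - j, j] A"
      unfolding S using p by (auto intro: cvec.span_base)
    have tr: "T (alt_tab A p) (swap a b ` B) = d * T (alt_tab A p) B"
      if ab: "a \<in> A" "b \<in> A"
        and d: "\<And>C. alt_prod p (swap a b ` C) = d * alt_prod p C" for a b d B
    proof -
      have "M_rep A (swap a b) (T (alt_tab A p)) = d *\<^sub>C T (alt_tab A p)"
        using T(4)[OF permutes_swap_id[OF ab] e] specht_rep_transpose[OF mp(1) ab d] e T(1)
        by (simp add: linear_on_def)
      then have "M_rep A (swap a b) (T (alt_tab A p)) B = d * T (alt_tab A p) B"
        by simp
      then show ?thesis by (simp add: M_rep_apply[OF permutes_swap_id[OF ab]])
    qed
    obtain c where c: "T (alt_tab A p) = c *\<^sub>C alt_fun A l p"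
    proof (rule alt_fun_unique[OF assms(1) mp(1)])
      show "T (alt_tab A p) \<in> M_space A l" using V T(2) e by blast
    next
      fix a b B assume ab: "(a, b) \<in> p"
      show "T (alt_tab A p) (swap a b ` B) = - T (alt_tab A p) B"
        using tr[of a b "-1" B] matching_pair[OF mp(1) ab] alt_prod_swap[OF mp(1) ab] by simp
    next
      fix x y B assume "x \<in> A - Field p" "y \<in> A - Field p"
      then show "T (alt_tab A p) (swap x y ` B) = T (alt_tab A p) B"
        using tr[of x y 1 B] alt_prod_fixed[of x p y] by simp
    qed
    moreover have "T (alt_tab A p) \<noteq> 0"
      using T(3)[OF e] alt_tab_nonzero[OF assms(1) p j] by blast
    ultimately show ?thesis by auto
  qed
  then have "cvec.span ((\<lambda>p. T (alt_tab A p)) ` matchings A j)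
    = cvec.span (alt_fun A l ` matchings A j)"
    by (rule span_image_scaled)
  moreover have "V = cvec.span (T ` alt_tab A ` matchings A j)"
    using T(1,2) unfolding S by (metis linear_on_image_span)
  ultimately show "V = cvec.span (alt_fun A l ` matchings A j)"
    by (simp add: image_image)
qed


section \<open>The hyperoctahedral group and its action\<close>

\<comment> \<open>Otherwise \<open>{1..n}\<close> is rewritten to \<open>{Suc 0..n}\<close>.\<close>
declare One_nat_def [simp del]

lemma bit_add_self_eq_0: "a + a = (0 :: bit)"
  by (cases a) simp_all

lemma C2_add_self [simp]: "\<omega> + \<omega> = (0 :: nat \<Rightarrow> bit)" "\<omega> + (\<omega> + \<tau>) = (\<tau> :: nat \<Rightarrow> bit)"
  by (simp_all add: fun_eq_iff bit_add_self_eq_0 add.assoc[symmetric])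

lemma C2_add_eq_0: "\<omega> + \<tau> = 0 \<longleftrightarrow> \<omega> = (\<tau> :: nat \<Rightarrow> bit)"
  by (metis C2_add_self add_0_right)

lemma C2_act_apply: "C2_act g \<omega> z = \<omega> (inv' g z)"
  by (simp add: C2_act_def)

lemma C2_act_id [simp]: "C2_act id \<omega> = \<omega>"
  by (simp add: C2_act_def)

lemma C2_act_add: "C2_act g (\<omega> + \<tau>) = C2_act g \<omega> + C2_act g \<tau>"
  by (simp add: C2_act_def fun_eq_iff)

lemma C2_act_0 [simp]: "C2_act g 0 = 0"
  by (simp add: C2_act_def fun_eq_iff)

lemma C2_act_compose: "bij g \<Longrightarrow> bij h \<Longrightarrow> C2_act (g \<circ> h) \<omega> = C2_act g (C2_act h \<omega>)"
  by (simp add: C2_act_def o_inv_distrib fun_eq_iff)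

lemma C2_act_inv [simp]:
  assumes "g permutes A"
  shows "C2_act g (C2_act (inv' g) \<omega>) = \<omega>" "C2_act (inv' g) (C2_act g \<omega>) = \<omega>"
  using assms by (auto simp: C2_act_def fun_eq_iff permutes_inv_inv permutes_inverses)

lemma zero_C2_pow [simp]: "0 \<in> C2_pow n"
  by (simp add: C2_pow_def)

lemma C2_pow_add [simp]: "\<omega> \<in> C2_pow n \<Longrightarrow> \<tau> \<in> C2_pow n \<Longrightarrow> \<omega> + \<tau> \<in> C2_pow n"
  by (simp add: C2_pow_def)

lemma C2_pow_add_iff: "\<omega> \<in> C2_pow n \<Longrightarrow> \<omega> + \<tau> \<in> C2_pow n \<longleftrightarrow> \<tau> \<in> C2_pow n"
  using C2_pow_add[of \<omega> n "\<omega> + \<tau>"] by auto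

lemma C2_pow_act:
  assumes "g permutes {1..n}" "\<omega> \<in> C2_pow n"
  shows "C2_act g \<omega> \<in> C2_pow n"
  using assms permutes_not_in[OF permutes_inv[OF assms(1)]]
  by (auto simp: C2_pow_def C2_act_def)

lemma C2_pow_act_iff: "g permutes {1..n} \<Longrightarrow> C2_act g \<omega> \<in> C2_pow n \<longleftrightarrow> \<omega> \<in> C2_pow n"
  using C2_pow_act permutes_inv C2_act_inv(2) by metis

lemma finite_C2_pow [simp]: "finite (C2_pow n)"
proof (rule finite_imageD)
  show "finite ((\<lambda>\<omega>. {z. \<omega> z = 1}) ` C2_pow n)"
  proof (rule finite_subset)
    show "(\<lambda>\<omega>. {z. \<omega> z = 1}) ` C2_pow n \<subseteq> Pow {1..n}"
    proof (intro image_subsetI PowI subsetI, rule ccontr)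
      fix \<omega> :: "nat \<Rightarrow> bit" and z assume "\<omega> \<in> C2_pow n" "z \<in> {z. \<omega> z = 1}" "z \<notin> {1..n}"
      then have "\<omega> z = 0" "\<omega> z = 1" unfolding C2_pow_def by blast+
      then show False by simp
    qed
  qed simp
  show "inj_on (\<lambda>\<omega>. {z. \<omega> z = 1}) (C2_pow n)"
  proof (rule inj_onI)
    fix \<omega> \<tau> :: "nat \<Rightarrow> bit" assume "{z. \<omega> z = 1} = {z. \<tau> z = 1}"
    then show "\<omega> = \<tau>" by (auto simp: fun_eq_iff set_eq_iff) (metis bit_not_one_iff)
  qed
qed

lemma card_C2_pow_nonzero: "card (C2_pow n) \<noteq> 0"
  using zero_C2_pow by (metis card_0_eq empty_iff finite_C2_pow)

lemma wreath_simps [simp]: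
  "(\<omega>, g) \<in> carrier (wreath n) \<longleftrightarrow> \<omega> \<in> C2_pow n \<and> g permutes {1..n}"
  "\<one>\<^bsub>wreath n\<^esub> = (0, id)"
  "(\<theta>, g) \<otimes>\<^bsub>wreath n\<^esub> (\<omega>, h) = (\<theta> + C2_act g \<omega>, g \<circ> h)"
  by (simp_all add: wreath_def sym_group_carrier)

lemma group_wreath: "group (wreath n)"
proof (rule groupI)
  fix a assume a: "a \<in> carrier (wreath n)"
  obtain \<omega> g where "a = (\<omega>, g)" by (cases a)
  then show "\<exists>b\<in>carrier (wreath n). b \<otimes>\<^bsub>wreath n\<^esub> a = \<one>\<^bsub>wreath n\<^esub>"
    using a
    by (auto intro!: bexI[of _ "(C2_act (inv' g) \<omega>, inv' g)"]
        simp: permutes_inv permutes_inv_o C2_pow_act)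
next
  fix a b c assume "a \<in> carrier (wreath n)" "b \<in> carrier (wreath n)" "c \<in> carrier (wreath n)"
  then show "a \<otimes>\<^bsub>wreath n\<^esub> b \<otimes>\<^bsub>wreath n\<^esub> c = a \<otimes>\<^bsub>wreath n\<^esub> (b \<otimes>\<^bsub>wreath n\<^esub> c)"
    by (cases a, cases b, cases c)
      (auto simp: C2_act_add C2_act_compose permutes_bij add.assoc comp_assoc)
next
  fix a b assume "a \<in> carrier (wreath n)" "b \<in> carrier (wreath n)"
  then show "a \<otimes>\<^bsub>wreath n\<^esub> b \<in> carrier (wreath n)"
    by (cases a, cases b) (auto simp: C2_pow_act permutes_compose)
next
  fix a assume "a \<in> carrier (wreath n)"
  then show "\<one>\<^bsub>wreath n\<^esub> \<otimes>\<^bsub>wreath n\<^esub> a = a"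
    by (cases a) auto
qed (auto simp: permutes_id)

lemma inv_wreath:
  assumes "\<omega> \<in> C2_pow n" "g permutes {1..n}"
  shows "inv\<^bsub>wreath n\<^esub> (\<omega>, g) = (C2_act (inv' g) \<omega>, inv' g)"
  using assms
  by (intro group.inv_equality[OF group_wreath])
    (auto simp: permutes_inv permutes_inv_o C2_pow_act)

lemma finite_carrier_wreath: "finite (carrier (wreath n))"
  by (simp add: wreath_def sym_group_def finite_permutations)

lemma wreath_perm_rep_apply:
  assumes "\<omega> \<in> C2_pow n" "g permutes {1..n}"
  shows "wreath_perm_rep n (\<omega>, g) f (\<tau>, x) = f (C2_act (inv' g) (\<omega> + \<tau>), inv' g ` x)"
  using assms by (simp add: wreath_perm_rep_def perm_rep_def inv_wreath wreath_act_def C2_act_add)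

abbreviation Y_set :: "nat \<Rightarrow> nat \<Rightarrow> ((nat \<Rightarrow> bit) \<times> nat set) set"
  where "Y_set n r \<equiv> C2_pow n \<times> subsets_of_card {1..n} r"

lemma wreath_act_bij:
  assumes "\<omega> \<in> C2_pow n" "g permutes {1..n}"
  shows "bij_betw (\<lambda>(\<tau>, x). (C2_act (inv' g) (\<omega> + \<tau>), inv' g ` x)) (Y_set n r) (Y_set n r)"
proof (rule bij_betw_byWitness[where f' = "\<lambda>(\<tau>, x). (\<omega> + C2_act g \<tau>, g ` x)"])
  note g = assms(2) permutes_inv[OF assms(2)]
  show "(\<lambda>(\<tau>, x). (C2_act (inv' g) (\<omega> + \<tau>), inv' g ` x)) ` Y_set n r \<subseteq> Y_set n r"
    using assms g by (auto simp: C2_pow_act image_subsets_of_card_iff)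
  show "(\<lambda>(\<tau>, x). (\<omega> + C2_act g \<tau>, g ` x)) ` Y_set n r \<subseteq> Y_set n r"
    using assms g image_subsets_of_card_iff[OF g(2)] by (auto simp: C2_pow_act permutes_inv_inv)
qed (use assms in \<open>auto simp: image_comp permutes_inv_o add.assoc[symmetric]\<close>)

lemma wreath_perm_rep_unitary:
  assumes "a \<in> carrier (wreath n)"
  shows "inner_on (Y_set n r) (wreath_perm_rep n a u) (wreath_perm_rep n a v) = inner_on (Y_set n r) u v"
proof -
  obtain \<omega> g where a: "a = (\<omega>, g)" by (cases a)
  then have wg: "\<omega> \<in> C2_pow n" "g permutes {1..n}" using assms by auto
  let ?s = "\<lambda>(\<tau>, x). (C2_act (inv' g) (\<omega> + \<tau>), inv' g ` x)"
  have *: "wreath_perm_rep n a u y = u (?s y)" for u y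
    unfolding a by (cases y) (simp add: wreath_perm_rep_apply[OF wg])
  show ?thesis
    unfolding inner_on_def *
    by (rule sum.reindex_bij_betw[OF wreath_act_bij[OF wg], of "\<lambda>y. u y * cnj (v y)"])
qed

lemma group_rep_wreath_perm:
  assumes "cvec.subspace U"
    "\<And>a u. a \<in> carrier (wreath n) \<Longrightarrow> u \<in> U \<Longrightarrow> wreath_perm_rep n a u \<in> U"
  shows "group_rep (wreath n) U (wreath_perm_rep n)"
  unfolding wreath_perm_rep_def
proof (rule group_rep_perm_rep[OF group_wreath assms(1)])
  fix b show "wreath_act \<one>\<^bsub>wreath n\<^esub> b = b"
    by (cases b) (simp add: wreath_act_def)
next
  fix g h b assume "g \<in> carrier (wreath n)" "h \<in> carrier (wreath n)"
  then show "wreath_act (g \<otimes>\<^bsub>wreath n\<^esub> h) b = wreath_act g (wreath_act h b)"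
    by (cases g, cases h, cases b)
      (auto simp: wreath_act_def C2_act_add C2_act_compose permutes_bij add.assoc image_comp)
qed (use assms(2) in \<open>simp add: wreath_perm_rep_def\<close>)

lemma group_rep_L_space: "group_rep (wreath n) (L_space n r) (wreath_perm_rep n)"
proof (rule group_rep_wreath_perm)
  show "cvec.subspace (L_space n r)" by (simp add: L_space_def subspace_functions_on)
  fix a u assume a: "a \<in> carrier (wreath n)" and u: "u \<in> L_space n r"
  obtain \<omega> g where "a = (\<omega>, g)" by (cases a)
  then show "wreath_perm_rep n a u \<in> L_space n r"
    using a u permutes_inv[of g "{1..n}"]
    by (auto simp: L_space_def functions_on_def wreath_perm_rep_apply C2_pow_act_iff C2_pow_add_iff
        image_subsets_of_card_iff)
qed

section \<open>Characters of the base group\<close>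

lemma chi_apply:
  "\<omega> \<in> C2_pow n \<Longrightarrow> chi n \<theta> \<omega> = (if (\<Sum>z\<in>{1..n}. \<theta> z * \<omega> z) = 0 then 1 else - 1)"
  by (simp add: chi_def)

lemma cnj_chi [simp]: "cnj (chi n \<theta> \<omega>) = chi n \<theta> \<omega>"
  by (simp add: chi_def)

lemma chi_0 [simp]: "chi n \<theta> 0 = 1"
  by (simp add: chi_def)

text \<open>The pairing of \<open>C2_pow n\<close> with itself is symmetric, so the orthogonality of
  characters also serves as Fourier inversion.\<close>

lemma chi_commute: "\<omega> \<in> C2_pow n \<Longrightarrow> \<theta> \<in> C2_pow n \<Longrightarrow> chi n \<theta> \<omega> = chi n \<omega> \<theta>"
  by (simp only: chi_apply mult.commute[of "\<theta> _" "\<omega> _"])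

lemma chi_add:
  assumes "\<omega> \<in> C2_pow n" "\<tau> \<in> C2_pow n"
  shows "chi n \<theta> (\<omega> + \<tau>) = chi n \<theta> \<omega> * chi n \<theta> \<tau>"
proof -
  define a b where "a = (\<Sum>z\<in>{1..n}. \<theta> z * \<omega> z)" and "b = (\<Sum>z\<in>{1..n}. \<theta> z * \<tau> z)"
  have "(\<Sum>z\<in>{1..n}. \<theta> z * (\<omega> + \<tau>) z) = a + b"
    unfolding a_def b_def by (simp only: plus_fun_apply distrib_left sum.distrib)
  then have "chi n \<theta> (\<omega> + \<tau>) = (if a + b = 0 then 1 else - 1)"
    "chi n \<theta> \<omega> = (if a = 0 then 1 else - 1)" "chi n \<theta> \<tau> = (if b = 0 then 1 else - 1)"
    using assms by (simp_all only: chi_apply C2_pow_add a_def b_def)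
  then show ?thesis by (cases a; cases b) simp_all
qed

lemma chi_square: "\<omega> \<in> C2_pow n \<Longrightarrow> chi n \<theta> \<omega> * chi n \<theta> \<omega> = 1"
  by (simp add: chi_apply)

lemma chi_act:
  assumes "g permutes {1..n}"
  shows "chi n \<theta> (C2_act (inv' g) \<omega>) = chi n (C2_act g \<theta>) \<omega>"
proof -
  have "(\<Sum>z\<in>{1..n}. \<theta> z * \<omega> (g z)) = (\<Sum>z\<in>{1..n}. \<theta> (inv' g (g z)) * \<omega> (g z))"
    using assms by (simp add: permutes_inverses)
  also have "\<dots> = (\<Sum>z\<in>{1..n}. \<theta> (inv' g z) * \<omega> z)"
    by (rule sum.reindex_bij_betw[OF permutes_imp_bij[OF assms]])
  finally show ?thesis
    using assms C2_pow_act_iff[OF permutes_inv[OF assms]]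
    by (simp add: chi_def C2_act_apply permutes_inv_inv)
qed

lemma chi_orthogonal:
  assumes "\<theta> \<in> C2_pow n" "\<theta>' \<in> C2_pow n"
  shows "(\<Sum>\<omega>\<in>C2_pow n. chi n \<theta> \<omega> * chi n \<theta>' \<omega>) = (if \<theta> = \<theta>' then of_nat (card (C2_pow n)) else 0)"
proof (cases "\<theta> = \<theta>'")
  case True
  then show ?thesis by (simp add: chi_square)
next
  case False
  then have "\<theta> + \<theta>' \<noteq> 0" by (simp add: C2_add_eq_0)
  then obtain z where z: "(\<theta> + \<theta>') z \<noteq> 0" by (metis ext zero_fun_apply)
  have zn: "z \<in> {1..n}"
  proof (rule ccontr)
    assume "z \<notin> {1..n}"
    then show False using C2_pow_add[OF assms] z unfolding C2_pow_def by blast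
  qed
  \<comment> \<open>\<open>d\<close> is the indicator of a coordinate at which \<theta> and
    \<theta>' differ; translation by \<open>d\<close> multiplies the product of the two characters
    by -1.\<close>
  define d :: "nat \<Rightarrow> bit" where "d x = of_bool (x = z)" for x
  have d: "d \<in> C2_pow n" using zn by (auto simp: d_def C2_pow_def)
  have chi_d: "chi n \<theta> d = (if \<theta> z = 0 then 1 else -1)" for \<theta>
  proof -
    have "(\<Sum>x\<in>{1..n}. \<theta> x * d x) = (\<Sum>x\<in>{1..n}. if x = z then \<theta> z else 0)"
      by (intro sum.cong) (auto simp: d_def)
    then show ?thesis using d zn by (simp add: chi_apply)
  qed
  have "chi n \<theta> d * chi n \<theta>' d = - 1"
    using z by (cases "\<theta> z"; cases "\<theta>' z") (simp_all add: chi_d)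
  moreover have "bij_betw ((+) d) (C2_pow n) (C2_pow n)"
    by (rule bij_betw_byWitness[where f' = "(+) d"]) (use d in auto)
  ultimately have "(\<Sum>\<omega>\<in>C2_pow n. chi n \<theta> \<omega> * chi n \<theta>' \<omega>) = 0"
    by (intro sum_antisymmetric[of "(+) d"]) (simp_all add: chi_add[OF d] mult_ac)
  then show ?thesis using False by simp
qed

lemma zeros_act:
  assumes "g permutes {1..n}"
  shows "zeros n (C2_act g \<theta>) = g ` zeros n \<theta>"
proof (intro Set.set_eqI iffI)
  fix z assume "z \<in> zeros n (C2_act g \<theta>)"
  then have "inv' g z \<in> zeros n \<theta>" "g (inv' g z) = z"
    using permutes_in_image[OF permutes_inv[OF assms], of z] permutes_inverses(1)[OF assms]
    unfolding zeros_def by (simp_all only: C2_act_apply mem_Collect_eq)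
  then show "z \<in> g ` zeros n \<theta>" by (metis imageI)
next
  fix z assume "z \<in> g ` zeros n \<theta>"
  then obtain w where w: "w \<in> {1..n}" "\<theta> w = 0" "z = g w"
    unfolding zeros_def by blast
  have "z \<in> {1..n}" using w permutes_in_image[OF assms] by blast
  then show "z \<in> zeros n (C2_act g \<theta>)"
    using w permutes_inverses(2)[OF assms] by (simp add: zeros_def C2_act_apply)
qed

lemma zeros_subset: "zeros n \<theta> \<subseteq> {1..n}"
  by (auto simp: zeros_def)

lemma finite_zeros [simp]: "finite (zeros n \<theta>)"
  by (simp add: zeros_def)

lemma card_zeros_le: "card (zeros n \<theta>) \<le> n"
  using card_mono[OF _ zeros_subset, of n \<theta>] by simp

lemma card_zeros_complement: "card ({1..n} - zeros n \<theta>) = n - card (zeros n \<theta>)"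
  using card_Diff_subset[OF finite_zeros zeros_subset, of n \<theta>] by simp

section \<open>The decomposition\<close>

text \<open>The common shape of the generators of \<open>W_space\<close> and of the cones used for
  the intertwiner: one formula for the group action and one for the inner product then serve
  both.\<close>

definition layer_fun :: "nat \<Rightarrow> nat \<Rightarrow> nat \<Rightarrow> (nat \<Rightarrow> bit) \<Rightarrow> (nat set \<Rightarrow> complex)
    \<Rightarrow> (nat \<Rightarrow> bit) \<times> nat set \<Rightarrow> complex"
  where "layer_fun n r i \<theta> h = tensor_fun (chi n \<theta>) (\<lambda>A. if A \<in> subsets_of_card {1..n} r
    \<and> card (A \<inter> zeros n \<theta>) = i then h A else 0)"

definition W_gen :: "nat \<Rightarrow> nat \<Rightarrow> nat \<Rightarrow> (nat \<Rightarrow> bit) \<Rightarrow> (nat \<times> nat) set \<Rightarrow> (nat \<times> nat) set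
    \<Rightarrow> (nat \<Rightarrow> bit) \<times> nat set \<Rightarrow> complex"
  where "W_gen n r i \<theta> p q = layer_fun n r i \<theta> (\<lambda>A. alt_prod p A * alt_prod q A)"

definition W_gens :: "nat \<Rightarrow> nat \<Rightarrow> nat \<times> nat \<times> nat \<times> nat
    \<Rightarrow> ((nat \<Rightarrow> bit) \<times> nat set \<Rightarrow> complex) set"
  where "W_gens n r = (\<lambda>(k, i, l, m). {W_gen n r i \<theta> p q | \<theta> p q. \<theta> \<in> C2_pow n
    \<and> card (zeros n \<theta>) = k \<and> p \<in> matchings (zeros n \<theta>) l \<and> q \<in> matchings ({1..n} - zeros n \<theta>) m})"

lemma W_gens_I:
  assumes "\<theta> \<in> C2_pow n" "card (zeros n \<theta>) = k"
    "p \<in> matchings (zeros n \<theta>) l" "q \<in> matchings ({1..n} - zeros n \<theta>) m"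
  shows "W_gen n r i \<theta> p q \<in> W_gens n r (k, i, l, m)"
  using assms unfolding W_gens_def by blast

lemma W_gens_E:
  assumes "s \<in> W_gens n r (k, i, l, m)"
  obtains \<theta> p q where "s = W_gen n r i \<theta> p q" "\<theta> \<in> C2_pow n" "card (zeros n \<theta>) = k"
    "p \<in> matchings (zeros n \<theta>) l" "q \<in> matchings ({1..n} - zeros n \<theta>) m"
  using assms unfolding W_gens_def by blast

lemma alt_prod_inter_zeros:
  assumes "p \<in> matchings (zeros n \<theta>) l"
  shows "alt_prod p (A \<inter> zeros n \<theta>) = alt_prod p A"
  by (rule alt_prod_cong) (use assms Field_matching in \<open>force simp: matchings_def\<close>)

lemma alt_prod_diff_zeros:
  assumes "q \<in> matchings ({1..n} - zeros n \<theta>) m"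
  shows "alt_prod q (A - zeros n \<theta>) = alt_prod q A"
  by (rule alt_prod_cong) (use assms Field_matching in \<open>force simp: matchings_def\<close>)

lemma split_card:
  assumes "A \<in> subsets_of_card {1..n} r" "card (A \<inter> zeros n \<theta>) = i"
  shows "A \<inter> zeros n \<theta> \<in> subsets_of_card (zeros n \<theta>) i"
    "A - zeros n \<theta> \<in> subsets_of_card ({1..n} - zeros n \<theta>) (r - i)"
proof -
  have "finite A" using assms by (auto simp: subsets_of_card_def intro: finite_subset)
  then show "A \<inter> zeros n \<theta> \<in> subsets_of_card (zeros n \<theta>) i"
    "A - zeros n \<theta> \<in> subsets_of_card ({1..n} - zeros n \<theta>) (r - i)"
    using assms by (auto simp: subsets_of_card_def card_Diff_subset_Int)
qed

lemma W_gen_eq_split_tensor: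
  assumes "p \<in> matchings (zeros n \<theta>) l" "q \<in> matchings ({1..n} - zeros n \<theta>) m"
  shows "tensor_fun (chi n \<theta>) (split_tensor n r \<theta> i (alt_fun (zeros n \<theta>) i p)
    (alt_fun ({1..n} - zeros n \<theta>) (r - i) q)) = W_gen n r i \<theta> p q"
proof -
  have "split_tensor n r \<theta> i (alt_fun (zeros n \<theta>) i p) (alt_fun ({1..n} - zeros n \<theta>) (r - i) q)
    = (\<lambda>A. if A \<in> subsets_of_card {1..n} r \<and> card (A \<inter> zeros n \<theta>) = i
        then alt_prod p A * alt_prod q A else 0)"
    using split_card alt_prod_inter_zeros[OF assms(1)] alt_prod_diff_zeros[OF assms(2)]
    by (auto simp: split_tensor_def fun_eq_iff alt_fun_def)
  then show ?thesis by (simp add: W_gen_def layer_fun_def)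
qed

text \<open>The bounds in \<open>W_index\<close> are those under which \<open>S_component_eq\<close>
  applies to the \<open>i\<close>-subsets of \<open>zeros n \<theta>\<close> and to the
  \<open>(r - i)\<close>-subsets of its complement; bilinearity then passes from the components to
  their alternating generators.\<close>

lemma W_space_eq:
  assumes "(k, i, l, m) \<in> W_index n r"
  shows "W_space n r (k, i, l, m) = cvec.span (W_gens n r (k, i, l, m))"
proof -
  let ?\<beta> = "\<lambda>\<theta> f1 f2. tensor_fun (chi n \<theta>) (split_tensor n r \<theta> i f1 f2)"
  let ?S1 = "\<lambda>\<theta>. alt_fun (zeros n \<theta>) i ` matchings (zeros n \<theta>) l"
  let ?S2 = "\<lambda>\<theta>. alt_fun ({1..n} - zeros n \<theta>) (r - i) ` matchings ({1..n} - zeros n \<theta>) m"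
  let ?G = "{?\<beta> \<theta> f1 f2 | \<theta> f1 f2. \<theta> \<in> C2_pow n \<and> card (zeros n \<theta>) = k
      \<and> f1 \<in> S_component (zeros n \<theta>) i l \<and> f2 \<in> S_component ({1..n} - zeros n \<theta>) (r - i) m}"
  have comp: "S_component (zeros n \<theta>) i l = cvec.span (?S1 \<theta>)"
    "S_component ({1..n} - zeros n \<theta>) (r - i) m = cvec.span (?S2 \<theta>)"
    if "card (zeros n \<theta>) = k" for \<theta>
    using assms that
    by (intro S_component_eq; auto simp: W_index_def card_zeros_complement)+
  have lin: "linear_on UNIV (\<lambda>u. ?\<beta> \<theta> u v)" "linear_on UNIV (?\<beta> \<theta> u)" for \<theta> u v
    by (auto simp: linear_on_def tensor_fun_def split_tensor_def fun_eq_iff algebra_simps)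
  have "?G \<subseteq> cvec.span (W_gens n r (k, i, l, m))"
  proof
    fix f assume "f \<in> ?G"
    then obtain \<theta> f1 f2 where f: "f = ?\<beta> \<theta> f1 f2" "\<theta> \<in> C2_pow n" "card (zeros n \<theta>) = k"
      "f1 \<in> cvec.span (?S1 \<theta>)" "f2 \<in> cvec.span (?S2 \<theta>)"
      using comp by blast
    have "f \<in> {?\<beta> \<theta> u v | u v. u \<in> cvec.span (?S1 \<theta>) \<and> v \<in> cvec.span (?S2 \<theta>)}"
      using f(1,4,5) by blast
    then have "f \<in> cvec.span {?\<beta> \<theta> u v | u v. u \<in> cvec.span (?S1 \<theta>) \<and> v \<in> cvec.span (?S2 \<theta>)}"
      by (rule cvec.span_base)
    also have "\<dots> = cvec.span {?\<beta> \<theta> u v | u v. u \<in> ?S1 \<theta> \<and> v \<in> ?S2 \<theta>}"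
      by (rule span_bilinear[OF lin])
    also have "\<dots> \<subseteq> cvec.span (W_gens n r (k, i, l, m))"
    proof (rule cvec.span_mono, safe)
      fix p q assume pq: "p \<in> matchings (zeros n \<theta>) l" "q \<in> matchings ({1..n} - zeros n \<theta>) m"
      show "?\<beta> \<theta> (alt_fun (zeros n \<theta>) i p) (alt_fun ({1..n} - zeros n \<theta>) (r - i) q)
        \<in> W_gens n r (k, i, l, m)"
        unfolding W_gen_eq_split_tensor[OF pq] by (rule W_gens_I[OF f(2,3) pq])
    qed
    finally show "f \<in> cvec.span (W_gens n r (k, i, l, m))" .
  qed
  moreover have "W_gens n r (k, i, l, m) \<subseteq> ?G"
  proof
    fix s assume "s \<in> W_gens n r (k, i, l, m)"
    then obtain \<theta> p q where s: "s = W_gen n r i \<theta> p q" "\<theta> \<in> C2_pow n" "card (zeros n \<theta>) = k"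
      "p \<in> matchings (zeros n \<theta>) l" "q \<in> matchings ({1..n} - zeros n \<theta>) m"
      by (rule W_gens_E)
    have mem: "alt_fun (zeros n \<theta>) i p \<in> S_component (zeros n \<theta>) i l"
      "alt_fun ({1..n} - zeros n \<theta>) (r - i) q \<in> S_component ({1..n} - zeros n \<theta>) (r - i) m"
      unfolding comp[OF s(3)] using s(4,5) by (auto intro: cvec.span_base)
    show "s \<in> ?G"
      unfolding s(1) W_gen_eq_split_tensor[OF s(4,5), symmetric]
      using s(2,3) mem by blast
  qed
  ultimately have "cvec.span ?G = cvec.span (W_gens n r (k, i, l, m))"
    by (rule subset_antisym[OF cvec.span_minimal[OF _ cvec.subspace_span] cvec.span_mono])
  then show ?thesis by (simp add: W_space_def)
qed

lemma bij_split_subsets: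
  assumes "finite Z" "S \<subseteq> Z" "i \<le> r"
  shows "bij_betw (\<lambda>(B, D). B \<union> D) (subsets_of_card S i \<times> subsets_of_card (Z - S) (r - i))
    {A \<in> subsets_of_card Z r. card (A \<inter> S) = i}"
proof (rule bij_betw_byWitness[where f' = "\<lambda>A. (A \<inter> S, A - S)"])
  show "(\<lambda>(B, D). B \<union> D) ` (subsets_of_card S i \<times> subsets_of_card (Z - S) (r - i))
    \<subseteq> {A \<in> subsets_of_card Z r. card (A \<inter> S) = i}"
  proof safe
    fix B D assume B: "B \<in> subsets_of_card S i" and D: "D \<in> subsets_of_card (Z - S) (r - i)"
    have fin: "finite B" "finite D"
      using B D assms by (auto simp: subsets_of_card_def intro: finite_subset)
    have "B \<inter> D = {}" using B D by (auto simp: subsets_of_card_def)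
    then have "card (B \<union> D) = r"
      using B D fin assms(3) by (simp add: card_Un_disjoint subsets_of_card_def)
    then show "B \<union> D \<in> subsets_of_card Z r"
      using B D assms(2) by (auto simp: subsets_of_card_def)
    have "(B \<union> D) \<inter> S = B" using B D by (auto simp: subsets_of_card_def)
    then show "card ((B \<union> D) \<inter> S) = i" using B by (simp add: subsets_of_card_def)
  qed
  show "(\<lambda>A. (A \<inter> S, A - S)) ` {A \<in> subsets_of_card Z r. card (A \<inter> S) = i}
    \<subseteq> subsets_of_card S i \<times> subsets_of_card (Z - S) (r - i)"
  proof safe
    fix A assume A: "A \<in> subsets_of_card Z r" "i = card (A \<inter> S)"
    then have "finite A" using assms by (auto simp: subsets_of_card_def intro: finite_subset)
    then show "A \<inter> S \<in> subsets_of_card S (card (A \<inter> S))"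
      "A - S \<in> subsets_of_card (Z - S) (r - card (A \<inter> S))"
      using A by (auto simp: subsets_of_card_def card_Diff_subset_Int)
  qed
qed (auto simp: subsets_of_card_def)

lemma sum_split_subsets:
  fixes h :: "'a set \<Rightarrow> complex"
  assumes "finite Z" "S \<subseteq> Z" "i \<le> r"
  shows "(\<Sum>A\<in>subsets_of_card Z r. if card (A \<inter> S) = i then h A else 0)
    = (\<Sum>B\<in>subsets_of_card S i. \<Sum>D\<in>subsets_of_card (Z - S) (r - i). h (B \<union> D))"
proof -
  have "(\<Sum>A\<in>subsets_of_card Z r. if card (A \<inter> S) = i then h A else 0)
    = sum h {A \<in> subsets_of_card Z r. card (A \<inter> S) = i}"
    using assms(1) by (simp add: sum.inter_filter)
  also have "\<dots> = (\<Sum>(B, D)\<in>subsets_of_card S i \<times> subsets_of_card (Z - S) (r - i). h (B \<union> D))"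
    using sum.reindex_bij_betw[OF bij_split_subsets[OF assms], of h]
    by (simp add: split_beta)
  finally show ?thesis by (simp add: sum.cartesian_product)
qed

text \<open>Summing over the base group first leaves the Fourier coefficient of \<open>f\<close> at
  \<theta>, a function of the set alone.\<close>

lemma inner_on_layer_fun:
  "inner_on (Y_set n r) f (layer_fun n r i \<theta> h)
    = (\<Sum>A\<in>subsets_of_card {1..n} r. if card (A \<inter> zeros n \<theta>) = i
        then (\<Sum>\<omega>\<in>C2_pow n. f (\<omega>, A) * chi n \<theta> \<omega>) * cnj (h A) else 0)"
proof -
  have "inner_on (Y_set n r) f (layer_fun n r i \<theta> h)
    = (\<Sum>\<omega>\<in>C2_pow n. \<Sum>A\<in>subsets_of_card {1..n} r. f (\<omega>, A) * cnj (layer_fun n r i \<theta> h (\<omega>, A)))"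
    by (simp add: inner_on_def sum.cartesian_product)
  also have "\<dots> = (\<Sum>A\<in>subsets_of_card {1..n} r. \<Sum>\<omega>\<in>C2_pow n. f (\<omega>, A) * cnj (layer_fun n r i \<theta> h (\<omega>, A)))"
    by (rule sum.swap)
  also have "\<dots> = (\<Sum>A\<in>subsets_of_card {1..n} r. if card (A \<inter> zeros n \<theta>) = i
        then (\<Sum>\<omega>\<in>C2_pow n. f (\<omega>, A) * chi n \<theta> \<omega>) * cnj (h A) else 0)"
  proof (rule sum.cong[OF refl])
    fix A assume "A \<in> subsets_of_card {1..n} r"
    then have "f (\<omega>, A) * cnj (layer_fun n r i \<theta> h (\<omega>, A))
      = (if card (A \<inter> zeros n \<theta>) = i then f (\<omega>, A) * chi n \<theta> \<omega> * cnj (h A) else 0)" for \<omega>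
      by (simp add: layer_fun_def tensor_fun_def)
    then show "(\<Sum>\<omega>\<in>C2_pow n. f (\<omega>, A) * cnj (layer_fun n r i \<theta> h (\<omega>, A)))
      = (if card (A \<inter> zeros n \<theta>) = i
        then (\<Sum>\<omega>\<in>C2_pow n. f (\<omega>, A) * chi n \<theta> \<omega>) * cnj (h A) else 0)"
      by (simp add: sum_distrib_right)
  qed
  finally show ?thesis .
qed

lemma inner_on_W_gen:
  "inner_on (Y_set n r) f (W_gen n r i \<theta> p q)
    = (\<Sum>A\<in>subsets_of_card {1..n} r. if card (A \<inter> zeros n \<theta>) = i
        then (\<Sum>\<omega>\<in>C2_pow n. f (\<omega>, A) * chi n \<theta> \<omega>) * (alt_prod p A * alt_prod q A) else 0)"
  by (simp only: W_gen_def inner_on_layer_fun complex_cnj_mult cnj_alt_prod)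

lemma sum_layer_fun_chi:
  assumes "\<theta> \<in> C2_pow n" "\<theta>' \<in> C2_pow n" "A \<in> subsets_of_card {1..n} r"
  shows "(\<Sum>\<omega>\<in>C2_pow n. layer_fun n r i \<theta> h (\<omega>, A) * chi n \<theta>' \<omega>)
    = (if \<theta> = \<theta>' \<and> card (A \<inter> zeros n \<theta>) = i then of_nat (card (C2_pow n)) * h A else 0)"
proof -
  have "layer_fun n r i \<theta> h (\<omega>, A) * chi n \<theta>' \<omega>
    = chi n \<theta> \<omega> * chi n \<theta>' \<omega> * (if card (A \<inter> zeros n \<theta>) = i then h A else 0)" for \<omega>
    using assms(3) by (simp add: layer_fun_def tensor_fun_def)
  then have "(\<Sum>\<omega>\<in>C2_pow n. layer_fun n r i \<theta> h (\<omega>, A) * chi n \<theta>' \<omega>)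
    = (\<Sum>\<omega>\<in>C2_pow n. chi n \<theta> \<omega> * chi n \<theta>' \<omega>) * (if card (A \<inter> zeros n \<theta>) = i then h A else 0)"
    by (simp only: sum_distrib_right)
  then show ?thesis by (simp add: chi_orthogonal[OF assms(1,2)])
qed

text \<open>Different \<theta> are separated by their characters, and equal \<theta> with different
  \<open>i\<close> by disjoint supports. With both equal, the sum factors over
  \<open>zeros n \<theta>\<close> and its complement, and one factor vanishes since \<open>l\<close>
  or \<open>m\<close> differs.\<close>

lemma W_gens_orthogonal:
  assumes "x \<in> W_index n r" "y \<in> W_index n r" "x \<noteq> y" "s \<in> W_gens n r x" "t \<in> W_gens n r y"
  shows "inner_on (Y_set n r) s t = 0"
proof -
  obtain k i l m where x: "x = (k, i, l, m)" by (cases x)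
  obtain k' i' l' m' where y: "y = (k', i', l', m')" by (cases y)
  obtain \<theta> p q where s: "s = W_gen n r i \<theta> p q" "\<theta> \<in> C2_pow n" "card (zeros n \<theta>) = k"
      "p \<in> matchings (zeros n \<theta>) l" "q \<in> matchings ({1..n} - zeros n \<theta>) m"
    using assms(4) W_gens_E unfolding x by metis
  obtain \<theta>' p' q' where t: "t = W_gen n r i' \<theta>' p' q'" "\<theta>' \<in> C2_pow n" "card (zeros n \<theta>') = k'"
      "p' \<in> matchings (zeros n \<theta>') l'" "q' \<in> matchings ({1..n} - zeros n \<theta>') m'"
    using assms(5) W_gens_E unfolding y by metis
  have "i \<le> r" using assms(1) by (simp add: x W_index_def)
  let ?e = "\<lambda>A. (alt_prod p A * alt_prod q A) * (alt_prod p' A * alt_prod q' A)"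
  let ?c = "of_nat (card (C2_pow n)) :: complex"
  have *: "inner_on (Y_set n r) s t = (\<Sum>A\<in>subsets_of_card {1..n} r.
      if card (A \<inter> zeros n \<theta>') = i' then
        (if \<theta> = \<theta>' \<and> card (A \<inter> zeros n \<theta>) = i then ?c * ?e A else 0) else 0)"
    unfolding t(1) s(1) inner_on_W_gen unfolding W_gen_def
  proof (rule sum.cong[OF refl], goal_cases)
    case (1 A)
    show ?case
      unfolding sum_layer_fun_chi[OF s(2) t(2) 1]
      by (cases "\<theta> = \<theta>' \<and> card (A \<inter> zeros n \<theta>) = i") auto
  qed
  show ?thesis
  proof (cases "\<theta> = \<theta>' \<and> i = i'")
    case False
    then show ?thesis
      unfolding * by (intro sum.neutral ballI, cases "\<theta> = \<theta>'") auto
  next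
    case True
    then have lm: "l \<noteq> l' \<or> m \<noteq> m'" using assms(3) s(3) t(3) x y by auto
    let ?Z = "zeros n \<theta>"
    have "inner_on (Y_set n r) s t = (\<Sum>A\<in>subsets_of_card {1..n} r.
      if card (A \<inter> ?Z) = i then ?c * ?e A else 0)"
      unfolding * conjunct1[OF True, symmetric] conjunct2[OF True, symmetric]
      by (intro sum.cong refl) simp
    also have "\<dots> = (\<Sum>B\<in>subsets_of_card ?Z i. \<Sum>D\<in>subsets_of_card ({1..n} - ?Z) (r - i).
        ?c * ?e (B \<union> D))"
      by (rule sum_split_subsets[OF _ zeros_subset \<open>i \<le> r\<close>]) simp
    also have "\<dots> = (\<Sum>B\<in>subsets_of_card ?Z i. \<Sum>D\<in>subsets_of_card ({1..n} - ?Z) (r - i).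
        ?c * ((alt_prod p B * alt_prod p' B) * (alt_prod q D * alt_prod q' D)))"
    proof (intro sum.cong refl)
      fix B D assume BD: "B \<in> subsets_of_card ?Z i" "D \<in> subsets_of_card ({1..n} - ?Z) (r - i)"
      then have "(B \<union> D) \<inter> ?Z = B" "(B \<union> D) - ?Z = D" by (auto simp: subsets_of_card_def)
      then have "alt_prod p (B \<union> D) = alt_prod p B" "alt_prod p' (B \<union> D) = alt_prod p' B"
        "alt_prod q (B \<union> D) = alt_prod q D" "alt_prod q' (B \<union> D) = alt_prod q' D"
        using alt_prod_inter_zeros[OF s(4), of "B \<union> D"] alt_prod_inter_zeros[OF t(4), of "B \<union> D"]
          alt_prod_diff_zeros[OF s(5), of "B \<union> D"] alt_prod_diff_zeros[OF t(5), of "B \<union> D"] True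
        by auto
      then show "?c * ?e (B \<union> D)
        = ?c * ((alt_prod p B * alt_prod p' B) * (alt_prod q D * alt_prod q' D))"
        by simp
    qed
    also have "\<dots> = ?c * ((\<Sum>B\<in>subsets_of_card ?Z i. alt_prod p B * alt_prod p' B) *
        (\<Sum>D\<in>subsets_of_card ({1..n} - ?Z) (r - i). alt_prod q D * alt_prod q' D))"
      by (subst sum_product) (simp only: sum_distrib_left)
    also have "\<dots> = 0"
      using lm alt_prod_orthogonal[of ?Z p p' i] alt_prod_orthogonal[of "{1..n} - ?Z" q q' "r - i"]
        s(4,5) t(4,5) True by (auto simp: matchings_def)
    finally show ?thesis .
  qed
qed

text \<open>The Fourier coefficient of \<open>f\<close> at \<theta>, on the sets meeting
  \<open>zeros n \<theta>\<close> in \<open>i\<close> points, is a function of two independent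
  subsets. Completeness of the alternating products is applied in one variable and then in the
  other; Fourier inversion recovers \<open>f\<close>.\<close>

lemma W_gens_complete:
  assumes f: "f \<in> L_space n r"
    and orth: "\<And>x s. x \<in> W_index n r \<Longrightarrow> s \<in> W_gens n r x \<Longrightarrow> inner_on (Y_set n r) f s = 0"
  shows "f = 0"
proof -
  let ?X = "subsets_of_card {1..n} r"
  have F0: "(\<Sum>\<omega>\<in>C2_pow n. f (\<omega>, A) * chi n \<theta> \<omega>) = 0" if \<theta>: "\<theta> \<in> C2_pow n" and A: "A \<in> ?X" for \<theta> A
  proof -
    let ?Z = "zeros n \<theta>"
    let ?Z' = "{1..n} - ?Z"
    define F where "F A = (\<Sum>\<omega>\<in>C2_pow n. f (\<omega>, A) * chi n \<theta> \<omega>)" for A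
    define k where "k = card ?Z"
    \<comment> \<open>The layer is the one containing the given set \<open>A\<close>; the two parts
      of \<open>A\<close> witness the size bounds required by \<open>W_index\<close>.\<close>
    define i where "i = card (A \<inter> ?Z)"
    have k: "k \<le> n" by (simp add: k_def card_zeros_le)
    have ik: "i \<le> k" unfolding i_def k_def by (intro card_mono) auto
    have parts: "A \<inter> ?Z \<in> subsets_of_card ?Z i" "A - ?Z \<in> subsets_of_card ?Z' (r - i)"
      using split_card[OF A] i_def by auto
    have "finite A" using A by (auto simp: subsets_of_card_def intro: finite_subset)
    then have ir: "i \<le> r"
      using A card_mono[of A "A \<inter> ?Z"] by (auto simp: i_def subsets_of_card_def)
    have Z': "card ?Z' = n - k" by (simp add: card_zeros_complement k_def)
    have rin: "r - i \<le> n - k"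
      using parts(2) card_mono[of ?Z' "A - ?Z"] Z' by (simp add: subsets_of_card_def)
    let ?Xi = "subsets_of_card ?Z i" and ?Xr = "subsets_of_card ?Z' (r - i)"
    have pq: "(\<Sum>B\<in>?Xi. (\<Sum>D\<in>?Xr. F (B \<union> D) * alt_prod q D) * alt_prod p B) = 0"
      if p: "matching ?Z p" "card p \<le> min i (k - i)"
        and q: "matching ?Z' q" "card q \<le> min (r - i) (n - k - (r - i))" for p q
    proof -
      have ind: "(k, i, card p, card q) \<in> W_index n r"
        using p q k ik ir rin by (auto simp: W_index_def)
      have pm: "p \<in> matchings ?Z (card p)" and qm: "q \<in> matchings ?Z' (card q)"
        using p q by (auto simp: matchings_def)
      have "0 = inner_on (Y_set n r) f (W_gen n r i \<theta> p q)"
        using orth[OF ind W_gens_I[OF \<theta> k_def[symmetric] pm qm]] by simp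
      also have "\<dots> = (\<Sum>A\<in>?X. if card (A \<inter> ?Z) = i then F A * (alt_prod p A * alt_prod q A) else 0)"
        by (simp only: inner_on_W_gen F_def)
      also have "\<dots> = (\<Sum>B\<in>?Xi. \<Sum>D\<in>?Xr. F (B \<union> D) * (alt_prod p (B \<union> D) * alt_prod q (B \<union> D)))"
        by (rule sum_split_subsets[OF _ zeros_subset ir]) simp
      also have "\<dots> = (\<Sum>B\<in>?Xi. \<Sum>D\<in>?Xr. F (B \<union> D) * alt_prod q D * alt_prod p B)"
      proof (intro sum.cong refl)
        fix B D assume BD: "B \<in> ?Xi" "D \<in> ?Xr"
        then have "(B \<union> D) \<inter> ?Z = B" "(B \<union> D) - ?Z = D" by (auto simp: subsets_of_card_def)
        then show "F (B \<union> D) * (alt_prod p (B \<union> D) * alt_prod q (B \<union> D))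
          = F (B \<union> D) * alt_prod q D * alt_prod p B"
          using alt_prod_inter_zeros[OF pm, of "B \<union> D"] alt_prod_diff_zeros[OF qm, of "B \<union> D"]
          by simp
      qed
      finally show ?thesis by (simp only: sum_distrib_right)
    qed
    have u: "(\<Sum>D\<in>?Xr. F (B \<union> D) * alt_prod q D) = 0"
      if q: "matching ?Z' q" "card q \<le> min (r - i) (n - k - (r - i))" and B: "B \<in> ?Xi" for q B
    proof -
      define u where "u B = (if B \<in> ?Xi then \<Sum>D\<in>?Xr. F (B \<union> D) * alt_prod q D else 0)" for B
      have "u = 0"
      proof (rule alt_fun_complete[of ?Z i])
        show "finite ?Z" "i \<le> card ?Z" using ik by (auto simp: k_def)
        show "u \<in> M_space ?Z i" by (simp add: u_def M_space_def functions_on_def)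
        fix p assume "matching ?Z p" "card p \<le> min i (card ?Z - i)"
        then show "(\<Sum>B\<in>?Xi. u B * alt_prod p B) = 0"
          using pq[OF _ _ q] by (simp add: u_def k_def)
      qed
      then have "u B = 0" by simp
      then show ?thesis using B by (simp add: u_def)
    qed
    define v where "v D = (if D \<in> ?Xr then F ((A \<inter> ?Z) \<union> D) else 0)" for D
    have "v = 0"
    proof (rule alt_fun_complete[of ?Z' "r - i"])
      show "finite ?Z'" "r - i \<le> card ?Z'" using rin Z' by auto
      show "v \<in> M_space ?Z' (r - i)" by (simp add: v_def M_space_def functions_on_def)
      fix q assume "matching ?Z' q" "card q \<le> min (r - i) (card ?Z' - (r - i))"
      then show "(\<Sum>D\<in>?Xr. v D * alt_prod q D) = 0"
        using u[OF _ _ parts(1)] Z' by (simp add: v_def)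
    qed
    then have "v (A - ?Z) = 0" by simp
    then have "F ((A \<inter> ?Z) \<union> (A - ?Z)) = 0" using parts(2) by (simp add: v_def)
    then show ?thesis by (simp add: F_def Int_Diff_Un)
  qed
  have "f (\<omega>, A) = 0" for \<omega> A
  proof (cases "\<omega> \<in> C2_pow n \<and> A \<in> ?X")
    case True
    \<comment> \<open>Fourier inversion: exchanging the roles of index and argument in the
      characters makes the sum over \<theta> isolate the value at \<omega>.\<close>
    have "0 = (\<Sum>\<theta>\<in>C2_pow n. chi n \<theta> \<omega> * (\<Sum>\<tau>\<in>C2_pow n. f (\<tau>, A) * chi n \<theta> \<tau>))"
      using F0 True by simp
    also have "\<dots> = (\<Sum>\<tau>\<in>C2_pow n. f (\<tau>, A) * (\<Sum>\<theta>\<in>C2_pow n. chi n \<theta> \<omega> * chi n \<theta> \<tau>))"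
      unfolding sum_distrib_left by (subst sum.swap) (simp only: mult_ac)
    also have "\<dots> = (\<Sum>\<tau>\<in>C2_pow n. f (\<tau>, A) * (\<Sum>\<theta>\<in>C2_pow n. chi n \<omega> \<theta> * chi n \<tau> \<theta>))"
      using True by (intro sum.cong refl arg_cong2[where f = "(*)"]) (auto simp: chi_commute)
    also have "\<dots> = (\<Sum>\<tau>\<in>C2_pow n. if \<tau> = \<omega> then f (\<omega>, A) * of_nat (card (C2_pow n)) else 0)"
      using True by (intro sum.cong refl) (auto simp: chi_orthogonal)
    also have "\<dots> = f (\<omega>, A) * of_nat (card (C2_pow n))"
      using True by simp
    finally show ?thesis using card_C2_pow_nonzero by simp
  qed (use f in \<open>auto simp: L_space_def functions_on_def\<close>)
  then show ?thesis by (auto simp: fun_eq_iff)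
qed

lemma finite_W_index: "finite (W_index n r)"
proof (rule finite_subset)
  show "W_index n r \<subseteq> {0..n} \<times> {0..r} \<times> {0..r} \<times> {0..r}"
    by (auto simp: W_index_def)
qed simp

lemma W_gens_subset: "W_gens n r x \<subseteq> L_space n r"
  by (cases x) (auto simp: W_gens_def W_gen_def layer_fun_def L_space_def functions_on_def tensor_fun_def chi_def)

lemma is_direct_sum_W: "is_direct_sum (L_space n r) (W_index n r) (W_space n r)"
proof -
  have "is_direct_sum (L_space n r) (W_index n r) (\<lambda>x. cvec.span (W_gens n r x))"
    unfolding L_space_def
  proof (rule is_direct_sum_orthogonal)
    show "finite (Y_set n r)" by simp
    show "W_gens n r x \<subseteq> functions_on (Y_set n r)" for x
      using W_gens_subset by (simp add: L_space_def)
    show "f = 0" if "f \<in> functions_on (Y_set n r)"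
      "\<And>x s. x \<in> W_index n r \<Longrightarrow> s \<in> W_gens n r x \<Longrightarrow> inner_on (Y_set n r) f s = 0" for f
      by (rule W_gens_complete[OF _ that(2)]) (use that(1) in \<open>simp_all add: L_space_def\<close>)
  qed (use finite_W_index W_gens_orthogonal in auto)
  then show ?thesis
    using is_direct_sum_cong[of "W_index n r" "W_space n r" "\<lambda>x. cvec.span (W_gens n r x)"] W_space_eq
    by (metis prod_cases4)
qed

section \<open>The wreath product acting on the generators\<close>

lemma wreath_perm_rep_layer_fun:
  assumes "\<omega> \<in> C2_pow n" "g permutes {1..n}"
  shows "wreath_perm_rep n (\<omega>, g) (layer_fun n r i \<theta> h)
    = chi n (C2_act g \<theta>) \<omega> *\<^sub>C layer_fun n r i (C2_act g \<theta>) (\<lambda>A. h (inv' g ` A))"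
proof
  fix y :: "(nat \<Rightarrow> bit) \<times> nat set"
  obtain \<tau> A where y: "y = (\<tau>, A)" by (cases y)
  note inj = permutes_inj[OF permutes_inv[OF assms(2)]]
  have "inv' g ` A \<inter> zeros n \<theta> = inv' g ` (A \<inter> g ` zeros n \<theta>)"
    using assms(2) by (simp add: image_Int[OF inj] image_comp permutes_inv_o)
  then have "card (inv' g ` A \<inter> zeros n \<theta>) = card (A \<inter> zeros n (C2_act g \<theta>))"
    using card_image[OF inj_on_subset[OF inj]] by (simp add: zeros_act[OF assms(2)])
  moreover have "chi n (C2_act g \<theta>) (\<omega> + \<tau>) = chi n (C2_act g \<theta>) \<omega> * chi n (C2_act g \<theta>) \<tau>"
  \<comment> \<open>\<open>chi\<close> is zero outside \<open>C2_pow n\<close>, so multiplicativity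
    persists there with both sides zero.\<close>
  proof (cases "\<tau> \<in> C2_pow n")
    case False
    then show ?thesis using C2_pow_add_iff[OF assms(1)] by (simp add: chi_def)
  qed (simp add: chi_add assms(1))
  ultimately show "wreath_perm_rep n (\<omega>, g) (layer_fun n r i \<theta> h) y
    = (chi n (C2_act g \<theta>) \<omega> *\<^sub>C layer_fun n r i (C2_act g \<theta>) (\<lambda>A. h (inv' g ` A))) y"
    by (simp add: y wreath_perm_rep_apply[OF assms] layer_fun_def tensor_fun_def
        chi_act[OF assms(2)] image_subsets_of_card_iff[OF assms(2)])
qed

lemma wreath_perm_rep_W_gen:
  assumes "\<omega> \<in> C2_pow n" "g permutes {1..n}"
  shows "wreath_perm_rep n (\<omega>, g) (W_gen n r i \<theta> p q)
    = chi n (C2_act g \<theta>) \<omega> *\<^sub>C W_gen n r i (C2_act g \<theta>) (map_prod g g ` p) (map_prod g g ` q)"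
  unfolding W_gen_def wreath_perm_rep_layer_fun[OF assms] alt_prod_inv[OF assms(2)] ..

lemma W_gens_image:
  assumes "g permutes {1..n}" "\<theta> \<in> C2_pow n" "card (zeros n \<theta>) = k"
    "p \<in> matchings (zeros n \<theta>) l" "q \<in> matchings ({1..n} - zeros n \<theta>) m"
  shows "C2_act g \<theta> \<in> C2_pow n" "card (zeros n (C2_act g \<theta>)) = k"
    "map_prod g g ` p \<in> matchings (zeros n (C2_act g \<theta>)) l"
    "map_prod g g ` q \<in> matchings ({1..n} - zeros n (C2_act g \<theta>)) m"
proof -
  note inj = permutes_inj[OF assms(1)]
  show "C2_act g \<theta> \<in> C2_pow n" using C2_pow_act assms by blast
  show "card (zeros n (C2_act g \<theta>)) = k"
    using assms(3) by (simp add: zeros_act[OF assms(1)] card_image inj_on_subset[OF inj])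
  have "g ` ({1..n} - zeros n \<theta>) = {1..n} - g ` zeros n \<theta>"
    using image_set_diff[OF inj] permutes_image[OF assms(1)] by metis
  then show "map_prod g g ` p \<in> matchings (zeros n (C2_act g \<theta>)) l"
    "map_prod g g ` q \<in> matchings ({1..n} - zeros n (C2_act g \<theta>)) m"
    using assms(4,5) matching_image[OF _ inj, of "zeros n \<theta>" p]
      matching_image[OF _ inj, of "{1..n} - zeros n \<theta>" q]
    by (auto simp: matchings_def card_map_prod_image[OF inj] zeros_act[OF assms(1)])
qed

lemma group_rep_W:
  assumes "x \<in> W_index n r"
  shows "group_rep (wreath n) (W_space n r x) (wreath_perm_rep n)"
proof -
  obtain k i l m where x: "x = (k, i, l, m)" by (cases x)
  have W: "W_space n r x = cvec.span (W_gens n r x)"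
    using W_space_eq assms unfolding x by blast
  show ?thesis
    unfolding W
  proof (rule group_rep_wreath_perm[OF cvec.subspace_span])
    fix a u assume a: "a \<in> carrier (wreath n)" and u: "u \<in> cvec.span (W_gens n r x)"
    obtain \<omega> g where ag: "a = (\<omega>, g)" by (cases a)
    show "wreath_perm_rep n a u \<in> cvec.span (W_gens n r x)"
      unfolding wreath_perm_rep_def
    proof (rule perm_rep_span_closed[OF _ u])
      fix s assume "s \<in> W_gens n r x"
      then obtain \<theta> p q where s: "s = W_gen n r i \<theta> p q" "\<theta> \<in> C2_pow n" "card (zeros n \<theta>) = k"
        "p \<in> matchings (zeros n \<theta>) l" "q \<in> matchings ({1..n} - zeros n \<theta>) m"
        unfolding x by (rule W_gens_E)
      have wg: "\<omega> \<in> C2_pow n" "g permutes {1..n}" using a ag by auto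
      have "wreath_perm_rep n a s \<in> cvec.span (W_gens n r x)"
        unfolding s(1) ag wreath_perm_rep_W_gen[OF wg] x
        by (intro cvec.span_scale cvec.span_base W_gens_I W_gens_image[OF wg(2) s(2-5)])
      then show "perm_rep (wreath n) wreath_act a s \<in> cvec.span (W_gens n r x)"
        by (simp add: wreath_perm_rep_def)
    qed
  qed
qed


section \<open>Induced representations\<close>

lemma ind_rep_apply: "g \<in> carrier G \<Longrightarrow> ind_rep G a F g = F (inv\<^bsub>G\<^esub> a \<otimes>\<^bsub>G\<^esub> g)"
  by (simp add: ind_rep_def)

lemma group_rep_ind_rep:
  assumes "group G" "cvec.subspace U" "\<And>F g. F \<in> U \<Longrightarrow> g \<notin> carrier G \<Longrightarrow> F g = 0"
    and "\<And>a F. a \<in> carrier G \<Longrightarrow> F \<in> U \<Longrightarrow> ind_rep G a F \<in> U"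
  shows "group_rep G U (ind_rep G)"
proof -
  interpret group G by fact
  show ?thesis
    using assms(2-4)
    by unfold_locales (auto simp: ind_rep_def linear_on_def fun_eq_iff inv_mult_group m_assoc)
qed

lemma subspace_ind_space:
  assumes "cvec.subspace V" "\<And>h. h \<in> H \<Longrightarrow> linear_on V (\<sigma> (inv\<^bsub>G\<^esub> h))"
  shows "cvec.subspace (ind_space G H V \<sigma>)"
  using assms linear_on_zero[OF assms(2) assms(1)]
  unfolding cvec.subspace_def ind_space_def by (auto simp: linear_on_def)

lemma ind_rep_ind_space:
  assumes "group G" "H \<subseteq> carrier G" "a \<in> carrier G" "F \<in> ind_space G H V \<sigma>"
  shows "ind_rep G a F \<in> ind_space G H V \<sigma>"
proof -
  interpret group G by fact
  have "ind_rep G a F (g \<otimes>\<^bsub>G\<^esub> h) = \<sigma> (inv\<^bsub>G\<^esub> h) (ind_rep G a F g)"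
    if "g \<in> carrier G" "h \<in> H" for g h
  proof -
    have h: "h \<in> carrier G" using that assms(2) by blast
    then have "ind_rep G a F (g \<otimes>\<^bsub>G\<^esub> h) = F ((inv\<^bsub>G\<^esub> a \<otimes>\<^bsub>G\<^esub> g) \<otimes>\<^bsub>G\<^esub> h)"
      using that assms(3) by (simp add: ind_rep_apply m_assoc)
    also have "\<dots> = \<sigma> (inv\<^bsub>G\<^esub> h) (F (inv\<^bsub>G\<^esub> a \<otimes>\<^bsub>G\<^esub> g))"
      using assms(3,4) that by (simp add: ind_space_def)
    finally show ?thesis using that by (simp add: ind_rep_apply)
  qed
  then show ?thesis
    using assms(3,4) by (simp add: ind_space_def) (simp add: ind_rep_def)
qed

text \<open>Evaluation at the identity commutes with the action of \<open>H\<close>, so symmetries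
  of a function in the induced space pass to its value in \<open>V\<close>.\<close>

lemma ind_rep_at_one:
  assumes "group G" "h \<in> H" "H \<subseteq> carrier G" "inv\<^bsub>G\<^esub> h \<in> H" "F \<in> ind_space G H V \<sigma>"
  shows "ind_rep G h F \<one>\<^bsub>G\<^esub> = \<sigma> h (F \<one>\<^bsub>G\<^esub>)"
proof -
  interpret group G by fact
  have h: "h \<in> carrier G" using assms by blast
  then have "ind_rep G h F \<one>\<^bsub>G\<^esub> = F (\<one>\<^bsub>G\<^esub> \<otimes>\<^bsub>G\<^esub> inv\<^bsub>G\<^esub> h)"
    by (simp add: ind_rep_apply)
  also have "\<dots> = \<sigma> (inv\<^bsub>G\<^esub> (inv\<^bsub>G\<^esub> h)) (F \<one>\<^bsub>G\<^esub>)"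
    using assms(4,5) by (simp add: ind_space_def del: l_one r_one inv_inv)
  finally show ?thesis using h by simp
qed

text \<open>Every \<open>F\<close> in the induced space is the average over \<open>g \<in> G\<close> of the translates by \<open>g\<close> of
  functions that are supported on \<open>H\<close> and take the value \<open>F g\<close> at the identity.\<close>

lemma ind_space_generated:
  assumes "group G" "finite (carrier G)" "H \<subseteq> carrier G" "H \<noteq> {}"
    and U: "U \<subseteq> ind_space G H V \<sigma>" "group_rep G U (ind_rep G)"
    and gen: "\<And>v. v \<in> V \<Longrightarrow> \<exists>E\<in>U. (\<forall>g\<in>carrier G. g \<notin> H \<longrightarrow> E g = 0) \<and> E \<one>\<^bsub>G\<^esub> = v"
  shows "U = ind_space G H V \<sigma>"
proof
  interpret group G by fact
  interpret U: group_rep G U "ind_rep G" by fact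
  show "ind_space G H V \<sigma> \<subseteq> U"
  proof
    fix F assume F: "F \<in> ind_space G H V \<sigma>"
    obtain E where E: "\<And>v. v \<in> V \<Longrightarrow> E v \<in> U" "\<And>v. v \<in> V \<Longrightarrow> E v \<one>\<^bsub>G\<^esub> = v"
      "\<And>v g. v \<in> V \<Longrightarrow> g \<in> carrier G \<Longrightarrow> g \<notin> H \<Longrightarrow> E v g = 0"
      using gen by metis
    have FV: "F g \<in> V" if "g \<in> carrier G" for g
      using F that by (simp add: ind_space_def)
    define S where "S = (\<Sum>g\<in>carrier G. ind_rep G g (E (F g)))"
    have "S \<in> U"
      unfolding S_def by (intro cvec.subspace_sum[OF U.subspace] U.closed E(1) FV)
    have "finite H" using assms(2,3) finite_subset by blast
    then have cardH: "of_nat (card H) \<noteq> (0 :: complex)" using assms(4) by simp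
    have "S x = of_nat (card H) *\<^sub>C F x" for x
    proof (cases "x \<in> carrier G")
      case x: True
      have "ind_rep G g (E (F g)) x = (if inv\<^bsub>G\<^esub> g \<otimes>\<^bsub>G\<^esub> x \<in> H then F x else 0)"
        if g: "g \<in> carrier G" for g
      proof (cases "inv\<^bsub>G\<^esub> g \<otimes>\<^bsub>G\<^esub> x \<in> H")
        case h: True
        let ?h = "inv\<^bsub>G\<^esub> g \<otimes>\<^bsub>G\<^esub> x"
        have hc: "?h \<in> carrier G" using g x by simp
        have "E (F g) (\<one>\<^bsub>G\<^esub> \<otimes>\<^bsub>G\<^esub> ?h) = \<sigma> (inv\<^bsub>G\<^esub> ?h) (E (F g) \<one>\<^bsub>G\<^esub>)"
          using E(1)[OF FV[OF g]] U(1) h unfolding ind_space_def by blast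
        moreover have "F (g \<otimes>\<^bsub>G\<^esub> ?h) = \<sigma> (inv\<^bsub>G\<^esub> ?h) (F g)"
          using F g h unfolding ind_space_def by blast
        moreover have "g \<otimes>\<^bsub>G\<^esub> ?h = x" using g x by (simp add: m_assoc[symmetric])
        ultimately show ?thesis
          using h hc x E(2)[OF FV[OF g]] by (simp add: ind_rep_apply)
      next
        case False
        then show ?thesis using g x E(3)[OF FV[OF g]] by (simp add: ind_rep_apply)
      qed
      then have "S x = (\<Sum>g\<in>carrier G. if inv\<^bsub>G\<^esub> g \<otimes>\<^bsub>G\<^esub> x \<in> H then F x else 0)"
        unfolding S_def sum_fun_apply by (intro sum.cong refl)
      also have "\<dots> = (\<Sum>g\<in>{g \<in> carrier G. inv\<^bsub>G\<^esub> g \<otimes>\<^bsub>G\<^esub> x \<in> H}. F x)"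
        using assms(2) by (simp add: sum.inter_filter)
      \<comment> \<open>These are the products of \<open>x\<close> with the inverses of the elements
        of \<open>H\<close>, one for each element, so the sum contains \<open>F x\<close> exactly
        \<open>card H\<close> times.\<close>
      also have "{g \<in> carrier G. inv\<^bsub>G\<^esub> g \<otimes>\<^bsub>G\<^esub> x \<in> H} = (\<lambda>h. x \<otimes>\<^bsub>G\<^esub> inv\<^bsub>G\<^esub> h) ` H"
      proof (intro Set.set_eqI iffI)
        fix g assume "g \<in> {g \<in> carrier G. inv\<^bsub>G\<^esub> g \<otimes>\<^bsub>G\<^esub> x \<in> H}"
        then have g: "g \<in> carrier G" "inv\<^bsub>G\<^esub> g \<otimes>\<^bsub>G\<^esub> x \<in> H" by auto
        have "g = x \<otimes>\<^bsub>G\<^esub> inv\<^bsub>G\<^esub> (inv\<^bsub>G\<^esub> g \<otimes>\<^bsub>G\<^esub> x)"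
          using g x by (simp add: inv_mult_group m_assoc[symmetric])
        then show "g \<in> (\<lambda>h. x \<otimes>\<^bsub>G\<^esub> inv\<^bsub>G\<^esub> h) ` H" using g(2) by blast
      next
        fix g assume "g \<in> (\<lambda>h. x \<otimes>\<^bsub>G\<^esub> inv\<^bsub>G\<^esub> h) ` H"
        then obtain h where h: "h \<in> H" "g = x \<otimes>\<^bsub>G\<^esub> inv\<^bsub>G\<^esub> h" by blast
        then have "h \<in> carrier G" using assms(3) by blast
        then show "g \<in> {g \<in> carrier G. inv\<^bsub>G\<^esub> g \<otimes>\<^bsub>G\<^esub> x \<in> H}"
          using h x by (simp add: inv_mult_group m_assoc)
      qed
      also have "(\<Sum>g\<in>(\<lambda>h. x \<otimes>\<^bsub>G\<^esub> inv\<^bsub>G\<^esub> h) ` H. F x)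
        = of_nat (card ((\<lambda>h. x \<otimes>\<^bsub>G\<^esub> inv\<^bsub>G\<^esub> h) ` H)) *\<^sub>C F x"
        by (rule sum_constant_scaleC)
      also have "card ((\<lambda>h. x \<otimes>\<^bsub>G\<^esub> inv\<^bsub>G\<^esub> h) ` H) = card H"
      proof (rule card_image, rule inj_onI)
        fix h h' assume hh: "h \<in> H" "h' \<in> H" "x \<otimes>\<^bsub>G\<^esub> inv\<^bsub>G\<^esub> h = x \<otimes>\<^bsub>G\<^esub> inv\<^bsub>G\<^esub> h'"
        then have "h \<in> carrier G" "h' \<in> carrier G" using assms(3) by auto
        then show "h = h'" using hh(3) x by simp (metis inv_inv)
      qed
      finally show ?thesis .
    next
      case False
      then show ?thesis
        using F by (simp add: S_def sum_fun_apply ind_rep_def ind_space_def)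
    qed
    then have "F = inverse (of_nat (card H)) *\<^sub>C S"
      using cardH by (simp add: fun_eq_iff scaleC_scaleC scaleC_one)
    then show "F \<in> U" using \<open>S \<in> U\<close> U.subspace by (simp add: cvec.subspace_scale)
  qed
qed fact

text \<open>Each step replaces \<open>v\<close> by \<open>v - s x v\<close>. Since \<phi> changes
  sign under \<open>s x\<close>, its value doubles instead of cancelling; since the involutions
  commute, the antisymmetry already achieved is kept.\<close>

lemma antisymmetrize:
  assumes "finite S" "cvec.subspace U" "\<And>x. x \<in> S \<Longrightarrow> linear_on U (s x)"
    and closed: "\<And>x u. x \<in> S \<Longrightarrow> u \<in> U \<Longrightarrow> s x u \<in> U"
    and invol: "\<And>x u. x \<in> S \<Longrightarrow> u \<in> U \<Longrightarrow> s x (s x u) = u"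
    and comm: "\<And>x y u. x \<in> S \<Longrightarrow> y \<in> S \<Longrightarrow> u \<in> U \<Longrightarrow> s x (s y u) = s y (s x u)"
    and \<phi>: "linear_on U \<phi>" "\<And>x u. x \<in> S \<Longrightarrow> u \<in> U \<Longrightarrow> \<phi> (s x u) = - (\<phi> u :: complex)"
    and "u \<in> U" "\<phi> u \<noteq> 0"
  shows "\<exists>u'\<in>U. \<phi> u' \<noteq> 0 \<and> (\<forall>x\<in>S. s x u' = - u')"
proof -
  have "\<exists>u'\<in>U. \<phi> u' \<noteq> 0 \<and> (\<forall>x\<in>R. s x u' = - u')" if "finite R" "R \<subseteq> S" for R
    using that
  proof (induction R rule: finite_induct)
    case empty
    then show ?case using assms(9,10) by blast
  next
    case (insert x R)
    then obtain v where v: "v \<in> U" "\<phi> v \<noteq> 0" "\<And>y. y \<in> R \<Longrightarrow> s y v = - v" by blast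
    have x: "x \<in> S" using insert.prems by blast
    note sv = closed[OF x v(1)]
    define w where "w = v - s x v"
    have w: "w \<in> U" unfolding w_def by (rule cvec.subspace_diff[OF assms(2) v(1) sv])
    have "\<phi> w = 2 * \<phi> v"
      unfolding w_def linear_on_diff[OF \<phi>(1) assms(2) v(1) sv] by (simp add: \<phi>(2)[OF x v(1)])
    then have "\<phi> w \<noteq> 0" using v(2) by simp
    moreover have "s x w = - w"
      unfolding w_def linear_on_diff[OF assms(3)[OF x] assms(2) v(1) sv] by (simp add: invol[OF x v(1)])
    moreover have "s y w = - w" if y: "y \<in> R" for y
    proof -
      have yS: "y \<in> S" using y insert.prems by blast
      have "s x (0 - v) = s x 0 - s x v"
        using linear_on_diff[OF assms(3)[OF x] assms(2) cvec.subspace_0[OF assms(2)] v(1)] .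
      then have "s x (- v) = - s x v"
        using linear_on_zero[OF assms(3)[OF x] assms(2)] by simp
      then have "s y (s x v) = - s x v"
        using comm[OF yS x v(1)] v(3)[OF y] by simp
      then show ?thesis
        unfolding w_def linear_on_diff[OF assms(3)[OF yS] assms(2) v(1) sv] by (simp add: v(3)[OF y])
    qed
    ultimately show ?case using w by blast
  qed
  then show ?thesis using assms(1) by blast
qed

section \<open>Transitivity on matchings\<close>

text \<open>A permutation that matches the tails is followed by the transposition carrying the image
  of \<open>x\<close> to \<open>y\<close>; distinctness keeps the other targets in place.\<close>

lemma exists_permutation_map:
  assumes "length xs = length ys" "distinct xs" "distinct ys" "set xs \<subseteq> A" "set ys \<subseteq> A"
  shows "\<exists>g. g permutes A \<and> map g xs = ys"
  using assms
proof (induction xs ys rule: list_induct2)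
  case Nil
  then show ?case by (auto intro: permutes_id)
next
  case (Cons x xs y ys)
  then obtain g where g: "g permutes A" "map g xs = ys" by auto
  let ?g = "swap (g x) y \<circ> g"
  have "g x \<in> A" using g(1) Cons.prems by (simp add: permutes_in_image)
  then have "?g permutes A"
    using g(1) Cons.prems by (intro permutes_compose permutes_swap_id) auto
  moreover have "?g z = g z" if "z \<in> set xs" for z
  proof -
    have "g z \<in> set ys" using g(2) that by auto
    then have "g z \<noteq> y" using Cons.prems by auto
    moreover have "g z \<noteq> g x"
      using Cons.prems that permutes_inj[OF g(1)] by (auto dest: injD)
    ultimately show ?thesis by simp
  qed
  then have "map ?g (x # xs) = y # ys" using g(2) by auto
  ultimately have "\<exists>g. g permutes A \<and> map g (x # xs) = y # ys" by (intro exI conjI)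
  then show ?case .
qed

lemma exists_permutation_image:
  assumes "finite A" "S \<subseteq> A" "S' \<subseteq> A" "card S = card S'"
  obtains g where "g permutes A" "g ` S = S'"
proof -
  obtain xs where xs: "set xs = S" "distinct xs"
    using finite_distinct_list assms finite_subset by metis
  obtain ys where ys: "set ys = S'" "distinct ys"
    using finite_distinct_list assms finite_subset by metis
  have "length xs = length ys" using xs ys assms(4) by (metis distinct_card)
  then obtain g where "g permutes A" "map g xs = ys"
    using exists_permutation_map[of xs ys A] xs ys assms(2,3) by auto
  then show ?thesis using that xs ys by (metis image_set)
qed

text \<open>Listing all first points and then all second points gives a list without repetition, so
  a permutation can be chosen that respects the order inside each pair and hence introduces no
  sign.\<close>

lemma matchings_transitive:
  assumes "p \<in> matchings A j" "p' \<in> matchings A j"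
  obtains g where "g permutes A" "map_prod g g ` p = p'"
proof -
  have list: "\<exists>ps. set ps = p \<and> length ps = j \<and> distinct (map fst ps @ map snd ps)
      \<and> set (map fst ps @ map snd ps) \<subseteq> A" if "p \<in> matchings A j" for p
  proof -
    have p: "matching A p" "card p = j" using that by (auto simp: matchings_def)
    obtain ps where ps: "set ps = p" "distinct ps"
      using finite_distinct_list[OF matching_finite[OF p(1)]] by blast
    then show ?thesis
      using p distinct_card[OF ps(2)]
      by (intro exI[of _ ps]) (auto simp: matching_def distinct_map)
  qed
  obtain ps where ps: "set ps = p" "length ps = j" "distinct (map fst ps @ map snd ps)"
    "set (map fst ps @ map snd ps) \<subseteq> A" using list[OF assms(1)] by blast
  obtain qs where qs: "set qs = p'" "length qs = j" "distinct (map fst qs @ map snd qs)"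
    "set (map fst qs @ map snd qs) \<subseteq> A" using list[OF assms(2)] by blast
  obtain g where g: "g permutes A" "map g (map fst ps @ map snd ps) = map fst qs @ map snd qs"
    using exists_permutation_map[OF _ ps(3) qs(3) ps(4) qs(4)] ps(2) qs(2) by auto
  have "map (g \<circ> fst) ps = map fst qs" "map (g \<circ> snd) ps = map snd qs"
    using g(2) ps(2) qs(2) by auto
  then have "map (map_prod g g) ps = qs"
    using ps(2) qs(2) by (auto simp: list_eq_iff_nth_eq prod_eq_iff)
  then show ?thesis using that g(1) ps(1) qs(1) by (metis image_set)
qed

lemma matching_union:
  assumes "matching A p" "matching B q" "A \<inter> B = {}"
  shows "matching (A \<union> B) (p \<union> q)"
proof -
  have p: "finite p" "inj_on fst p" "inj_on snd p" "fst ` p \<inter> snd ` p = {}" "fst ` p \<subseteq> A" "snd ` p \<subseteq> A"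
    using assms(1) by (auto simp: matching_def)
  have q: "finite q" "inj_on fst q" "inj_on snd q" "fst ` q \<inter> snd ` q = {}" "fst ` q \<subseteq> B" "snd ` q \<subseteq> B"
    using assms(2) by (auto simp: matching_def)
  have dis: "X \<inter> Y = {}" if "X \<subseteq> A" "Y \<subseteq> B" for X Y
    using that assms(3) by blast
  have "fst ` (p - q) \<inter> fst ` (q - p) = {}" "snd ` (p - q) \<inter> snd ` (q - p) = {}"
    using dis[OF subset_trans[OF image_mono p(5)] subset_trans[OF image_mono q(5)]]
      dis[OF subset_trans[OF image_mono p(6)] subset_trans[OF image_mono q(6)]] by simp_all
  then have "inj_on fst (p \<union> q)" "inj_on snd (p \<union> q)"
    using p(2,3) q(2,3) by (simp_all add: inj_on_Un)
  moreover have "fst ` (p \<union> q) \<inter> snd ` (p \<union> q) = {}"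
    using dis[OF p(5) q(6)] dis[OF p(6) q(5)] p(4) q(4)
    by (simp add: image_Un Int_Un_distrib Int_Un_distrib2 Int_commute)
  moreover have "fst ` (p \<union> q) \<union> snd ` (p \<union> q) \<subseteq> A \<union> B"
    using p(5,6) q(5,6) unfolding image_Un by (intro Un_least) (rule le_supI1 le_supI2, assumption)+
  ultimately show ?thesis using p(1) q(1) by (simp add: matching_def)
qed

lemma matchings_nonempty:
  assumes "finite A" "2 * j \<le> card A"
  shows "matchings A j \<noteq> {}"
  using assms(2)
proof (induction j)
  case 0
  then show ?case by (auto simp: matchings_def intro!: exI[of _ "{}"])
next
  case (Suc j)
  then obtain p where p: "matching A p" "card p = j" by (auto simp: matchings_def)
  have "2 \<le> card (A - Field p)"
    using card_minus_Field_matching[OF assms(1) p(1)] p(2) Suc.prems by simp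
  then obtain x y where "x \<in> A - Field p" "y \<in> A - Field p" "x \<noteq> y"
    by (metis card_le_Suc0_iff_eq not_less_eq_eq numeral_2_eq_2 card.infinite le_zero_eq zero_neq_numeral)
  moreover from this have "(x, y) \<notin> p" by (auto simp: Field_def)
  ultimately have "insert (x, y) p \<in> matchings A (Suc j)"
    using matching_insert[OF p(1)] p matching_finite[OF p(1)] by (simp add: matchings_def)
  then show ?case by blast
qed


section \<open>Irreducibility of the induced representation\<close>

definition tabs :: "'a set \<Rightarrow> nat \<Rightarrow> 'a set list set"
  where "tabs S j = (\<lambda>C. [S - C, C]) ` subsets_of_card S j"

lemma finite_tabs [simp]: "finite S \<Longrightarrow> finite (tabs S j)"
  by (simp add: tabs_def)

lemma alt_tab_outside: "T \<notin> tabs A (card p) \<Longrightarrow> alt_tab A p T = 0"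
  by (auto simp: alt_tab_def tabs_def)

lemma tabs_act:
  assumes "g permutes S" "T \<in> tabs S j"
  shows "tabloid_act g T \<in> tabs S j"
proof -
  obtain C where C: "C \<in> subsets_of_card S j" "T = [S - C, C]" using assms(2) by (auto simp: tabs_def)
  have "g ` C \<in> subsets_of_card S j"
    using image_subsets_of_card_iff[OF permutes_inv[OF assms(1)], of C j] C(1)
    by (simp add: permutes_inv_inv[OF assms(1)])
  then show ?thesis
    unfolding C(2) tabloid_act_permutes[OF assms(1)] by (auto simp: tabs_def)
qed

text \<open>The two bounds say that \<open>[card A - l, l]\<close> and
  \<open>[card B - m, m]\<close> are partitions, where \<open>A\<close> and \<open>B\<close> are the
  two sides of \<theta> named below.\<close>

locale specht_pair =
  fixes n l m :: nat and \<theta> :: "nat \<Rightarrow> bit"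
  assumes \<theta>: "\<theta> \<in> C2_pow n"
    and l: "2 * l \<le> card (zeros n \<theta>)" and m: "2 * m \<le> card ({1..n} - zeros n \<theta>)"
begin

abbreviation "A \<equiv> zeros n \<theta>"
abbreviation "B \<equiv> {1..n} - zeros n \<theta>"
abbreviation "H \<equiv> C2_pow n \<times> stab n \<theta>"
abbreviation "TT \<equiv> tabs A l \<times> tabs B m"

definition E :: "(nat \<times> nat) set \<Rightarrow> (nat \<times> nat) set \<Rightarrow> nat set list \<times> nat set list \<Rightarrow> complex"
  where "E p q = tensor_fun (alt_tab A p) (alt_tab B q)"

definition V :: "(nat set list \<times> nat set list \<Rightarrow> complex) set"
  where "V = cvec.span {E p q | p q. p \<in> matchings A l \<and> q \<in> matchings B m}"

abbreviation "R \<equiv> ind_space (wreath n) H V (twisted_rep n \<theta>)"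

lemma tensor_space_eq_V:
  "tensor_space (specht [card A - l, l] A) (specht [card B - m, m] B) = V"
proof -
  have lin: "linear_on UNIV (\<lambda>u. tensor_fun u v)" "linear_on UNIV (tensor_fun u)"
    for u :: "nat set list \<Rightarrow> complex" and v :: "nat set list \<Rightarrow> complex"
    by (auto simp: linear_on_def tensor_fun_def fun_eq_iff algebra_simps)
  have S: "specht [card A - l, l] A = cvec.span (alt_tab A ` matchings A l)"
    "specht [card B - m, m] B = cvec.span (alt_tab B ` matchings B m)"
    using l m by (intro specht_two_rows; simp)+
  have "{tensor_fun u v | u v. u \<in> alt_tab A ` matchings A l \<and> v \<in> alt_tab B ` matchings B m}
    = {E p q | p q. p \<in> matchings A l \<and> q \<in> matchings B m}"
    unfolding E_def by blast
  then show ?thesis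
    unfolding tensor_space_def V_def S span_bilinear[OF lin] by simp
qed

lemma rho_space_eq: "rho_space n \<theta> [card A - l, l] [card B - m, m] = R"
  by (simp add: rho_space_def tensor_space_eq_V)

lemma stab_iff: "g \<in> stab n \<theta> \<longleftrightarrow> g permutes {1..n} \<and> C2_act g \<theta> = \<theta>"
  by (simp add: stab_def sym_group_carrier)

lemma stab_permutes: "g \<in> stab n \<theta> \<Longrightarrow> g permutes {1..n}"
  by (simp add: stab_iff)

lemma stab_image:
  assumes "g \<in> stab n \<theta>"
  shows "g ` A = A" "g ` B = B"
proof -
  have g: "g permutes {1..n}" "C2_act g \<theta> = \<theta>" using assms by (auto simp: stab_iff)
  then show A: "g ` A = A" using zeros_act[OF g(1), of \<theta>] by simp
  show "g ` B = B"
    using image_set_diff[OF permutes_inj[OF g(1)], of "{1..n}" A] permutes_image[OF g(1)] A by simp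
qed

lemma stab_inv: "g \<in> stab n \<theta> \<Longrightarrow> inv' g \<in> stab n \<theta>"
  unfolding stab_iff using C2_act_inv(2)[of g "{1..n}" \<theta>] by (simp add: permutes_inv)

lemma id_stab: "id \<in> stab n \<theta>"
  by (simp add: stab_iff permutes_id)

lemma restrict_permutes:
  assumes "g \<in> stab n \<theta>"
  shows "restrict_id g A permutes A" "restrict_id g B permutes B"
  using stab_image[OF assms] permutes_inj[OF stab_permutes[OF assms]]
  by (auto intro!: permutes_restrict_id simp: bij_betw_def intro: inj_on_subset[OF _ subset_UNIV])

lemma H_carrier: "H \<subseteq> carrier (wreath n)"
  by (auto simp: stab_permutes)

lemma H_inv:
  assumes "h \<in> H"
  shows "inv\<^bsub>wreath n\<^esub> h \<in> H"
proof -
  obtain \<omega> g where h: "h = (\<omega>, g)" by (cases h)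
  then have "\<omega> \<in> C2_pow n" "g \<in> stab n \<theta>" using assms by auto
  then show ?thesis
    unfolding h by (simp add: inv_wreath stab_permutes stab_inv C2_pow_act permutes_inv)
qed

lemma H_mult:
  assumes "h \<in> H" "h' \<in> H"
  shows "h \<otimes>\<^bsub>wreath n\<^esub> h' \<in> H"
proof -
  obtain \<omega> g \<omega>' g' where h: "h = (\<omega>, g)" "h' = (\<omega>', g')" by (cases h; cases h')
  then have "\<omega> \<in> C2_pow n" "g \<in> stab n \<theta>" "\<omega>' \<in> C2_pow n" "g' \<in> stab n \<theta>" using assms by auto
  then show ?thesis
    unfolding h
    by (auto simp: stab_iff C2_pow_act permutes_compose C2_act_compose[OF permutes_bij permutes_bij])
qed

lemma one_H: "\<one>\<^bsub>wreath n\<^esub> \<in> H"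
  by (simp add: id_stab)

lemma restrict_inv_image:
  assumes "bij g" "g ` S = S" "restrict_id g S permutes S" "C \<subseteq> S"
  shows "inv' (restrict_id g S) ` C = inv' g ` C"
proof -
  let ?D = "inv' g ` C"
  have gD: "g ` ?D = C" using assms(1) by (simp add: image_f_inv_f bij_is_surj)
  have "inv' g ` g ` S = S"
    using assms(1) by (simp add: image_inv_f_f bij_is_inj)
  then have "?D \<subseteq> S" using assms(2,4) by (metis image_mono)
  then have "restrict_id g S ` ?D = C" using gD by (auto simp: image_def subset_iff)
  then show ?thesis using permutes_inj[OF assms(3)] by (metis image_inv_f_f)
qed

lemma act_tab:
  assumes "g \<in> stab n \<theta>"
  shows "C \<subseteq> A \<Longrightarrow> tabloid_act (inv' (restrict_id g A)) [A - C, C] = [A - inv' g ` C, inv' g ` C]"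
    and "D \<subseteq> B \<Longrightarrow> tabloid_act (inv' (restrict_id g B)) [B - D, D] = [B - inv' g ` D, inv' g ` D]"
  using tabloid_act_permutes[OF permutes_inv[OF restrict_permutes(1)[OF assms]]]
    tabloid_act_permutes[OF permutes_inv[OF restrict_permutes(2)[OF assms]]]
    restrict_inv_image[OF permutes_bij[OF stab_permutes[OF assms]] stab_image(1)[OF assms]
      restrict_permutes(1)[OF assms]]
    restrict_inv_image[OF permutes_bij[OF stab_permutes[OF assms]] stab_image(2)[OF assms]
      restrict_permutes(2)[OF assms]]
  by simp_all

text \<open>The inverse is built in so that the tensor representation becomes plain composition with
  \<open>tab_act g\<close>.\<close>

definition tab_act :: "(nat \<Rightarrow> nat) \<Rightarrow> nat set list \<times> nat set list \<Rightarrow> nat set list \<times> nat set list"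
  where "tab_act g = (\<lambda>(x, y). (tabloid_act (inv' (restrict_id g A)) x, tabloid_act (inv' (restrict_id g B)) y))"

lemma specht_tensor_rep_apply:
  assumes "g \<in> stab n \<theta>"
  shows "specht_tensor_rep n \<theta> g f = (\<lambda>y. f (tab_act g y))"
  by (simp add: specht_tensor_rep_def Let_def tensor_op_def fun_eq_iff tab_act_def
      specht_rep_apply[OF restrict_permutes(1)[OF assms]] specht_rep_apply[OF restrict_permutes(2)[OF assms]])

lemma twisted_rep_apply:
  assumes "g \<in> stab n \<theta>"
  shows "twisted_rep n \<theta> (\<omega>, g) f = chi n \<theta> \<omega> *\<^sub>C (\<lambda>y. f (tab_act g y))"
  by (simp add: twisted_rep_def specht_tensor_rep_apply[OF assms])

lemma linear_on_twisted: "h \<in> H \<Longrightarrow> linear_on U (twisted_rep n \<theta> h)"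
  by (cases h) (auto simp: linear_on_def twisted_rep_apply fun_eq_iff algebra_simps)

lemma bij_tab_act:
  assumes "g \<in> stab n \<theta>"
  shows "bij_betw (tab_act g) TT TT"
proof (rule bij_betw_byWitness[where f' = "\<lambda>(x, y). (tabloid_act (restrict_id g A) x, tabloid_act (restrict_id g B) y)"])
  note g = restrict_permutes[OF assms]
  show "tab_act g ` TT \<subseteq> TT"
    using tabs_act[OF permutes_inv[OF g(1)]] tabs_act[OF permutes_inv[OF g(2)]] by (auto simp: tab_act_def)
  show "(\<lambda>(x, y). (tabloid_act (restrict_id g A) x, tabloid_act (restrict_id g B) y)) ` TT \<subseteq> TT"
    using tabs_act[OF g(1)] tabs_act[OF g(2)] by auto
qed (use restrict_permutes[OF assms] in
    \<open>auto simp: tab_act_def tabloid_act_compose[symmetric] permutes_inv_o tabloid_act_id\<close>)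

lemma tab_act_mem_iff:
  assumes "g \<in> stab n \<theta>"
  shows "tab_act g y \<in> TT \<longleftrightarrow> y \<in> TT"
proof
  note g = restrict_permutes[OF assms]
  obtain y1 y2 where y: "y = (y1, y2)" by (cases y)
  assume "tab_act g y \<in> TT"
  then have "tabloid_act (restrict_id g A) (tabloid_act (inv' (restrict_id g A)) y1) \<in> tabs A l"
    "tabloid_act (restrict_id g B) (tabloid_act (inv' (restrict_id g B)) y2) \<in> tabs B m"
    using tabs_act[OF g(1)] tabs_act[OF g(2)] by (auto simp: y tab_act_def)
  then show "y \<in> TT"
    using g by (simp add: y tabloid_act_compose[symmetric] permutes_inv_o tabloid_act_id)
qed (use bij_tab_act[OF assms] in \<open>auto simp: bij_betw_def\<close>)

lemma map_prod_restrict: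
  assumes "p \<in> matchings S j"
  shows "map_prod (restrict_id g S) (restrict_id g S) ` p = map_prod g g ` p"
proof (rule image_cong[OF refl])
  fix x assume "x \<in> p"
  then have "fst x \<in> S" "snd x \<in> S"
    using assms by (auto simp: matchings_def matching_def)
  then show "map_prod (restrict_id g S) (restrict_id g S) x = map_prod g g x"
    by (cases x) simp
qed

lemma E_tab_act:
  assumes "g \<in> stab n \<theta>" "p \<in> matchings A l" "q \<in> matchings B m"
  shows "(\<lambda>y. E p q (tab_act g y)) = E (map_prod g g ` p) (map_prod g g ` q)"
proof
  fix y
  have "alt_tab A p (tabloid_act (inv' (restrict_id g A)) x) = alt_tab A (map_prod g g ` p) x" for x
    using fun_cong[OF specht_rep_alt_tab[OF restrict_permutes(1)[OF assms(1)]], of p x]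
    by (simp add: specht_rep_apply[OF restrict_permutes(1)[OF assms(1)]] map_prod_restrict[OF assms(2)])
  moreover have "alt_tab B q (tabloid_act (inv' (restrict_id g B)) x) = alt_tab B (map_prod g g ` q) x" for x
    using fun_cong[OF specht_rep_alt_tab[OF restrict_permutes(2)[OF assms(1)]], of q x]
    by (simp add: specht_rep_apply[OF restrict_permutes(2)[OF assms(1)]] map_prod_restrict[OF assms(3)])
  ultimately show "E p q (tab_act g y) = E (map_prod g g ` p) (map_prod g g ` q) y"
    by (cases y) (simp add: E_def tab_act_def tensor_fun_def)
qed

lemma E_apply:
  assumes "p \<in> matchings A l" "q \<in> matchings B m" "C \<in> subsets_of_card A l" "D \<in> subsets_of_card B m"
  shows "E p q ([A - C, C], [B - D, D]) = alt_prod p C * alt_prod q D"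
  using assms by (simp add: E_def tensor_fun_def alt_tab_apply matchings_def)

lemma E_functions:
  assumes "p \<in> matchings A l" "q \<in> matchings B m"
  shows "E p q \<in> functions_on TT"
  using assms alt_tab_outside[of _ A p] alt_tab_outside[of _ B q]
  by (auto simp: functions_on_def E_def tensor_fun_def matchings_def)

lemma V_functions: "V \<subseteq> functions_on TT"
  unfolding V_def by (rule cvec.span_minimal[OF _ subspace_functions_on]) (auto simp: E_functions)

lemma subspace_R: "cvec.subspace R"
  by (rule subspace_ind_space) (auto simp: V_def cvec.subspace_span intro: linear_on_twisted H_inv)

lemma group_rep_R: "group_rep (wreath n) R (ind_rep (wreath n))"
proof (rule group_rep_ind_rep[OF group_wreath subspace_R])
  show "F g = 0" if "F \<in> R" "g \<notin> carrier (wreath n)" for F g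
    using that unfolding ind_space_def by blast
qed (rule ind_rep_ind_space[OF group_wreath H_carrier])

lemma transpose_stab:
  assumes "a \<in> A \<and> b \<in> A \<or> a \<in> B \<and> b \<in> B"
  shows "swap a b \<in> stab n \<theta>"
proof -
  have "\<theta> a = \<theta> b" using assms by (auto simp: zeros_def)
  then have "C2_act (swap a b) \<theta> = \<theta>"
    by (auto simp: fun_eq_iff C2_act_apply Transposition.transpose_def)
  moreover have "swap a b permutes {1..n}"
    using assms zeros_subset[of n \<theta>] by (intro permutes_swap_id) auto
  ultimately show ?thesis by (simp add: stab_iff)
qed

lemma matching_pair_cases:
  assumes "p \<in> matchings A l" "q \<in> matchings B m" "(a, b) \<in> p \<union> q"
  shows "a \<in> A \<and> b \<in> A \<or> a \<in> B \<and> b \<in> B"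
  using assms matching_pair[of A p a b] matching_pair[of B q a b] by (auto simp: matchings_def)

lemma tab_act_transpose:
  assumes "a \<in> A \<and> b \<in> A \<or> a \<in> B \<and> b \<in> B" "C \<subseteq> A" "D \<subseteq> B"
  defines "t \<equiv> swap a b"
  shows "tab_act t ([A - C, C], [B - D, D]) = ([A - t ` C, t ` C], [B - t ` D, t ` D])"
  using act_tab(1)[OF transpose_stab[OF assms(1)] assms(2)]
    act_tab(2)[OF transpose_stab[OF assms(1)] assms(3)]
  by (simp add: tab_act_def t_def)

text \<open>A pair of \<open>p\<close> lies in \<open>A\<close>, away from \<open>Field q\<close>,
  so its transposition reverses one factor and fixes the other; likewise for a pair of
  \<open>q\<close>. Outside \<open>TT\<close> both sides are zero.\<close>

lemma E_transpose:
  assumes "p \<in> matchings A l" "q \<in> matchings B m" "(a, b) \<in> p \<union> q"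
  shows "E p q (tab_act (swap a b) y) = - E p q y"
proof -
  let ?t = "swap a b"
  note ab = matching_pair_cases[OF assms]
  show ?thesis
  proof (cases "y \<in> TT")
    case True
    then obtain C D where CD: "C \<in> subsets_of_card A l" "D \<in> subsets_of_card B m"
      "y = ([A - C, C], [B - D, D])" by (auto simp: tabs_def)
    then have sub: "C \<subseteq> A" "D \<subseteq> B" by (auto simp: subsets_of_card_def)
    have "tab_act ?t y \<in> TT"
      using bij_tab_act[OF transpose_stab[OF ab]] True by (auto simp: bij_betw_def)
    then have tCD: "?t ` C \<in> subsets_of_card A l" "?t ` D \<in> subsets_of_card B m"
      unfolding CD(3) tab_act_transpose[OF ab sub] by (auto simp: tabs_def)
    have mp: "matching A p" "matching B q" using assms by (auto simp: matchings_def)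
    have "alt_prod p (?t ` C) * alt_prod q (?t ` D) = - (alt_prod p C * alt_prod q D)"
    proof (cases "(a, b) \<in> p")
      case True
      then have "a \<notin> Field q" "b \<notin> Field q"
        using matching_pair[OF mp(1) True] Field_matching[OF mp(2)] by auto
      then show ?thesis using alt_prod_swap[OF mp(1) True] alt_prod_fixed[of a q b] by simp
    next
      case False
      then have q: "(a, b) \<in> q" using assms(3) by simp
      then have "a \<notin> Field p" "b \<notin> Field p"
        using matching_pair[OF mp(2) q] Field_matching[OF mp(1)] by auto
      then show ?thesis using alt_prod_swap[OF mp(2) q] alt_prod_fixed[of a p b] by simp
    qed
    then show ?thesis
      unfolding CD(3) tab_act_transpose[OF ab sub]
      by (simp add: E_apply[OF assms(1,2) CD(1,2)] E_apply[OF assms(1,2) tCD])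
  next
    case False
    then have "tab_act ?t y \<notin> TT" 
      unfolding tab_act_mem_iff[OF transpose_stab[OF ab]] .
    then show ?thesis
      using functions_onD[OF E_functions[OF assms(1,2)]] False by simp
  qed
qed

end


section \<open>Vectors antisymmetric under all pairs, and invariant subspaces\<close>

context specht_pair
begin

text \<open>One variable at a time: for fixed \<open>D\<close> the function is a multiple of the
  alternating product of \<open>p\<close>, with some factor \<open>c D\<close>. Reading it at one
  transversal \<open>C0\<close> shows that \<open>c D\<close> is itself a multiple of the
  alternating product of \<open>q\<close>.\<close>

lemma E_eigenspace:
  assumes "p \<in> matchings A l" "q \<in> matchings B m" "v \<in> functions_on TT"
    and anti: "\<And>a b y. (a, b) \<in> p \<union> q \<Longrightarrow> v (tab_act (swap a b) y) = - v y"
  obtains c where "v = c *\<^sub>C E p q"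
proof -
  have mp: "matching A p" "card p = l" and mq: "matching B q" "card q = m"
    using assms(1,2) by (auto simp: matchings_def)
  let ?X = "subsets_of_card A l" and ?Y = "subsets_of_card B m"
  let ?v = "\<lambda>C D. v ([A - C, C], [B - D, D])"
  have sub: "C \<in> ?X \<Longrightarrow> C \<subseteq> A" "D \<in> ?Y \<Longrightarrow> D \<subseteq> B" for C D
    by (auto simp: subsets_of_card_def)
  have "\<exists>c. \<forall>C\<in>?X. ?v C D = c * alt_prod p C" if D: "D \<in> ?Y" for D
  proof -
    define f where "f C = (if C \<in> ?X then ?v C D else 0)" for C
    obtain c where c: "f = c *\<^sub>C alt_fun A (card p) p"
    proof (rule alt_fun_unique_top[OF finite_zeros mp(1)])
      show "f \<in> M_space A (card p)" by (simp add: f_def M_space_def functions_on_def mp(2))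
      fix a b C assume ab: "(a, b) \<in> p" and "C \<in> subsets_of_card A (card p)"
      then have C: "C \<in> ?X" by (simp add: mp(2))
      have mem: "a \<in> A" "b \<in> A" using matching_pair[OF mp(1) ab] by auto
      have "swap a b ` C \<in> ?X"
        using transpose_subsets_of_card[OF mem] C by (auto simp: bij_betw_def)
      moreover have "swap a b ` D = D"
        using sub(2)[OF D] mem by (intro image_transpose_same) auto
      ultimately show "f (swap a b ` C) = - f C"
        using anti[of a b "([A - C, C], [B - D, D])"] ab C mem
          tab_act_transpose[of a b C D] sub(1)[OF C] sub(2)[OF D] by (simp add: f_def)
    qed
    have "?v C D = c * alt_prod p C" if "C \<in> ?X" for C
      using fun_cong[OF c, of C] that by (simp add: f_def alt_fun_def mp(2))
    then show ?thesis by blast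
  qed
  then obtain c where c: "\<And>C D. C \<in> ?X \<Longrightarrow> D \<in> ?Y \<Longrightarrow> ?v C D = c D * alt_prod p C"
    by metis
  obtain C0 where C0: "C0 \<in> ?X" "alt_prod p C0 \<noteq> 0"
    using alt_prod_nonzero_exists[OF finite_zeros mp(1), of l] mp(2) l by auto
  define g where "g D = (if D \<in> ?Y then ?v C0 D else 0)" for D
  obtain d where d: "g = d *\<^sub>C alt_fun B (card q) q"
  proof (rule alt_fun_unique_top[OF _ mq(1)])
    show "g \<in> M_space B (card q)" by (simp add: g_def M_space_def functions_on_def mq(2))
    fix a b D assume ab: "(a, b) \<in> q" and "D \<in> subsets_of_card B (card q)"
    then have D: "D \<in> ?Y" by (simp add: mq(2))
    have mem: "a \<in> B" "b \<in> B" using matching_pair[OF mq(1) ab] by auto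
    have "swap a b ` D \<in> ?Y"
      using transpose_subsets_of_card[OF mem] D by (auto simp: bij_betw_def)
    moreover have "swap a b ` C0 = C0"
      using sub(1)[OF C0(1)] mem by (intro image_transpose_same) auto
    ultimately show "g (swap a b ` D) = - g D"
      using anti[of a b "([A - C0, C0], [B - D, D])"] ab D mem
        tab_act_transpose[of a b C0 D] sub(1)[OF C0(1)] sub(2)[OF D] by (simp add: g_def)
  qed simp
  have cD: "c D = d / alt_prod p C0 * alt_prod q D" if "D \<in> ?Y" for D
    using fun_cong[OF d, of D] that c[OF C0(1) that] C0(2)
    by (simp add: g_def alt_fun_def mq(2) field_simps)
  have "v y = (d / alt_prod p C0) * E p q y" for y
  proof (cases "y \<in> TT")
    case True
    then obtain C D where CD: "C \<in> ?X" "D \<in> ?Y" "y = ([A - C, C], [B - D, D])"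
      by (auto simp: tabs_def)
    show ?thesis
      unfolding CD(3) E_apply[OF assms(1,2) CD(1,2)] c[OF CD(1,2)] cD[OF CD(2)] by simp
  next
    case False
    then show ?thesis
      using functions_onD[OF assms(3)] functions_onD[OF E_functions[OF assms(1,2)]] by simp
  qed
  then have "v = (d / alt_prod p C0) *\<^sub>C E p q" by (simp add: fun_eq_iff)
  then show ?thesis by (rule that)
qed

lemma R_value: "F \<in> R \<Longrightarrow> g \<in> carrier (wreath n) \<Longrightarrow> F g \<in> V"
  by (simp add: ind_space_def)

text \<open>Projecting onto the \<open>chi n \<theta>\<close>-isotypic part for the base group amounts to restricting to \<open>H\<close>.\<close>

lemma character_projection:
  assumes "F \<in> R" "(\<tau>, g) \<in> carrier (wreath n)"
  shows "(\<Sum>\<omega>\<in>C2_pow n. chi n \<theta> \<omega> *\<^sub>C ind_rep (wreath n) (\<omega>, id) F) (\<tau>, g)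
    = (if (\<tau>, g) \<in> H then of_nat (card (C2_pow n)) *\<^sub>C F (\<tau>, g) else 0)"
proof -
  have \<tau>g: "\<tau> \<in> C2_pow n" "g permutes {1..n}" using assms(2) by auto
  have "ind_rep (wreath n) (\<omega>, id) F (\<tau>, g) = chi n (C2_act g \<theta>) \<omega> *\<^sub>C F (\<tau>, g)"
    if \<omega>: "\<omega> \<in> C2_pow n" for \<omega>
  proof -
    \<comment> \<open>Left translation by \<open>(\<omega>, id)\<close> is moved to the right of
      \<open>(\<tau>, g)\<close>, where it appears conjugated by \<open>g\<close>; the character
      picked up is therefore that of \<open>C2_act g \<theta>\<close>.\<close>
    let ?\<omega> = "C2_act (inv' g) \<omega>"
    have \<omega>': "?\<omega> \<in> C2_pow n" using C2_pow_act[OF permutes_inv[OF \<tau>g(2)] \<omega>] .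
    have "(?\<omega>, id) \<in> H" using \<omega>' id_stab by simp
    then have "F ((\<tau>, g) \<otimes>\<^bsub>wreath n\<^esub> (?\<omega>, id)) = twisted_rep n \<theta> (inv\<^bsub>wreath n\<^esub> (?\<omega>, id)) (F (\<tau>, g))"
      using assms unfolding ind_space_def by blast
    moreover have "inv\<^bsub>wreath n\<^esub> (?\<omega>, id) = (?\<omega>, id)" "inv\<^bsub>wreath n\<^esub> (\<omega>, id) = (\<omega>, id)"
      using inv_wreath[OF \<omega>' permutes_id] inv_wreath[OF \<omega> permutes_id] by simp_all
    moreover have "tab_act id y = y" for y
      by (cases y) (simp add: tab_act_def restrict_id_def tabloid_act_id flip: id_def)
    ultimately show ?thesis
      using \<tau>g assms(2)
      by (simp add: ind_rep_apply twisted_rep_apply[OF id_stab] chi_act add.commute)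
  qed
  then have "(\<Sum>\<omega>\<in>C2_pow n. chi n \<theta> \<omega> *\<^sub>C ind_rep (wreath n) (\<omega>, id) F) (\<tau>, g)
    = (\<Sum>\<omega>\<in>C2_pow n. (chi n \<theta> \<omega> * chi n (C2_act g \<theta>) \<omega>) *\<^sub>C F (\<tau>, g))"
    unfolding sum_fun_apply[where x = "(\<tau>, g)"] by (intro sum.cong refl) (simp add: scaleC_scaleC)
  \<comment> \<open>Orthogonality of characters leaves only those \<open>g\<close> that fix
    \<theta>, which is membership in the stabilizer.\<close>
  also have "\<dots> = (if \<theta> = C2_act g \<theta> then of_nat (card (C2_pow n)) else 0) *\<^sub>C F (\<tau>, g)"
    unfolding cvec.scale_sum_left[symmetric] chi_orthogonal[OF \<theta> C2_pow_act[OF \<tau>g(2) \<theta>]] ..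
  also have "\<dots> = (if (\<tau>, g) \<in> H then of_nat (card (C2_pow n)) *\<^sub>C F (\<tau>, g) else 0)"
    using \<tau>g by (auto simp: stab_iff)
  finally show ?thesis .
qed

text \<open>Permutations of \<open>A\<close> and of \<open>B\<close> can be chosen independently,
  and their composition fixes \<theta> because \<theta> is constant on each side.\<close>

lemma stab_transitive:
  assumes "p \<in> matchings A l" "q \<in> matchings B m" "p' \<in> matchings A l" "q' \<in> matchings B m"
  obtains g where "g \<in> stab n \<theta>" "map_prod g g ` p = p'" "map_prod g g ` q = q'"
proof -
  obtain g1 where g1: "g1 permutes A" "map_prod g1 g1 ` p = p'"
    using matchings_transitive[OF assms(1,3)] .
  obtain g2 where g2: "g2 permutes B" "map_prod g2 g2 ` q = q'"
    using matchings_transitive[OF assms(2,4)] .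
  define g where "g = g1 \<circ> g2"
  have gA: "g z = g1 z" if "z \<in> A" for z
    using permutes_not_in[OF g2(1), of z] that by (simp add: g_def)
  have gB: "g z = g2 z" if "z \<in> B" for z
    using permutes_not_in[OF g1(1), of "g2 z"] permutes_in_image[OF g2(1), of z] that
    by (simp add: g_def)
  have "g permutes {1..n}"
    unfolding g_def
    using permutes_subset[OF g1(1) zeros_subset] permutes_subset[OF g2(1) Diff_subset]
    by (rule permutes_compose[rotated])
  moreover have "C2_act g \<theta> = \<theta>"
  proof
    fix z
    have inv: "inv' g z = inv' g2 (inv' g1 z)"
      using o_inv_distrib[OF permutes_bij[OF g1(1)] permutes_bij[OF g2(1)]] by (simp add: g_def)
    show "C2_act g \<theta> z = \<theta> z"
    proof (cases "z \<in> A")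
      case True
      then have "inv' g1 z \<in> A" using permutes_in_image[OF permutes_inv[OF g1(1)]] by blast
      moreover from this have "inv' g z = inv' g1 z"
        using inv permutes_not_in[OF permutes_inv[OF g2(1)]] by simp
      ultimately show ?thesis using True by (simp add: C2_act_apply zeros_def)
    next
      case zA: False
      then have i1: "inv' g1 z = z" using permutes_not_in[OF permutes_inv[OF g1(1)]] by blast
      show ?thesis
      proof (cases "z \<in> B")
        case True
        then have "inv' g z \<in> B"
          using inv i1 permutes_in_image[OF permutes_inv[OF g2(1)], of z] by simp
        then show ?thesis using True by (simp add: C2_act_apply zeros_def)
      next
        case False
        then have "inv' g z = z" using inv i1 permutes_not_in[OF permutes_inv[OF g2(1)]] by simp
        then show ?thesis by (simp add: C2_act_apply)
      qed
    qed
  qed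
  ultimately have "g \<in> stab n \<theta>" by (simp add: stab_iff)
  moreover have "map_prod g g ` p = p'"
  proof -
    have mp: "matching A p" using assms(1) by (simp add: matchings_def)
    have "map_prod g g x = map_prod g1 g1 x" if "x \<in> p" for x
      using matching_pair[OF mp, of "fst x" "snd x"] that gA by (cases x) simp
    then have "map_prod g g ` p = map_prod g1 g1 ` p" by (rule image_cong[OF refl])
    then show ?thesis using g1(2) by simp
  qed
  moreover have "map_prod g g ` q = q'"
  proof -
    have mq: "matching B q" using assms(2) by (simp add: matchings_def)
    have "map_prod g g x = map_prod g2 g2 x" if "x \<in> q" for x
      using matching_pair[OF mq, of "fst x" "snd x"] that gB by (cases x) simp
    then have "map_prod g g ` q = map_prod g2 g2 ` q" by (rule image_cong[OF refl])
    then show ?thesis using g2(2) by simp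
  qed
  ultimately show ?thesis by (rule that)
qed

text \<open>The functional pairing the value at the identity with \<open>E p q\<close> is carried
  along. It is nonzero after a translation, and neither the projection nor the antisymmetrization
  can make it zero, so the final vector does not vanish; \<open>E_eigenspace\<close> then identifies
  its value at the identity up to a scalar.\<close>

lemma subrep_contains_E:
  assumes U: "U \<subseteq> R" "group_rep (wreath n) U (ind_rep (wreath n))" "U \<noteq> {0}"
  obtains p q F where "p \<in> matchings A l" "q \<in> matchings B m" "F \<in> U"
    "\<And>g. g \<in> carrier (wreath n) \<Longrightarrow> g \<notin> H \<Longrightarrow> F g = 0" "F \<one>\<^bsub>wreath n\<^esub> = E p q"
proof -
  interpret W: group "wreath n" by (rule group_wreath)
  interpret U: group_rep "wreath n" U "ind_rep (wreath n)" by fact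
  let ?G = "wreath n"
  have oneG: "\<one>\<^bsub>?G\<^esub> \<in> carrier ?G" by (rule W.one_closed)
  have finTT: "finite TT" by simp
  obtain F0 where F0: "F0 \<in> U" "F0 \<noteq> 0"
    using U(3) cvec.subspace_0[OF U.subspace] by blast
  then obtain g where "F0 g \<noteq> 0" by (auto simp: fun_eq_iff)
  moreover from this have g: "g \<in> carrier ?G"
    using F0(1) U(1) unfolding ind_space_def by blast
  moreover have FV: "F0 g \<in> V" using R_value[OF _ g] F0(1) U(1) by blast
  ultimately have "inner_on TT (F0 g) (F0 g) \<noteq> 0"
    using inner_on_self_functions[OF finTT] V_functions by blast
  \<comment> \<open>If all these pairings were zero, \<open>F0 g\<close> would be orthogonal to the
    span \<open>V\<close> that contains it, hence to itself.\<close>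
  then obtain p q where pq: "p \<in> matchings A l" "q \<in> matchings B m"
    and nz: "inner_on TT (F0 g) (E p q) \<noteq> 0"
    using inner_on_span[OF _ FV[unfolded V_def], of TT "F0 g"] by blast
  define F1 where "F1 = ind_rep ?G (inv\<^bsub>?G\<^esub> g) F0"
  have F1: "F1 \<in> U" unfolding F1_def by (intro U.closed W.inv_closed g F0(1))
  have F1_one: "F1 \<one>\<^bsub>?G\<^esub> = F0 g"
    unfolding F1_def ind_rep_apply[OF oneG] W.inv_inv[OF g] W.r_one[OF g] ..
  define F2 where "F2 = (\<Sum>\<omega>\<in>C2_pow n. chi n \<theta> \<omega> *\<^sub>C ind_rep ?G (\<omega>, id) F1)"
  have F2: "F2 \<in> U"
    unfolding F2_def
    by (intro cvec.subspace_sum[OF U.subspace] cvec.subspace_scale[OF U.subspace] U.closed F1)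
      (simp add: permutes_id)
  have F2_val: "F2 x = (if x \<in> H then of_nat (card (C2_pow n)) *\<^sub>C F1 x else 0)" if "x \<in> carrier ?G" for x
  proof -
    obtain \<tau> g where x: "x = (\<tau>, g)" by (cases x)
    show ?thesis
      unfolding F2_def x
      by (rule character_projection[OF subsetD[OF U(1) F1]]) (use that in \<open>simp only: x\<close>)
  qed
  \<comment> \<open>Antisymmetrization takes place inside the functions supported on
    \<open>H\<close>, which the action of \<open>H\<close> preserves because \<open>H\<close> is
    closed under products.\<close>
  define U' where "U' = {F \<in> U. \<forall>g\<in>carrier ?G. g \<notin> H \<longrightarrow> F g = 0}"
  have subU': "cvec.subspace U'"
    using U.subspace by (auto simp: cvec.subspace_def U'_def)
  have F2U': "F2 \<in> U'" using F2 F2_val by (simp add: U'_def)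
  have closedU': "ind_rep ?G h F \<in> U'" if h: "h \<in> H" and F: "F \<in> U'" for h F
  proof -
    have hG: "h \<in> carrier ?G" using h H_carrier by blast
    have "ind_rep ?G h F x = 0" if x: "x \<in> carrier ?G" "x \<notin> H" for x
    proof -
      have "inv\<^bsub>?G\<^esub> h \<otimes>\<^bsub>?G\<^esub> x \<notin> H"
      proof
        assume "inv\<^bsub>?G\<^esub> h \<otimes>\<^bsub>?G\<^esub> x \<in> H"
        then have "h \<otimes>\<^bsub>?G\<^esub> (inv\<^bsub>?G\<^esub> h \<otimes>\<^bsub>?G\<^esub> x) \<in> H" by (rule H_mult[OF h])
        then show False using x hG by (simp add: W.m_assoc[symmetric] del: wreath_simps mem_Sigma_iff)
      qed
      moreover have "inv\<^bsub>?G\<^esub> h \<otimes>\<^bsub>?G\<^esub> x \<in> carrier ?G" using hG x(1) by blast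
      ultimately show ?thesis using F x(1) by (simp add: ind_rep_apply U'_def)
    qed
    then show ?thesis using U.closed[OF hG] F by (simp add: U'_def)
  qed
  have at_one: "ind_rep ?G h F \<one>\<^bsub>?G\<^esub> = twisted_rep n \<theta> h (F \<one>\<^bsub>?G\<^esub>)" if "h \<in> H" "F \<in> U'" for h F
    by (rule ind_rep_at_one[OF group_wreath that(1) H_carrier H_inv[OF that(1)]])
      (use that(2) U(1) in \<open>auto simp: U'_def\<close>)
  let ?S = "p \<union> q"
  let ?t = "\<lambda>x. swap (fst x) (snd x)"
  let ?s = "\<lambda>x. ind_rep ?G (0, ?t x)"
  let ?\<phi> = "\<lambda>F. inner_on TT (F \<one>\<^bsub>?G\<^esub>) (E p q)"
  have tstab: "?t x \<in> stab n \<theta>" if "x \<in> ?S" for x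
    by (rule transpose_stab, rule matching_pair_cases[OF pq]) (use that in simp)
  have tH: "(0, ?t x) \<in> H" if "x \<in> ?S" for x
    using tstab[OF that] by simp
  have tG: "(0, ?t x) \<in> carrier ?G" if "x \<in> ?S" for x
    using tH[OF that] H_carrier by blast
  have s_one: "?s x F \<one>\<^bsub>?G\<^esub> = (\<lambda>y. (F \<one>\<^bsub>?G\<^esub>) (tab_act (?t x) y))" if "x \<in> ?S" "F \<in> U'" for x F
    by (simp only: at_one[OF tH[OF that(1)] that(2)] twisted_rep_apply[OF tstab[OF that(1)]] chi_0 scaleC_one)
  have munion: "matching (A \<union> B) ?S"
    using pq by (intro matching_union) (auto simp: matchings_def)
  have "\<exists>F\<in>U'. ?\<phi> F \<noteq> 0 \<and> (\<forall>x\<in>?S. ?s x F = - F)"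
  proof (rule antisymmetrize[OF _ subU', where u = F2])
    show "finite ?S" using pq by (auto simp: matchings_def matching_finite)
    show "F2 \<in> U'" by (rule F2U')
    show "linear_on U' ?\<phi>"
      by (simp add: linear_on_def inner_on_add_left inner_on_scale_left)
    show "?\<phi> F2 \<noteq> 0"
      using nz card_C2_pow_nonzero one_H
      unfolding F2_val[OF oneG] F1_one by (simp add: inner_on_scale_left del: wreath_simps mem_Sigma_iff)
  next
    fix x assume x: "x \<in> ?S"
    show "linear_on U' (?s x)"
      by (rule linear_on_subset[OF U.linear[OF tG[OF x]]]) (auto simp: U'_def)
    show "?s x u \<in> U'" if "u \<in> U'" for u
      by (rule closedU'[OF tH[OF x] that])
    show "?s x (?s x u) = u" if u: "u \<in> U'" for u
    proof -
      have uU: "u \<in> U" using u by (simp add: U'_def)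
      have "ind_rep ?G ((0, ?t x) \<otimes>\<^bsub>?G\<^esub> (0, ?t x)) u = ?s x (?s x u)"
        by (rule U.rep_mult[OF tG[OF x] tG[OF x] uU])
      moreover have "(0, ?t x) \<otimes>\<^bsub>?G\<^esub> (0, ?t x) = \<one>\<^bsub>?G\<^esub>" by simp
      ultimately show ?thesis using U.rep_one[OF uU] by simp
    qed
    show "?\<phi> (?s x u) = - ?\<phi> u" if u: "u \<in> U'" for u
    proof -
      let ?f = "u \<one>\<^bsub>?G\<^esub>"
      have "?\<phi> (?s x u) = (\<Sum>y\<in>TT. ?f (tab_act (?t x) y) * cnj (E p q y))"
        unfolding s_one[OF x u] inner_on_def ..
      also have "\<dots> = (\<Sum>y\<in>TT. - (?f (tab_act (?t x) y) * cnj (E p q (tab_act (?t x) y))))"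
        using E_transpose[OF pq, of "fst x" "snd x"] x by simp
      also have "\<dots> = - (\<Sum>y\<in>TT. ?f (tab_act (?t x) y) * cnj (E p q (tab_act (?t x) y)))"
        by (rule sum_negf)
      also have "(\<Sum>y\<in>TT. ?f (tab_act (?t x) y) * cnj (E p q (tab_act (?t x) y)))
        = (\<Sum>y\<in>TT. ?f y * cnj (E p q y))"
        by (rule sum.reindex_bij_betw[OF bij_tab_act[OF tstab[OF x]]])
      finally show ?thesis unfolding inner_on_def .
    qed
    fix y u assume y: "y \<in> ?S" and u: "u \<in> U'"
    have uU: "u \<in> U" using u by (simp add: U'_def)
    \<comment> \<open>Distinct pairs of the combined matching \<open>p \<union> q\<close> are
      disjoint, so their transpositions commute.\<close>
    have "?t x \<circ> ?t y = ?t y \<circ> ?t x"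
    proof (cases "x = y")
      case False
      then have ne: "?t y (fst x) = fst x" "?t y (snd x) = snd x"
        using matching_disjoint_pairs[OF munion, of "fst x" "snd x" "fst y" "snd y"] x y
        by (auto simp: prod_eq_iff)
      then show ?thesis
        using transpose_apply_commute[OF bij_transpose, of "fst x" "snd x" "fst y" "snd y"]
        by (simp add: fun_eq_iff)
    qed simp
    then have "(0, ?t x) \<otimes>\<^bsub>?G\<^esub> (0, ?t y) = (0, ?t y) \<otimes>\<^bsub>?G\<^esub> (0, ?t x)" by simp
    then show "?s x (?s y u) = ?s y (?s x u)"
      using U.rep_mult[OF tG[OF x] tG[OF y] uU] U.rep_mult[OF tG[OF y] tG[OF x] uU] by simp
  qed
  then obtain F where F: "F \<in> U'" "?\<phi> F \<noteq> 0" "\<And>x. x \<in> ?S \<Longrightarrow> ?s x F = - F"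
    by blast
  let ?v = "F \<one>\<^bsub>?G\<^esub>"
  have FR: "F \<in> R" using F(1) U(1) by (auto simp: U'_def)
  obtain c where c: "?v = c *\<^sub>C E p q"
  proof (rule E_eigenspace[OF pq])
    show "?v \<in> functions_on TT" using R_value[OF FR oneG] V_functions by blast
    fix a b y assume ab: "(a, b) \<in> ?S"
    have "?s (a, b) F \<one>\<^bsub>?G\<^esub> = - ?v" using F(3)[OF ab] by simp
    then have "(\<lambda>y. ?v (tab_act (swap a b) y)) = - ?v"
      using s_one[OF ab F(1)] by simp
    from fun_cong[OF this, of y] show "?v (tab_act (swap a b) y) = - ?v y"
      by simp
  qed
  have "c \<noteq> 0" using F(2) c by auto
  then have "(inverse c *\<^sub>C F) \<one>\<^bsub>?G\<^esub> = E p q"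
    by (simp add: c scaleC_scaleC scaleC_one del: wreath_simps)
  moreover have "inverse c *\<^sub>C F \<in> U'" by (rule cvec.subspace_scale[OF subU' F(1)])
  ultimately show ?thesis
    using that[OF pq, of "inverse c *\<^sub>C F"] unfolding U'_def by blast
qed

text \<open>The values at the identity of those functions in \<open>U\<close> that are supported on
  \<open>H\<close> form a subspace. It contains one \<open>E p q\<close>, hence all of them by
  transitivity of the stabilizer, and so contains \<open>V\<close>; averaging translates then yields
  all of \<open>R\<close>.\<close>

lemma subrep_eq_R:
  assumes U: "U \<subseteq> R" "group_rep (wreath n) U (ind_rep (wreath n))" "U \<noteq> {0}"
  shows "U = R"
proof (rule ind_space_generated[OF group_wreath finite_carrier_wreath H_carrier _ U(1,2)])
  interpret W: group "wreath n" by (rule group_wreath)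
  interpret U: group_rep "wreath n" U "ind_rep (wreath n)" by fact
  let ?G = "wreath n"
  show "H \<noteq> {}" using one_H by blast
  obtain p q F where F: "p \<in> matchings A l" "q \<in> matchings B m" "F \<in> U"
    "\<And>g. g \<in> carrier ?G \<Longrightarrow> g \<notin> H \<Longrightarrow> F g = 0" "F \<one>\<^bsub>?G\<^esub> = E p q"
    using subrep_contains_E[OF U] by blast
  define V' where "V' = {v. \<exists>K\<in>U. (\<forall>g\<in>carrier ?G. g \<notin> H \<longrightarrow> K g = 0) \<and> K \<one>\<^bsub>?G\<^esub> = v}"
  have "cvec.subspace V'"
    unfolding cvec.subspace_def
  proof (intro conjI ballI allI)
    show "0 \<in> V'" using cvec.subspace_0[OF U.subspace] by (auto simp: V'_def intro!: bexI[of _ 0])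
    fix u v assume "u \<in> V'" "v \<in> V'"
    then obtain K L where "K \<in> U" "\<forall>g\<in>carrier ?G. g \<notin> H \<longrightarrow> K g = 0" "K \<one>\<^bsub>?G\<^esub> = u"
      "L \<in> U" "\<forall>g\<in>carrier ?G. g \<notin> H \<longrightarrow> L g = 0" "L \<one>\<^bsub>?G\<^esub> = v"
      unfolding V'_def by blast
    then show "u + v \<in> V'"
      unfolding V'_def by (intro CollectI bexI[of _ "K + L"]) (simp_all add: cvec.subspace_add[OF U.subspace])
  next
    fix c u assume "u \<in> V'"
    then obtain K where "K \<in> U" "\<forall>g\<in>carrier ?G. g \<notin> H \<longrightarrow> K g = 0" "K \<one>\<^bsub>?G\<^esub> = u"
      unfolding V'_def by blast
    then show "c *\<^sub>C u \<in> V'"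
      unfolding V'_def by (intro CollectI bexI[of _ "c *\<^sub>C K"]) (simp_all add: cvec.subspace_scale[OF U.subspace])
  qed
  moreover have "E p' q' \<in> V'" if p': "p' \<in> matchings A l" and q': "q' \<in> matchings B m" for p' q'
  proof -
    obtain g where g: "g \<in> stab n \<theta>" "map_prod g g ` p = p'" "map_prod g g ` q = q'"
      using stab_transitive[OF F(1,2) p' q'] .
    let ?h = "(0 :: nat \<Rightarrow> bit, g)"
    have h: "?h \<in> H" using g(1) by simp
    then have hG: "?h \<in> carrier ?G" using H_carrier by blast
    have "ind_rep ?G ?h F \<one>\<^bsub>?G\<^esub> = twisted_rep n \<theta> ?h (E p q)"
      unfolding ind_rep_at_one[OF group_wreath h H_carrier H_inv[OF h] subsetD[OF U(1) F(3)]] F(5) ..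
    also have "\<dots> = E p' q'"
      by (simp only: twisted_rep_apply[OF g(1)] E_tab_act[OF g(1) F(1,2)] g(2,3) chi_0 scaleC_one)
    finally have 1: "ind_rep ?G ?h F \<one>\<^bsub>?G\<^esub> = E p' q'" .
    have "ind_rep ?G ?h F x = 0" if x: "x \<in> carrier ?G" "x \<notin> H" for x
    proof -
      have "inv\<^bsub>?G\<^esub> ?h \<otimes>\<^bsub>?G\<^esub> x \<notin> H"
      proof
        assume "inv\<^bsub>?G\<^esub> ?h \<otimes>\<^bsub>?G\<^esub> x \<in> H"
        then have "?h \<otimes>\<^bsub>?G\<^esub> (inv\<^bsub>?G\<^esub> ?h \<otimes>\<^bsub>?G\<^esub> x) \<in> H" by (rule H_mult[OF h])
        then show False using x hG by (simp add: W.m_assoc[symmetric] del: wreath_simps mem_Sigma_iff)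
      qed
      moreover have "inv\<^bsub>?G\<^esub> ?h \<otimes>\<^bsub>?G\<^esub> x \<in> carrier ?G" using hG x(1) by blast
      ultimately show ?thesis using F(4) x(1) by (simp add: ind_rep_apply)
    qed
    then show ?thesis using 1 U.closed[OF hG F(3)] unfolding V'_def by blast
  qed
  ultimately have "V \<subseteq> V'" unfolding V_def by (intro cvec.span_minimal) auto
  then show "\<exists>K\<in>U. (\<forall>g\<in>carrier ?G. g \<notin> H \<longrightarrow> K g = 0) \<and> K \<one>\<^bsub>?G\<^esub> = v" if "v \<in> V" for v
    using that unfolding V'_def by blast
qed

end


section \<open>The isomorphism\<close>

lemma C2_eqI:
  assumes "\<theta> \<in> C2_pow n" "\<theta>' \<in> C2_pow n" "zeros n \<theta> = zeros n \<theta>'"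
  shows "\<theta> = \<theta>'"
proof
  fix z
  show "\<theta> z = \<theta>' z"
  proof (cases "z \<in> {1..n}")
    case True
    then have "\<theta> z = 0 \<longleftrightarrow> \<theta>' z = 0" using assms(3) by (auto simp: zeros_def)
    then show ?thesis by (cases "\<theta> z"; cases "\<theta>' z") simp_all
  next
    case False
    then show ?thesis using assms(1,2) unfolding C2_pow_def by simp
  qed
qed

text \<open>The image of an injective intertwiner from a nonzero space is a nonzero invariant
  subspace of \<open>R\<close>, hence all of \<open>R\<close>. Surjectivity and the nonvanishing of
  \<open>R\<close> come out together.\<close>

lemma rep_iso_of_irreducible:
  assumes "group_rep G W \<rho>" "group_rep G R \<sigma>"
    and lin: "linear_on W T" and TW: "\<And>w. w \<in> W \<Longrightarrow> T w \<in> R"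
    and equi: "\<And>g w. g \<in> carrier G \<Longrightarrow> w \<in> W \<Longrightarrow> T (\<rho> g w) = \<sigma> g (T w)"
    and ker: "\<And>w. w \<in> W \<Longrightarrow> T w = 0 \<Longrightarrow> w = 0" and "W \<noteq> {0}"
    and irr: "\<And>U. U \<subseteq> R \<Longrightarrow> group_rep G U \<sigma> \<Longrightarrow> U \<noteq> {0} \<Longrightarrow> U = R"
  shows "rep_iso G W \<rho> R \<sigma> \<and> irreducible_rep G R \<sigma>"
proof -
  interpret W: group_rep G W \<rho> by fact
  interpret R: group_rep G R \<sigma> by fact
  have sub: "T ` W \<subseteq> R" using TW by blast
  have "group_rep G (T ` W) \<sigma>"
  proof unfold_locales
    show "cvec.subspace (T ` W)" by (rule linear_on_subspace_image[OF lin W.subspace])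
    show "linear_on (T ` W) (\<sigma> g)" if "g \<in> carrier G" for g
      by (rule linear_on_subset[OF R.linear[OF that] sub])
    show "\<sigma> g v \<in> T ` W" if "g \<in> carrier G" "v \<in> T ` W" for g v
      using that W.closed equi by (metis (no_types, lifting) image_iff)
  qed (use sub R.rep_one R.rep_mult in blast)+
  moreover have nz: "T ` W \<noteq> {0}"
  proof
    assume "T ` W = {0}"
    then have "W \<subseteq> {0}" using ker by blast
    then show False using \<open>W \<noteq> {0}\<close> W.subspace cvec.subspace_0 by blast
  qed
  ultimately have im: "T ` W = R" by (rule irr[OF sub])
  then have "rep_iso G W \<rho> R \<sigma>"
    unfolding rep_iso_def bij_betw_def
    using assms(1-3) equi linear_on_inj[OF lin W.subspace ker] by blast
  moreover have "irreducible_rep G R \<sigma>"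
    unfolding irreducible_rep_def using assms(2) irr nz im by blast
  ultimately show ?thesis ..
qed

section \<open>The intertwiner obtained by pairing with cones\<close>

context specht_pair
begin

text \<open>Two indicators are kept instead of a single one for \<open>C \<union> D\<close>, so that
  sums over \<open>S\<close> factor over the two sides of \<theta>.\<close>

definition cone :: "nat \<Rightarrow> nat \<Rightarrow> nat set \<Rightarrow> nat set \<Rightarrow> (nat \<Rightarrow> bit) \<times> nat set \<Rightarrow> complex"
  where "cone r i C D = layer_fun n r i \<theta> (\<lambda>S. of_bool (C \<subseteq> S) * of_bool (D \<subseteq> S))"

text \<open>The adjoint of the embedding that sends a pair of tabloids with second rows \<open>C\<close> and \<open>D\<close> to the
  cone over \<open>C\<close> and \<open>D\<close>.\<close>

definition Q :: "nat \<Rightarrow> nat \<Rightarrow> ((nat \<Rightarrow> bit) \<times> nat set \<Rightarrow> complex)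
    \<Rightarrow> nat set list \<times> nat set list \<Rightarrow> complex"
  where "Q r i u = (\<lambda>y. if y \<in> TT then inner_on (Y_set n r) u (cone r i (fst y ! 1) (snd y ! 1)) else 0)"

lemma Q_apply:
  assumes "C \<in> subsets_of_card A l" "D \<in> subsets_of_card B m"
  shows "Q r i u ([A - C, C], [B - D, D]) = inner_on (Y_set n r) u (cone r i C D)"
  using assms by (simp add: Q_def tabs_def)

lemma linear_on_Q: "linear_on U (Q r i)"
  by (auto simp: linear_on_def Q_def fun_eq_iff inner_on_add_left inner_on_scale_left)

lemma wreath_cone:
  assumes "\<omega> \<in> C2_pow n" "g \<in> stab n \<theta>"
  shows "wreath_perm_rep n (\<omega>, g) (cone r i (inv' g ` C) (inv' g ` D)) = chi n \<theta> \<omega> *\<^sub>C cone r i C D"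
proof -
  have g: "g permutes {1..n}" "C2_act g \<theta> = \<theta>" using assms(2) by (auto simp: stab_iff)
  show ?thesis
    unfolding cone_def wreath_perm_rep_layer_fun[OF assms(1) g(1)] g(2)
      inj_image_subset_iff[OF permutes_inj[OF permutes_inv[OF g(1)]]] ..
qed

text \<open>The action preserves the inner product and can be moved from \<open>u\<close> to the
  cone. An element of \<open>H\<close> permutes the cones up to a character value, which is real and
  its own inverse.\<close>

lemma Q_equivariant:
  assumes "h \<in> H"
  shows "Q r i (wreath_perm_rep n h u) = twisted_rep n \<theta> h (Q r i u)"
proof
  fix y
  obtain \<omega> g where h: "h = (\<omega>, g)" by (cases h)
  then have \<omega>: "\<omega> \<in> C2_pow n" and g: "g \<in> stab n \<theta>" using assms by auto
  have hG: "h \<in> carrier (wreath n)" using assms H_carrier by blast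
  show "Q r i (wreath_perm_rep n h u) y = twisted_rep n \<theta> h (Q r i u) y"
  proof (cases "y \<in> TT")
    case False
    then have "tab_act g y \<notin> TT" unfolding tab_act_mem_iff[OF g] .
    then show ?thesis
      using False by (simp add: h twisted_rep_apply[OF g] Q_def del: mem_Sigma_iff)
  next
    case True
    then obtain C D where CD: "C \<in> subsets_of_card A l" "D \<in> subsets_of_card B m"
      "y = ([A - C, C], [B - D, D])" by (auto simp: tabs_def)
    then have sub: "C \<subseteq> A" "D \<subseteq> B" by (auto simp: subsets_of_card_def)
    have ty: "tab_act g y = ([A - inv' g ` C, inv' g ` C], [B - inv' g ` D, inv' g ` D])"
      unfolding CD(3) 
      by (simp only: tab_act_def prod.case act_tab(1)[OF g sub(1)] act_tab(2)[OF g sub(2)])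
    have tT: "tab_act g y \<in> TT" using True unfolding tab_act_mem_iff[OF g] .
    have "cone r i C D = chi n \<theta> \<omega> *\<^sub>C wreath_perm_rep n h (cone r i (inv' g ` C) (inv' g ` D))"
      unfolding h wreath_cone[OF \<omega> g] by (simp add: scaleC_scaleC chi_square[OF \<omega>] scaleC_one)
    then have "inner_on (Y_set n r) (wreath_perm_rep n h u) (cone r i C D)
      = chi n \<theta> \<omega> * inner_on (Y_set n r) (wreath_perm_rep n h u)
          (wreath_perm_rep n h (cone r i (inv' g ` C) (inv' g ` D)))"
      by (simp only: inner_on_scale_right cnj_chi)
    also have "\<dots> = chi n \<theta> \<omega> * inner_on (Y_set n r) u (cone r i (inv' g ` C) (inv' g ` D))"
      by (simp only: wreath_perm_rep_unitary[OF hG])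
    finally have "Q r i (wreath_perm_rep n h u) y
      = chi n \<theta> \<omega> * inner_on (Y_set n r) u (cone r i (inv' g ` C) (inv' g ` D))"
      unfolding CD(3) Q_apply[OF CD(1,2)] .
    moreover have "inv' g ` C \<in> subsets_of_card A l" "inv' g ` D \<in> subsets_of_card B m"
      using tT unfolding ty by (auto simp: tabs_def)
    then have "Q r i u (tab_act g y) = inner_on (Y_set n r) u (cone r i (inv' g ` C) (inv' g ` D))"
      unfolding ty by (rule Q_apply)
    ultimately show ?thesis by (simp add: h twisted_rep_apply[OF g])
  qed
qed

text \<open>On each side of \<theta>, \<open>sum_subsets_alt_prod\<close> expands the alternating
  product over small subsets, which makes the generator a combination of cones. Hence the vanishing
  of \<open>Q\<close> forces orthogonality to the generators at \<theta>.\<close>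

lemma W_gen_eq_sum_cones:
  assumes "p \<in> matchings A l" "q \<in> matchings B m"
  shows "inner_on (Y_set n r) u (W_gen n r i \<theta> p q)
    = (\<Sum>C\<in>subsets_of_card A l. \<Sum>D\<in>subsets_of_card B m.
        alt_prod p C * alt_prod q D * inner_on (Y_set n r) u (cone r i C D))"
proof -
  let ?X = "subsets_of_card A l" and ?Y = "subsets_of_card B m" and ?Z = "subsets_of_card {1..n} r"
  let ?F = "\<lambda>S. \<Sum>\<omega>\<in>C2_pow n. u (\<omega>, S) * chi n \<theta> \<omega>"
  have p: "matching A p" "card p = l" and q: "matching B q" "card q = m"
    using assms by (auto simp: matchings_def)
  have expand: "alt_prod p S * alt_prod q S
    = (\<Sum>C\<in>?X. \<Sum>D\<in>?Y. alt_prod p C * alt_prod q D * (of_bool (C \<subseteq> S) * of_bool (D \<subseteq> S)))"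
    if S: "S \<in> ?Z" for S
  proof -
    have "alt_prod p S = (\<Sum>C\<in>?X. of_bool (C \<subseteq> S \<inter> A) * alt_prod p C)"
      using sum_subsets_alt_prod[OF finite_zeros p(1), of "S \<inter> A"] alt_prod_inter_zeros[OF assms(1), of S] p(2)
      by simp
    also have "\<dots> = (\<Sum>C\<in>?X. of_bool (C \<subseteq> S) * alt_prod p C)"
      by (intro sum.cong refl) (auto simp: subsets_of_card_def)
    finally have 1: "alt_prod p S = (\<Sum>C\<in>?X. of_bool (C \<subseteq> S) * alt_prod p C)" .
    have "S - A \<subseteq> B" using S by (auto simp: subsets_of_card_def)
    then have "alt_prod q S = (\<Sum>D\<in>?Y. of_bool (D \<subseteq> S - A) * alt_prod q D)"
      using sum_subsets_alt_prod[OF _ q(1), of "S - A"] alt_prod_diff_zeros[OF assms(2), of S] q(2)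
      by simp
    also have "\<dots> = (\<Sum>D\<in>?Y. of_bool (D \<subseteq> S) * alt_prod q D)"
      by (intro sum.cong refl) (auto simp: subsets_of_card_def)
    finally have 2: "alt_prod q S = (\<Sum>D\<in>?Y. of_bool (D \<subseteq> S) * alt_prod q D)" .
    show ?thesis
      unfolding 1 2 sum_product by (simp only: mult_ac)
  qed
  have "inner_on (Y_set n r) u (W_gen n r i \<theta> p q)
    = (\<Sum>S\<in>?Z. \<Sum>C\<in>?X. \<Sum>D\<in>?Y. alt_prod p C * alt_prod q D *
        (if card (S \<inter> A) = i then ?F S * (of_bool (C \<subseteq> S) * of_bool (D \<subseteq> S)) else 0))"
    unfolding inner_on_W_gen
  proof (rule sum.cong[OF refl])
    fix S assume S: "S \<in> ?Z"
    show "(if card (S \<inter> A) = i then ?F S * (alt_prod p S * alt_prod q S) else 0)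
      = (\<Sum>C\<in>?X. \<Sum>D\<in>?Y. alt_prod p C * alt_prod q D *
        (if card (S \<inter> A) = i then ?F S * (of_bool (C \<subseteq> S) * of_bool (D \<subseteq> S)) else 0))"
    proof (cases "card (S \<inter> A) = i")
      case True
      show ?thesis unfolding if_P[OF True] expand[OF S] sum_distrib_left by (simp only: mult_ac)
    next
      case False
      show ?thesis unfolding if_not_P[OF False] by simp
    qed
  qed
  also have "\<dots> = (\<Sum>C\<in>?X. \<Sum>S\<in>?Z. \<Sum>D\<in>?Y. alt_prod p C * alt_prod q D *
        (if card (S \<inter> A) = i then ?F S * (of_bool (C \<subseteq> S) * of_bool (D \<subseteq> S)) else 0))"
    by (rule sum.swap)
  also have "\<dots> = (\<Sum>C\<in>?X. \<Sum>D\<in>?Y. \<Sum>S\<in>?Z. alt_prod p C * alt_prod q D *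
        (if card (S \<inter> A) = i then ?F S * (of_bool (C \<subseteq> S) * of_bool (D \<subseteq> S)) else 0))"
    by (intro sum.cong refl sum.swap)
  also have "\<dots> = (\<Sum>C\<in>?X. \<Sum>D\<in>?Y.
        alt_prod p C * alt_prod q D * inner_on (Y_set n r) u (cone r i C D))"
    by (simp only: cone_def inner_on_layer_fun complex_cnj_mult cnj_of_bool sum_distrib_left)
  finally show ?thesis .
qed

text \<open>Generators at another \<theta>' are orthogonal to every cone by orthogonality of
  characters. At \<theta> itself the sum over \<open>S\<close> factors, and the superset sums on the
  two sides return \<open>c\<close> and \<open>d\<close> times the alternating products, so the
  result is a multiple of \<open>E p q\<close>.\<close>

lemma Q_W_gen:
  assumes \<theta>': "\<theta>' \<in> C2_pow n" and p: "p \<in> matchings (zeros n \<theta>') l"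
    and q: "q \<in> matchings ({1..n} - zeros n \<theta>') m"
    and r: "l \<le> i" "l + i \<le> card A" "i \<le> r" "m \<le> r - i" "m + (r - i) \<le> card B"
  shows "Q r i (W_gen n r i \<theta>' p q) \<in> V"
proof -
  let ?u = "W_gen n r i \<theta>' p q" and ?N = "of_nat (card (C2_pow n)) :: complex"
  let ?Z = "subsets_of_card {1..n} r"
  have inner: "inner_on (Y_set n r) ?u (cone r i C D)
    = (\<Sum>S\<in>?Z. if card (S \<inter> A) = i then
        (if \<theta>' = \<theta> then ?N * (alt_prod p S * alt_prod q S) * (of_bool (C \<subseteq> S) * of_bool (D \<subseteq> S)) else 0) else 0)"
    for C D
    unfolding cone_def inner_on_layer_fun W_gen_def
  proof (rule sum.cong[OF refl])
    fix S assume S: "S \<in> ?Z"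
    show "(if card (S \<inter> A) = i then (\<Sum>\<omega>\<in>C2_pow n. layer_fun n r i \<theta>' (\<lambda>A. alt_prod p A * alt_prod q A) (\<omega>, S)
        * chi n \<theta> \<omega>) * cnj (of_bool (C \<subseteq> S) * of_bool (D \<subseteq> S)) else 0)
      = (if card (S \<inter> A) = i then (if \<theta>' = \<theta> then ?N * (alt_prod p S * alt_prod q S) *
          (of_bool (C \<subseteq> S) * of_bool (D \<subseteq> S)) else 0) else 0)"
      unfolding sum_layer_fun_chi[OF \<theta>' \<theta> S] by (cases "\<theta>' = \<theta>") simp_all
  qed
  show ?thesis
  proof (cases "\<theta>' = \<theta>")
    case False
    have "inner_on (Y_set n r) ?u (cone r i C D) = 0" for C D
      unfolding inner if_not_P[OF False] by simp
    then have "Q r i ?u = 0" by (simp add: Q_def fun_eq_iff)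
    then show ?thesis by (simp add: V_def cvec.span_zero)
  next
    case True
    have p': "p \<in> matchings A l" and q': "q \<in> matchings B m" using p q True by auto
    have mp: "matching A p" "card p = l" and mq: "matching B q" "card q = m"
      using p' q' by (auto simp: matchings_def)
    obtain c where c: "\<And>C. C \<in> subsets_of_card A l \<Longrightarrow>
      (\<Sum>S\<in>subsets_of_card A i. of_bool (C \<subseteq> S) * alt_prod p S) = c * alt_prod p C"
      using sum_supersets_alt_prod[OF finite_zeros mp(1), of i] mp(2) r(1,2) by metis
    obtain d where d: "\<And>D. D \<in> subsets_of_card B m \<Longrightarrow>
      (\<Sum>S\<in>subsets_of_card B (r - i). of_bool (D \<subseteq> S) * alt_prod q S) = d * alt_prod q D"
      using sum_supersets_alt_prod[OF finite_Diff[OF finite_atLeastAtMost] mq(1), of "r - i"] mq(2) r(4,5) by metis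
    have "inner_on (Y_set n r) ?u (cone r i C D) = ?N * c * d * (alt_prod p C * alt_prod q D)"
      if C: "C \<in> subsets_of_card A l" and D: "D \<in> subsets_of_card B m" for C D
    proof -
      have sub: "C \<subseteq> A" "D \<subseteq> B" using C D by (auto simp: subsets_of_card_def)
      have "inner_on (Y_set n r) ?u (cone r i C D) = (\<Sum>S\<in>?Z. if card (S \<inter> A) = i then
        ?N * (alt_prod p S * alt_prod q S) * (of_bool (C \<subseteq> S) * of_bool (D \<subseteq> S)) else 0)"
        unfolding inner if_P[OF True] ..
      also have "\<dots> = (\<Sum>S\<in>subsets_of_card A i. \<Sum>T\<in>subsets_of_card B (r - i).
        ?N * (alt_prod p (S \<union> T) * alt_prod q (S \<union> T)) * (of_bool (C \<subseteq> S \<union> T) * of_bool (D \<subseteq> S \<union> T)))"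
        by (rule sum_split_subsets[OF _ zeros_subset r(3)]) simp
      also have "\<dots> = (\<Sum>S\<in>subsets_of_card A i. \<Sum>T\<in>subsets_of_card B (r - i).
        ?N * ((of_bool (C \<subseteq> S) * alt_prod p S) * (of_bool (D \<subseteq> T) * alt_prod q T)))"
      proof (intro sum.cong refl)
        fix S T assume ST: "S \<in> subsets_of_card A i" "T \<in> subsets_of_card B (r - i)"
        then have "(S \<union> T) \<inter> A = S" "(S \<union> T) - A = T" by (auto simp: subsets_of_card_def)
        then have "alt_prod p (S \<union> T) = alt_prod p S" "alt_prod q (S \<union> T) = alt_prod q T"
          using alt_prod_inter_zeros[OF p', of "S \<union> T"] alt_prod_diff_zeros[OF q', of "S \<union> T"] by simp_all
        moreover have "C \<subseteq> S \<union> T \<longleftrightarrow> C \<subseteq> S" "D \<subseteq> S \<union> T \<longleftrightarrow> D \<subseteq> T"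
          using sub ST by (auto simp: subsets_of_card_def)
        ultimately show "?N * (alt_prod p (S \<union> T) * alt_prod q (S \<union> T)) * (of_bool (C \<subseteq> S \<union> T) * of_bool (D \<subseteq> S \<union> T))
          = ?N * ((of_bool (C \<subseteq> S) * alt_prod p S) * (of_bool (D \<subseteq> T) * alt_prod q T))"
          by simp
      qed
      also have "\<dots> = ?N * ((\<Sum>S\<in>subsets_of_card A i. of_bool (C \<subseteq> S) * alt_prod p S)
          * (\<Sum>T\<in>subsets_of_card B (r - i). of_bool (D \<subseteq> T) * alt_prod q T))"
        by (subst sum_product) (simp only: sum_distrib_left)
      finally show ?thesis unfolding c[OF C] d[OF D] by simp
    qed
    note val = this
    have "Q r i ?u y = (?N * c * d) * E p q y" for y
    proof (cases "y \<in> TT")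
      case True
      then obtain C D where CD: "C \<in> subsets_of_card A l" "D \<in> subsets_of_card B m"
        "y = ([A - C, C], [B - D, D])" by (auto simp: tabs_def)
      show ?thesis
        unfolding CD(3) Q_apply[OF CD(1,2)] val[OF CD(1,2)] E_apply[OF p' q' CD(1,2)] ..
    next
      case False
      then show ?thesis using functions_onD[OF E_functions[OF p' q'] False] by (simp add: Q_def del: mem_Sigma_iff)
    qed
    then have "Q r i ?u = (?N * c * d) *\<^sub>C E p q" by (simp add: fun_eq_iff)
    moreover have "E p q \<in> V" unfolding V_def using p' q' by (intro cvec.span_base) blast
    ultimately show ?thesis by (simp add: V_def cvec.span_scale)
  qed
qed

end

text \<open>\<open>Q\<close> sees only the part of a function belonging to the fixed \<theta>, so
  generators at other points have to be reached from there by the group; any two \<theta> with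
  equally many zeros are related by a permutation.\<close>

lemma W_gen_transitive:
  assumes \<theta>: "\<theta> \<in> C2_pow n" and s: "s \<in> W_gens n r (card (zeros n \<theta>), i, l, m)"
  obtains g p q where "(0, g) \<in> carrier (wreath n)" "p \<in> matchings (zeros n \<theta>) l"
    "q \<in> matchings ({1..n} - zeros n \<theta>) m" "wreath_perm_rep n (0, g) (W_gen n r i \<theta> p q) = s"
proof -
  obtain \<theta>' p' q' where s': "s = W_gen n r i \<theta>' p' q'" "\<theta>' \<in> C2_pow n"
    "card (zeros n \<theta>') = card (zeros n \<theta>)"
    "p' \<in> matchings (zeros n \<theta>') l" "q' \<in> matchings ({1..n} - zeros n \<theta>') m"
    using s by (rule W_gens_E)
  obtain g where g: "g permutes {1..n}" "g ` zeros n \<theta> = zeros n \<theta>'"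
    using exists_permutation_image[OF _ zeros_subset zeros_subset s'(3)[symmetric]] by auto
  have act: "C2_act g \<theta> = \<theta>'"
    by (rule C2_eqI[OF C2_pow_act[OF g(1) \<theta>] s'(2)]) (simp add: zeros_act[OF g(1)] g(2))
  note g' = permutes_inv[OF g(1)]
  have act': "C2_act (inv' g) \<theta>' = \<theta>" using C2_act_inv(2)[OF g(1), of \<theta>] act by simp
  let ?p = "map_prod (inv' g) (inv' g) ` p'" and ?q = "map_prod (inv' g) (inv' g) ` q'"
  have pq: "?p \<in> matchings (zeros n \<theta>) l" "?q \<in> matchings ({1..n} - zeros n \<theta>) m"
    using W_gens_image(3,4)[OF g' s'(2,3,4,5)] unfolding act' .
  have "map_prod g g ` map_prod (inv' g) (inv' g) ` x = x" for x
    using permutes_inverses(1)[OF g(1)] by (simp add: image_comp comp_def map_prod_def case_prod_beta)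
  then have "wreath_perm_rep n (0, g) (W_gen n r i \<theta> ?p ?q) = s"
    unfolding wreath_perm_rep_W_gen[OF zero_C2_pow g(1)] act s'(1) by (simp only: chi_0 scaleC_one)
  then show ?thesis using that[OF _ pq] g(1) by simp
qed

lemma W_space_nonzero:
  assumes x: "(k, i, l, m) \<in> W_index n r" and \<theta>: "\<theta> \<in> C2_pow n" "card (zeros n \<theta>) = k"
  shows "W_space n r (k, i, l, m) \<noteq> {0}"
proof
  let ?A = "zeros n \<theta>" and ?B = "{1..n} - zeros n \<theta>"
  have cB: "card ?B = n - k" using card_zeros_complement \<theta>(2) by simp
  have num: "l \<le> i" "l + i \<le> card ?A" "m \<le> r - i" "m + (r - i) \<le> card ?B" "i \<le> r"
    using x \<theta>(2) cB by (auto simp: W_index_def)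
  obtain p where p: "p \<in> matchings ?A l" using matchings_nonempty[of ?A l] num by auto
  obtain q where q: "q \<in> matchings ?B m" using matchings_nonempty[of ?B m] num by auto
  obtain C where C: "C \<in> subsets_of_card ?A i" "alt_prod p C \<noteq> 0"
    using alt_prod_nonzero_exists[of ?A p i] p num by (auto simp: matchings_def)
  obtain D where D: "D \<in> subsets_of_card ?B (r - i)" "alt_prod q D \<noteq> 0"
    using alt_prod_nonzero_exists[of ?B q "r - i"] q num by (auto simp: matchings_def)
  have S: "C \<union> D \<in> {S \<in> subsets_of_card {1..n} r. card (S \<inter> ?A) = i}"
    using bij_split_subsets[OF finite_atLeastAtMost zeros_subset num(5), of n \<theta>] C(1) D(1)
    unfolding bij_betw_def by blast
  have "(C \<union> D) \<inter> ?A = C" "(C \<union> D) - ?A = D" using C(1) D(1) by (auto simp: subsets_of_card_def)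
  then have "alt_prod p (C \<union> D) \<noteq> 0" "alt_prod q (C \<union> D) \<noteq> 0"
    using alt_prod_inter_zeros[OF p, of "C \<union> D"] alt_prod_diff_zeros[OF q, of "C \<union> D"] C(2) D(2) by auto
  then have "W_gen n r i \<theta> p q (0, C \<union> D) \<noteq> 0"
    using S by (simp add: W_gen_def layer_fun_def tensor_fun_def)
  moreover assume "W_space n r (k, i, l, m) = {0}"
  then have "W_gen n r i \<theta> p q = 0"
    using W_space_eq[OF x] cvec.span_base[OF W_gens_I[OF \<theta> p q, of r i]] by auto
  ultimately show False by simp
qed

lemma W_irreducible:
  assumes x: "(k, i, l, m) \<in> W_index n r" and th: "\<theta> \<in> C2_pow n" "card (zeros n \<theta>) = k"
  shows "irreducible_rep (wreath n) (rho_space n \<theta> [k - l, l] [n - k - m, m]) (ind_rep (wreath n))"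
    and "rep_iso (wreath n) (W_space n r (k, i, l, m)) (wreath_perm_rep n)
      (rho_space n \<theta> [k - l, l] [n - k - m, m]) (ind_rep (wreath n))"
proof -
  let ?A = "zeros n \<theta>" and ?B = "{1..n} - zeros n \<theta>" and ?G = "wreath n"
  have cB: "card ?B = n - k" using card_zeros_complement th(2) by simp
  have num: "l \<le> i" "l + i \<le> card ?A" "i \<le> r" "m \<le> r - i" "m + (r - i) \<le> card ?B"
    using x th(2) cB by (auto simp: W_index_def)
  interpret specht_pair n l m \<theta>
    using th(1) num by unfold_locales auto
  interpret G: group ?G by (rule group_wreath)
  have R: "rho_space n \<theta> [k - l, l] [n - k - m, m] = R"
    using rho_space_eq cB th(2) by simp
  let ?W = "W_space n r (k, i, l, m)"
  have W: "?W = cvec.span (W_gens n r (k, i, l, m))" by (rule W_space_eq[OF x])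
  interpret W: group_rep ?G ?W "wreath_perm_rep n" by (rule group_rep_W[OF x])
  have QV: "Q r i u \<in> V" if "u \<in> ?W" for u
    unfolding V_def
  proof (rule linear_on_span_closed[OF linear_on_Q _ that[unfolded W]])
    fix s assume "s \<in> W_gens n r (k, i, l, m)"
    then show "Q r i s \<in> cvec.span {E p q |p q. p \<in> matchings ?A l \<and> q \<in> matchings ?B m}"
      using Q_W_gen[OF _ _ _ num] unfolding V_def by (auto elim!: W_gens_E)
  qed
  \<comment> \<open>The intertwiner of Frobenius reciprocity: its value at \<open>a\<close> is the
    \<open>H\<close>-equivariant map \<open>Q\<close> applied to the translate of \<open>w\<close>
    by the inverse of \<open>a\<close>.\<close>
  define T where "T w = (\<lambda>a. if a \<in> carrier ?G then Q r i (wreath_perm_rep n (inv\<^bsub>?G\<^esub> a) w) else 0)" for w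
  have lin: "linear_on ?W T"
    unfolding linear_on_def
  proof (intro conjI ballI allI)
    fix u v assume uv: "u \<in> ?W" "v \<in> ?W"
    show "T (u + v) = T u + T v"
    proof
      fix a
      show "T (u + v) a = (T u + T v) a"
        using uv W.linear[OF G.inv_closed, of a] linear_on_Q[of UNIV r i]
        by (simp add: T_def linear_on_def)
    qed
  next
    fix c v assume v: "v \<in> ?W"
    show "T (c *\<^sub>C v) = c *\<^sub>C T v"
    proof
      fix a
      show "T (c *\<^sub>C v) a = (c *\<^sub>C T v) a"
        using v W.linear[OF G.inv_closed, of a] linear_on_Q[of UNIV r i]
        by (simp add: T_def linear_on_def)
    qed
  qed
  have TR: "T w \<in> R" if w: "w \<in> ?W" for w
    unfolding ind_space_def
  proof (intro CollectI conjI allI ballI impI)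
    fix a assume a: "a \<in> carrier ?G"
    show "T w a \<in> V" using a w by (simp add: T_def QV W.closed)
    fix h assume h: "h \<in> H"
    then have hG: "h \<in> carrier ?G" using H_carrier by blast
    have "wreath_perm_rep n (inv\<^bsub>?G\<^esub> (a \<otimes>\<^bsub>?G\<^esub> h)) w
      = wreath_perm_rep n (inv\<^bsub>?G\<^esub> h) (wreath_perm_rep n (inv\<^bsub>?G\<^esub> a) w)"
      using a hG w by (simp only: G.inv_mult_group W.rep_mult G.inv_closed)
    then show "T w (a \<otimes>\<^bsub>?G\<^esub> h) = twisted_rep n \<theta> (inv\<^bsub>?G\<^esub> h) (T w a)"
      using a hG by (simp only: T_def G.m_closed if_True Q_equivariant[OF H_inv[OF h]])
  qed (simp only: T_def if_False)
  have equi: "T (wreath_perm_rep n b w) = ind_rep ?G b (T w)" if b: "b \<in> carrier ?G" and w: "w \<in> ?W" for b w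
  proof
    fix a
    show "T (wreath_perm_rep n b w) a = ind_rep ?G b (T w) a"
    proof (cases "a \<in> carrier ?G")
      case a: True
      have "inv\<^bsub>?G\<^esub> (inv\<^bsub>?G\<^esub> b \<otimes>\<^bsub>?G\<^esub> a) = inv\<^bsub>?G\<^esub> a \<otimes>\<^bsub>?G\<^esub> b"
        using a b by (simp only: G.inv_mult_group G.inv_closed G.inv_inv)
      then have "T w (inv\<^bsub>?G\<^esub> b \<otimes>\<^bsub>?G\<^esub> a) = Q r i (wreath_perm_rep n (inv\<^bsub>?G\<^esub> a) (wreath_perm_rep n b w))"
        using a b w by (simp only: T_def G.m_closed G.inv_closed if_True W.rep_mult)
      then show ?thesis using a by (simp only: ind_rep_apply) (simp only: T_def if_True)
    qed (simp only: T_def ind_rep_def if_False)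
  qed
  have ker: "w = 0" if w: "w \<in> ?W" "T w = 0" for w
  proof -
    \<comment> \<open>Vanishing of \<open>T w\<close> at \<open>(0, g)\<close> makes a translate of
      \<open>w\<close> orthogonal to the generators at \<theta>; by unitarity \<open>w\<close> is
      orthogonal to their images under \<open>(0, g)\<close>, and every generator is such an
      image.\<close>
    have "inner_on (Y_set n r) w s = 0" if s: "s \<in> W_gens n r (k, i, l, m)" for s
    proof -
      obtain g p q where g: "(0, g) \<in> carrier ?G" "p \<in> matchings ?A l" "q \<in> matchings ?B m"
        "wreath_perm_rep n (0, g) (W_gen n r i \<theta> p q) = s"
        using W_gen_transitive[OF th(1) s[folded th(2)]] .
      let ?a = "(0 :: nat \<Rightarrow> bit, g)"
      let ?w = "wreath_perm_rep n (inv\<^bsub>?G\<^esub> ?a) w"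
      have "Q r i ?w = 0"
        using fun_cong[OF w(2), of ?a] g(1) by (simp add: T_def)
      then have "inner_on (Y_set n r) ?w (cone r i C D) = 0"
        if "C \<in> subsets_of_card ?A l" "D \<in> subsets_of_card ?B m" for C D
        using Q_apply[OF that, of r i ?w] by simp
      then have "inner_on (Y_set n r) ?w (W_gen n r i \<theta> p q) = 0"
        unfolding W_gen_eq_sum_cones[OF g(2,3)] by simp
      moreover have "wreath_perm_rep n ?a ?w = w"
        using W.rep_mult[OF g(1) G.inv_closed[OF g(1)] w(1)] W.rep_one[OF w(1)] G.r_inv[OF g(1)] by simp
      ultimately show ?thesis
        using wreath_perm_rep_unitary[OF g(1), of r ?w "W_gen n r i \<theta> p q"] g(4) by simp
    qed
    then have self: "inner_on (Y_set n r) w w = 0" by (rule inner_on_span[OF _ w(1)[unfolded W]])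
    have mem: "w \<in> functions_on (Y_set n r)"
    proof -
      have "cvec.span (W_gens n r (k, i, l, m)) \<subseteq> functions_on (Y_set n r)"
        using W_gens_subset[of n r "(k, i, l, m)"] unfolding L_space_def
        by (rule cvec.span_minimal[OF _ subspace_functions_on])
      then show ?thesis using w(1) unfolding W by blast
    qed
    show "w = 0" by (rule inner_on_self_functions[OF _ self mem]) simp
  qed
  have "rep_iso ?G ?W (wreath_perm_rep n) R (ind_rep ?G) \<and> irreducible_rep ?G R (ind_rep ?G)"
  proof (rule rep_iso_of_irreducible[where T = T])
    show "?W \<noteq> {0}" by (rule W_space_nonzero[OF x th])
  qed (fact group_rep_W[OF x] group_rep_R lin | rule TR equi ker subrep_eq_R, assumption+)+
  then show "irreducible_rep ?G (rho_space n \<theta> [k - l, l] [n - k - m, m]) (ind_rep ?G)"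
    "rep_iso ?G ?W (wreath_perm_rep n) (rho_space n \<theta> [k - l, l] [n - k - m, m]) (ind_rep ?G)"
    unfolding R by simp_all
qed

theorem theorem9p1:
  fixes n r :: nat and \<theta> :: "nat \<Rightarrow> nat \<Rightarrow> bit"
  assumes "n \<ge> 2" and "1 \<le> r" and "r \<le> n - 1"
    and "\<And>k. k \<le> n \<Longrightarrow> \<theta> k \<in> C2_pow n \<and> card (zeros n (\<theta> k)) = k"
  shows "group_rep (wreath n) (L_space n r) (wreath_perm_rep n)
    \<and> is_direct_sum (L_space n r) (W_index n r) (W_space n r)
    \<and> (\<forall>(k, i, l, m) \<in> W_index n r.
         group_rep (wreath n) (W_space n r (k, i, l, m)) (wreath_perm_rep n)
         \<and> irreducible_rep (wreath n)
             (rho_space n (\<theta> k) [k - l, l] [n - k - m, m]) (ind_rep (wreath n))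
         \<and> rep_iso (wreath n)
             (W_space n r (k, i, l, m)) (wreath_perm_rep n)
             (rho_space n (\<theta> k) [k - l, l] [n - k - m, m]) (ind_rep (wreath n)))"
proof (intro conjI)
  show "group_rep (wreath n) (L_space n r) (wreath_perm_rep n)" by (rule group_rep_L_space)
  show "is_direct_sum (L_space n r) (W_index n r) (W_space n r)" by (rule is_direct_sum_W)
  have "group_rep (wreath n) (W_space n r (k, i, l, m)) (wreath_perm_rep n)
         \<and> irreducible_rep (wreath n)
             (rho_space n (\<theta> k) [k - l, l] [n - k - m, m]) (ind_rep (wreath n))
         \<and> rep_iso (wreath n)
             (W_space n r (k, i, l, m)) (wreath_perm_rep n)
             (rho_space n (\<theta> k) [k - l, l] [n - k - m, m]) (ind_rep (wreath n))"
    if x: "(k, i, l, m) \<in> W_index n r" for k i l m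
  proof -
    have "k \<le> n" using x by (auto simp: W_index_def)
    with assms(4) have "\<theta> k \<in> C2_pow n" "card (zeros n (\<theta> k)) = k" by auto
    then show ?thesis using group_rep_W[OF x] W_irreducible[OF x] by blast
  qed
  then show "\<forall>(k, i, l, m) \<in> W_index n r.
         group_rep (wreath n) (W_space n r (k, i, l, m)) (wreath_perm_rep n)
         \<and> irreducible_rep (wreath n)
             (rho_space n (\<theta> k) [k - l, l] [n - k - m, m]) (ind_rep (wreath n))
         \<and> rep_iso (wreath n)
             (W_space n r (k, i, l, m)) (wreath_perm_rep n)
             (rho_space n (\<theta> k) [k - l, l] [n - k - m, m]) (ind_rep (wreath n))"
    by blast
qed


end
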